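(* Let $\Omega\subset\mathbb{R}^N$ be a bounded $C^2$ domain, and let $u$ satisfy $$\begin{cases}\mathcal{I}_N^-u\le0&\text{in }\Omega\\ u\ge0&\text{in }\mathbb{R}^N\setminus\Omega.\end{cases}$$ Assume $u\not\equiv0$ in $\Omega$. Then there exists a positive constant $c=c(\Omega,u)$ such that $$u(x)\ge c\,d(x)^s\qquad\forall x\in\overline\Omega.$$
   Context: Fix $s\in(0,1)$. $d(x)=\inf_{y\in\partial\Omega}|x-y|$ is the distance to $\partial\Omega$. Set $\delta(u,x,y)=u(x+y)+u(x-y)-2u(x)$, let $C_s=C_{1,s}>0$ be the normalizing constant of the one-dimensional fractional Laplacian, and let $\mathcal{V}_N$ be the family of orthonormal bases of $\mathbb{R}^N$. The operator is $\mathcal{I}_N^-u(x)=\inf_{\{\xi_i\}\in\mathcal{V}_N}\sum_{i=1}^N\mathcal{I}_{\xi_i}u(x)$, where $\mathcal{I}_\xi u(x)=C_s\int_0^{+\infty}\delta(u,x,\tau\xi)\tau^{-1-2s}\,d\tau$. The inequality $\mathcal{I}_N^-u\le0$ in $\Omega$ is in the viscosity sense: $u\in L^\infty(\mathbb{R}^N)\cap LSC(\Omega)$ (bounded measurable, defined at every point, lower semicontinuous in $\Omega$), and for every $x_0\in\Omega$, $\rho>0$ and $\varphi\in C^2(B_\rho(x_0))$ such that $x_0$ is a minimum point of $u-\varphi$ in $B_\rho(x_0)$, $$C_s\inf_{\{\xi_i\}\in\mathcal{V}_N}\sum_{i=1}^N\left(\int_0^\rho\frac{\delta(\varphi,x_0,\tau\xi_i)}{\tau^{1+2s}}\,d\tau+\int_\rho^{+\infty}\frac{\delta(u,x_0,\tau\xi_i)}{\tau^{1+2s}}\,d\tau\right)\le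 0.$$ *)

theory Defs
  imports "HOL-Analysis.Analysis"
begin

text \<open>
  \<open>C2_on f S\<close>, for open \<open>S\<close>: the witnesses \<open>Df\<close> and \<open>D2f\<close> are the gradient and the Hessian of \<open>f\<close>.
\<close>
definition C2_on :: "('a::euclidean_space \<Rightarrow> real) \<Rightarrow> 'a set \<Rightarrow> bool" where
  "C2_on f S \<longleftrightarrow>
     (\<exists>(Df :: 'a \<Rightarrow> 'a) (D2f :: 'a \<Rightarrow> 'a \<Rightarrow>\<^sub>L 'a).
        (\<forall>x\<in>S. (f has_derivative (\<lambda>h. Df x \<bullet> h)) (at x)) \<and>
        (\<forall>x\<in>S. (Df has_derivative blinfun_apply (D2f x)) (at x)) \<and>
        continuous_on S D2f)"

text \<open>
  Near each boundary point the set is the part of a ball strictly above a \<open>C\<^sup>2\<close> graph over the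
  hyperplane orthogonal to a unit vector \<open>\<nu>\<close>.  Functions on that hyperplane are represented by
  functions \<open>\<gamma>\<close> on the whole space that are only evaluated at the projection
  \<open>x - (x \<bullet> \<nu>) \<nu>\<close>; every \<open>C\<^sup>2\<close> function on the hyperplane arises in this way.
\<close>
definition C2_boundary :: "'a::euclidean_space set \<Rightarrow> bool" where
  "C2_boundary \<Omega> \<longleftrightarrow>
     (\<forall>p\<in>frontier \<Omega>. \<exists>r>0. \<exists>\<nu> \<gamma>. norm \<nu> = 1 \<and> C2_on \<gamma> UNIV \<and>
        \<Omega> \<inter> ball p r = {x \<in> ball p r. x \<bullet> \<nu> > \<gamma> (x - (x \<bullet> \<nu>) *\<^sub>R \<nu>)})"

definition bounded_C2_domain :: "'a::euclidean_space set \<Rightarrow> bool" where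
  "bounded_C2_domain \<Omega> \<longleftrightarrow>
     open \<Omega> \<and> connected \<Omega> \<and> \<Omega> \<noteq> {} \<and> bounded \<Omega> \<and> C2_boundary \<Omega>"

definition lsc_on :: "('a::topological_space \<Rightarrow> real) \<Rightarrow> 'a set \<Rightarrow> bool" where
  "lsc_on u S \<longleftrightarrow> (\<forall>x\<in>S. \<forall>a<u x. eventually (\<lambda>y. a < u y) (at x within S))"

definition delta :: "('a::real_vector \<Rightarrow> real) \<Rightarrow> 'a \<Rightarrow> 'a \<Rightarrow> real" where
  "delta u x y = u (x + y) + u (x - y) - 2 * u x"

text \<open>
  The constant \<open>C\<^bsub>1,s\<^esub>\<close> for which \<open>C\<^bsub>1,s\<^esub> \<integral>\<^sub>0\<^sup>\<infinity> delta v x \<tau> / \<tau>\<^bsup>1+2s\<^esup> d\<tau>\<close> equals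
  \<open>- (- \<Delta>)\<^sup>s v x\<close> on the real line, i.e. the operator with Fourier symbol \<open>- \<bar>\<xi>\<bar>\<^bsup>2s\<^esup>\<close>.
\<close>
definition C_frac :: "real \<Rightarrow> real" where
  "C_frac s = 4 powr s * s * Gamma (1 / 2 + s) / (sqrt pi * Gamma (1 - s))"

text \<open>
  Integrals are extended-real valued, as positive part minus negative part.  A test function need
  not be bounded below on its ball, so \<open>\<integral>\<^sub>0\<^sup>\<rho>\<close> below can be \<open>-\<infinity>\<close>, whereas the Bochner integral
  would return \<open>0\<close>.  Positive parts are finite wherever this is used, so \<open>\<infinity> - \<infinity>\<close> does not occur.
  Along a line on which a Lebesgue measurable \<open>u\<close> fails to be measurable, each part is a lower integral.
\<close>
definition ext_integral :: "real set \<Rightarrow> (real \<Rightarrow> real) \<Rightarrow> ereal" where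
  "ext_integral A f =
     enn2ereal (\<integral>\<^sup>+\<tau>\<in>A. ennreal (f \<tau>) \<partial>lebesgue)
     - enn2ereal (\<integral>\<^sup>+\<tau>\<in>A. ennreal (- f \<tau>) \<partial>lebesgue)"

definition orthonormal_bases :: "('n::finite \<Rightarrow> real ^ 'n) set" where
  "orthonormal_bases =
     {\<xi>. (\<forall>i j. \<xi> i \<bullet> \<xi> j = (if i = j then 1 else 0)) \<and> span (range \<xi>) = UNIV}"

text \<open>
  \<open>I_minus_test s \<rho> \<phi> u x\<close> is the minimal operator evaluated at \<open>x\<close> on the function equal to
  \<open>\<phi>\<close> at distance less than \<open>\<rho>\<close> and to \<open>u\<close> further away.
\<close>
definition I_minus_test ::
    "real \<Rightarrow> real \<Rightarrow> (real ^ 'n::finite \<Rightarrow> real) \<Rightarrow> (real ^ 'n \<Rightarrow> real) \<Rightarrow> real ^ 'n \<Rightarrow> ereal" where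
  "I_minus_test s \<rho> \<phi> u x =
     ereal (C_frac s) *
     (INF \<xi>\<in>orthonormal_bases. \<Sum>i\<in>UNIV.
        ext_integral {0<..<\<rho>} (\<lambda>\<tau>. delta \<phi> x (\<tau> *\<^sub>R \<xi> i) / \<tau> powr (1 + 2 * s))
        + ext_integral {\<rho>..} (\<lambda>\<tau>. delta u x (\<tau> *\<^sub>R \<xi> i) / \<tau> powr (1 + 2 * s)))"

text \<open>
  \<open>u\<close> is a viscosity solution of \<open>\<I>\<^sub>N\<^sup>- u \<le> 0\<close> in \<open>\<Omega>\<close>.  The values of \<open>\<phi>\<close> outside
  \<open>ball x\<^sub>0 \<rho>\<close> play no role.
\<close>
definition visc_supersolution :: "real \<Rightarrow> (real ^ 'n::finite) set \<Rightarrow> (real ^ 'n \<Rightarrow> real) \<Rightarrow> bool" where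
  "visc_supersolution s \<Omega> u \<longleftrightarrow>
     u \<in> borel_measurable lebesgue \<and> bounded (range u) \<and> lsc_on u \<Omega> \<and>
     (\<forall>x\<^sub>0\<in>\<Omega>. \<forall>\<rho>>0. \<forall>\<phi>.
        C2_on \<phi> (ball x\<^sub>0 \<rho>) \<and> (\<forall>y\<in>ball x\<^sub>0 \<rho>. u x\<^sub>0 - \<phi> x\<^sub>0 \<le> u y - \<phi> y)
        \<longrightarrow> I_minus_test s \<rho> \<phi> u x\<^sub>0 \<le> 0)"

end

theory Submission
  imports Defs
begin

text \<open>
  A basis of \<open>\<real>\<^sup>N\<close> always contains a direction making a cosine of at least \<open>1 / \<surd>N\<close> with a given
  vector, so from a point near the surface of a ball (on either side) one line of every orthonormal
  basis crosses a definite portion of a slightly smaller concentric ball.  If \<open>u\<close> exceeds its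
  touching test function by a fixed amount on that ball, the operator picks up a definite
  positive contribution there.  With exterior balls this gives \<open>u \<ge> 0\<close>, with a ball touching the
  zero set it gives \<open>u > 0\<close> in \<open>\<Omega>\<close>, and with interior balls it makes
  \<open>\<eta> (r\<^sup>2 - \<bar>x - z\<bar>\<^sup>2)\<^sub>+\<^sup>s\<close>, for small \<open>\<eta>\<close>, a lower barrier.  The last step requires the fractional
  operator of the barrier to be bounded below on every line.  There the barrier is a product
  \<open>g h\<close> of two functions \<open>(a \<plusminus> \<tau>)\<^sub>+\<^sup>s\<close>, both \<open>s\<close>-harmonic, so only the integral of
  \<open>(g(\<tau>) - g(0)) (h(\<tau>) - h(0))\<close> is left, which is bounded uniformly in the line.
\<close>


text \<open>Cost and gain scale alike: at length scale \<open>t\<close>, both the integrals around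
  the touching point and the one over the distant ball are of order t^(-2s), so the estimates do not
  degenerate at the boundary. Nonnegativity depends on this. Lower semicontinuity holds only inside
  \<Omega>, so the infimum of \<open>u\<close> may be approached only at the boundary; a
  near-minimum point is turned into a true one by a paraboloid whose opening is adapted to its
  distance from the boundary. The barrier enters only through a lower bound for its operator that is
  proportional to \<eta>, whereas the gain is fixed by a positive lower bound of \<open>u\<close> on
  an inner ball; hence a small \<eta> decides. The bound must hold up to the sphere, where the
  second derivatives of the barrier blow up. The exponent \<open>s\<close> is the one that makes
  both half-line factors harmonic and leaves a scale invariant remainder. Every estimate uses an
  explicit integrable minorant on the half-line, because \<open>u\<close> may be nonmeasurable along
  single lines, where monotonicity of the integral still holds.\<close>

section \<open>Powers of the distance in one dimension\<close>

text \<open>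
  A primitive of \<open>z\<^sup>s\<^sup>-\<^sup>1 (1 - z\<^sup>s) (1 - z)\<^sup>-\<^sup>1\<^sup>-\<^sup>2\<^sup>s\<close>, in the variable \<open>w = z\<^sup>s\<close> to remove the singularity
  at \<open>0\<close>.  It is the non-elementary part of the primitives of \<open>((1 \<plusminus> \<tau>)\<^sup>s - 1) \<tau>\<^sup>-\<^sup>1\<^sup>-\<^sup>2\<^sup>s\<close>,
  evaluated at \<open>z = 1 - \<tau>\<close> and at \<open>z = 1 / (1 + \<tau>)\<close>, and cancels in their sum.
\<close>
definition kern_prim :: "real \<Rightarrow> real \<Rightarrow> real" where
  "kern_prim s z =
     integral {0..z powr s} (\<lambda>w. (1 - w) * (1 - w powr (1 / s)) powr (-1 - 2 * s) / s)"

section \<open>The half-line profile x_+^s is annihilated by the one-dimensional operator\<close>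

lemma kern_cont:
  fixes s b :: real
  assumes "0 < s" "b < 1"
  shows "continuous_on {0..b} (\<lambda>w. (1 - w) * (1 - w powr (1 / s)) powr (-1 - 2 * s) / s)"
proof -
  have "w powr (1/s) < 1" if "w \<in> {0..b}" for w
  proof -
    have "w powr (1/s) < 1 powr (1/s)"
      using that assms by (intro powr_less_mono2) auto
    then show ?thesis by simp
  qed
  then have ne: "1 - w powr (1/s) \<noteq> 0" if "w \<in> {0..b}" for w
    using that by fastforce
  show ?thesis
    using assms ne
    by (intro continuous_intros continuous_on_powr') auto
qed

lemma kern_prim_deriv:
  fixes s z :: real
  assumes "0 < s" "0 < z" "z < 1"
  shows "(kern_prim s has_real_derivative z powr (s - 1) * (1 - z powr s) * (1 - z) powr (-1 - 2 * s)) (at z)"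
proof -
  let ?k = "\<lambda>w. (1 - w) * (1 - w powr (1 / s)) powr (-1 - 2 * s) / s"
  define w where "w = z powr s"
  have w: "0 < w" "w < 1"
    using assms powr_less_mono2[of s z 1] by (auto simp: w_def)
  \<comment> \<open>The integrand is continuous only on closed intervals ending before 1, so the
    integral is differentiated inside one that has \<open>w\<close> in its interior.\<close>
  define b where "b = (w + 1) / 2"
  have b: "w < b" "b < 1" using w by (auto simp: b_def)
  have "((\<lambda>x. integral {0..x} ?k) has_real_derivative ?k w) (at w within {0..b})"
    using b w by (intro integral_has_real_derivative kern_cont assms) auto
  then have d: "((\<lambda>x. integral {0..x} ?k) has_real_derivative ?k w) (at w)"
    using w b at_within_interior[of w "{0..b}"] by simp
  have p: "((\<lambda>z. z powr s) has_real_derivative s * z powr (s - 1)) (at z)"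
    using assms by (intro has_real_derivative_powr) auto
  have "((\<lambda>z. integral {0..z powr s} ?k) has_real_derivative ?k w * (s * z powr (s - 1))) (at z)"
    using DERIV_chain2[OF _ p, of "\<lambda>x. integral {0..x} ?k"] d unfolding w_def by blast
  moreover have "w powr (1/s) = z"
    using assms by (simp add: w_def powr_powr)
  ultimately show ?thesis
    using assms unfolding kern_prim_def[abs_def] w_def by (simp add: mult_ac)
qed

lemma kern_prim_tendsto_0:
  fixes s :: real
  assumes "0 < s"
  shows "(kern_prim s \<longlongrightarrow> 0) (at_right 0)"
proof -
  let ?k = "\<lambda>w. (1 - w) * (1 - w powr (1 / s)) powr (-1 - 2 * s) / s"
  have "continuous_on {0..1/2} (\<lambda>x. integral {0..x} ?k)"
    using kern_cont[OF assms, of "1/2"] 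
    by (intro indefinite_integral_continuous_1 integrable_continuous_real) auto
  then have "((\<lambda>x. integral {0..x} ?k) \<longlongrightarrow> integral {0..0} ?k) (at 0 within {0..1/2})"
    unfolding continuous_on_def by force
  then have *: "((\<lambda>x. integral {0..x} ?k) \<longlongrightarrow> 0) (at_right 0)"
    by (simp add: at_within_Icc_at_right)
  have "filterlim (\<lambda>z. z powr s) (at_right 0) (at_right (0::real))"
    unfolding filterlim_at
    using assms by (auto intro!: tendsto_eq_intros eventually_at_rightI[of 0 1])
  from filterlim_compose[OF * this] show ?thesis
    unfolding kern_prim_def[abs_def] .
qed

text \<open>The integrand of the operator for x_+^s at the point 1; the truncation switches the left
  term off once \<open>t\<close> passes 1.\<close>

definition hl_kernel :: "real \<Rightarrow> real \<Rightarrow> real" where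
  "hl_kernel s t = ((1 + t) powr s + (max 0 (1 - t)) powr s - 2) / t powr (1 + 2 * s)"

text \<open>With q = 1 + t and z = 1 / q, the factor z^2 from the chain rule leaves \<open>q\<close>
  with the exponent (1 - s) + (1 + 2 s) - 2 = s. This cancellation ties the exponent of the profile
  to that of the kernel.\<close>

lemma kern_prim_inv_deriv:
  fixes s t :: real
  assumes "0 < s" "0 < t"
  shows "((\<lambda>t. - kern_prim s (1 / (1 + t))) has_real_derivative ((1 + t) powr s - 1) / t powr (1 + 2 * s)) (at t)"
proof -
  let ?z = "1 / (1 + t)"
  have z: "0 < ?z" "?z < 1" using assms by auto
  have i: "((\<lambda>t. 1 / (1 + t)) has_real_derivative - 1 / (1 + t)^2) (at t)"
    using assms by (auto intro!: derivative_eq_intros simp: power2_eq_square)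
  have "((\<lambda>t. kern_prim s (1 / (1 + t))) has_real_derivative
      ?z powr (s - 1) * (1 - ?z powr s) * (1 - ?z) powr (-1 - 2 * s) * (- 1 / (1 + t)^2)) (at t)"
    using DERIV_chain2[OF kern_prim_deriv[OF assms(1) z] i] .
  moreover have "?z powr (s - 1) * (1 - ?z powr s) * (1 - ?z) powr (-1 - 2 * s) * (1 / (1 + t)^2)
      = ((1 + t) powr s - 1) / t powr (1 + 2 * s)"
  proof -
    define q where "q = 1 + t"
    have q: "q > 0" "q > 1" using assms by (auto simp: q_def)
    have "1 - ?z = t / q" using q by (simp add: q_def field_simps)
    moreover have "(t / q) powr (-1 - 2 * s) = q powr (1 + 2 * s) / t powr (1 + 2 * s)"
    proof -
      have e: "-1 - 2 * s = - (1 + 2 * s)" by simp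
      show ?thesis
        unfolding e powr_minus using assms q by (simp add: powr_divide)
    qed
    ultimately have a: "(1 - ?z) powr (-1 - 2 * s) = q powr (1 + 2 * s) / t powr (1 + 2 * s)"
      by simp
    have b: "?z powr (s - 1) = q powr (1 - s)" "?z powr s = q powr (- s)"
      using q by (auto simp: q_def[symmetric] powr_divide powr_minus_divide powr_diff)
    have c: "1 / (1 + t)^2 = q powr (-2)"
      using q powr_realpow[of q 2] powr_minus_divide[of q 2] by (simp add: q_def)
    have "q powr (1 - s) * (1 - q powr (-s)) * q powr (1 + 2 * s) * q powr (-2) = q powr s - 1"
    proof -
      have "q powr (1 - s) * q powr (1 + 2 * s) * q powr (-2) = q powr s"
        using q by (simp flip: powr_add)
      moreover have "q powr s * q powr (-s) = 1"
        using q by (simp flip: powr_add)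
      moreover have "q powr (1 - s) * (1 - q powr (-s)) * q powr (1 + 2 * s) * q powr (-2)
        = q powr (1 - s) * q powr (1 + 2 * s) * q powr (-2) * (1 - q powr (-s))"
        by (simp only: mult_ac)
      ultimately show ?thesis by (simp only: right_diff_distrib mult_1_right)
    qed
    then show ?thesis unfolding a b c by (simp add: q_def mult_ac)
  qed
  ultimately show ?thesis
    using DERIV_minus[of "\<lambda>t. kern_prim s (1 / (1 + t))" "- (((1 + t) powr s - 1) / t powr (1 + 2 * s))"]
    by (metis (no_types) minus_minus divide_minus_left mult_minus_right times_divide_eq_right mult_1_right)
qed

text \<open>Write z = 1 - t. The derivative of the square term plus that of
  \<open>kern_prim s (1 - t)\<close> is (1 - z^s) t^(-1-2s) times z^(s-1) t - (1 - z^s) - z^(s-1),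
  and the last factor equals -1 because t = 1 - z.\<close>

lemma kern_prim_refl_deriv:
  fixes s t :: real
  assumes "0 < s" "0 < t" "t < 1"
  shows "((\<lambda>t. (1 - (1 - t) powr s)^2 * t powr (- 2 * s) / (2 * s) + kern_prim s (1 - t))
     has_real_derivative ((1 - t) powr s - 1) / t powr (1 + 2 * s)) (at t)"
proof -
  define z where "z = 1 - t"
  have z: "0 < z" "z < 1" using assms by (auto simp: z_def)
  have d1: "((\<lambda>t. kern_prim s (1 - t)) has_real_derivative
      z powr (s - 1) * (1 - z powr s) * (1 - z) powr (-1 - 2 * s) * (- 1)) (at t)"
  proof (rule DERIV_chain2[where f = "kern_prim s" and g = "\<lambda>t. 1 - t"])
    show "(kern_prim s has_real_derivative
      z powr (s - 1) * (1 - z powr s) * (1 - z) powr (-1 - 2 * s)) (at (1 - t))"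
      using kern_prim_deriv[OF assms(1) z] by (simp add: z_def)
    show "((\<lambda>t. 1 - t) has_real_derivative - 1) (at t)"
      by (auto intro!: derivative_eq_intros)
  qed
  have d2: "((\<lambda>t. (1 - (1 - t) powr s)^2 * t powr (- 2 * s) / (2 * s)) has_real_derivative
      (2 * (1 - z powr s) * (s * z powr (s - 1)) * t powr (- 2 * s) + (1 - z powr s)^2 * (- 2 * s * t powr (- 2 * s - 1))) / (2 * s)) (at t)"
    (is "(_ has_real_derivative ?D2) _")
  proof -
    have e1: "((\<lambda>t. (1 - t) powr s) has_real_derivative s * z powr (s - 1) * (- 1)) (at t)"
    proof (rule DERIV_chain2[where f = "\<lambda>t. t powr s" and g = "\<lambda>t. 1 - t"])
      show "((\<lambda>t. t powr s) has_real_derivative s * z powr (s - 1)) (at (1 - t))"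
        using z has_real_derivative_powr[of z s] by (simp add: z_def)
      show "((\<lambda>t. 1 - t) has_real_derivative - 1) (at t)"
        by (auto intro!: derivative_eq_intros)
    qed
    have e2: "((\<lambda>t. t powr (- 2 * s)) has_real_derivative - 2 * s * t powr (- 2 * s - 1)) (at t)"
      using has_real_derivative_powr[of t "- 2 * s"] assms by simp
    have e3: "((\<lambda>t. (1 - (1 - t) powr s)^2) has_real_derivative 2 * (1 - z powr s) * (s * z powr (s - 1))) (at t)"
      using DERIV_power[OF DERIV_diff[OF DERIV_const[of 1] e1], of 2]
      by (simp add: z_def algebra_simps)
    have "((\<lambda>t. (1 - (1 - t) powr s)^2 * t powr (- 2 * s)) has_real_derivative
      2 * (1 - z powr s) * (s * z powr (s - 1)) * t powr (- 2 * s) + (1 - z powr s)^2 * (- 2 * s * t powr (- 2 * s - 1))) (at t)"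
      using DERIV_mult[OF e3 e2] unfolding z_def by (simp only: mult_ac add_ac)
    then show ?thesis by (rule DERIV_cdivide)
  qed
  define T where "T = t powr (- 1 - 2 * s)"
  define Z1 where "Z1 = z powr (s - 1)"
  have T1: "t powr (- 2 * s - 1) = T"
  proof -
    have "- 2 * s - 1 = - 1 - 2 * s" by simp
    then show ?thesis unfolding T_def by (simp only:)
  qed
  have T2: "t powr (- 2 * s) = t * T"
    using assms powr_mult_base[of t "-1 - 2 * s"] by (simp add: T_def)
  have T3: "t powr (1 + 2 * s) = inverse T"
    using powr_minus[of t "1 + 2 * s"] by (simp add: T_def)
  have T4: "(1 - z) powr (-1 - 2 * s) = T" by (simp add: z_def T_def)
  have Z: "z powr s = z * Z1"
    using z powr_mult_base[of z "s - 1"] by (simp add: Z1_def)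
  have t: "t = 1 - z" by (simp add: z_def)
  have "?D2 + z powr (s - 1) * (1 - z powr s) * (1 - z) powr (-1 - 2 * s) * (- 1)
      = ((1 - t) powr s - 1) / t powr (1 + 2 * s)"
  proof -
    have "(2 * (1 - z * Z1) * (s * Z1) * (t * T) + (1 - z * Z1)^2 * (- 2 * s * T)) / (2 * s)
       = (1 - z * Z1) * Z1 * (t * T) - (1 - z * Z1)^2 * T"
      using assms by (simp add: divide_simps) (simp add: algebra_simps)
    also have "\<dots> + Z1 * (1 - z * Z1) * T * (- 1) = (z * Z1 - 1) * T"
      unfolding t by (simp add: algebra_simps power2_eq_square)
    also have "\<dots> = (z * Z1 - 1) / inverse T" by (simp add: divide_inverse)
    finally show ?thesis
      unfolding T1 T2 T3 T4 Z Z1_def[symmetric] using Z by (simp add: z_def)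
  qed
  with DERIV_add[OF d2 d1] show ?thesis by simp
qed


lemma powr_le_tangent:
  fixes s x :: real
  assumes "0 < s" "s < 1" "0 \<le> x"
  shows "x powr s \<le> 1 + s * (x - 1)"
proof (cases "x = 0")
  case False
  then show ?thesis
    using Youngs_inequality_0[of s "1 - s" x 1] assms by (simp add: algebra_simps)
qed (use assms in auto)

lemma hl_kernel_cont:
  assumes "0 < s"
  shows "continuous_on {0<..} (hl_kernel s)"
  unfolding hl_kernel_def[abs_def]
  using assms by (intro continuous_intros continuous_on_powr') auto

text \<open>For s >= 1/2 each of the two values blows up as \<open>t\<close> tends to 0, so they
  must be handled together. The arguments differ by at most t^2 and the derivative between them is
  of order t^(-2s); the mean value theorem gives a bound that vanishes at 0 since s < 1.\<close>

lemma kern_prim_diff_bound: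
  fixes s t :: real
  assumes s: "0 < s" "s < 1" and t: "0 < t" "t < 1/2"
  shows "\<bar>kern_prim s (1 / (1 + t)) - kern_prim s (1 - t)\<bar> \<le> 2 * 2 powr (2 * s) * t powr (2 - 2 * s)"
proof -
  have lt: "1 - t < 1 / (1 + t)" using t by (simp add: field_simps)
  have lt1: "1 / (1 + t) < 1" using t by simp
  obtain z where z: "1 - t < z" "z < 1 / (1 + t)"
    and eq: "kern_prim s (1 / (1 + t)) - kern_prim s (1 - t) =
       (1 / (1 + t) - (1 - t)) * (z powr (s - 1) * (1 - z powr s) * (1 - z) powr (-1 - 2 * s))"
    using MVT2[OF lt, of "kern_prim s" "\<lambda>z. z powr (s - 1) * (1 - z powr s) * (1 - z) powr (-1 - 2 * s)"]
      kern_prim_deriv[OF s(1)] t lt1 by force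
  have z1: "1/2 < z" "z < 1" using z t lt1 by auto
  have "1 / (1 + t) \<le> 1 - t / 2" using t by (simp add: field_simps)
  then have z2: "t / 2 \<le> 1 - z" using z by simp
  have a1: "z powr (s - 1) \<le> 2"
  proof -
    have "z powr (s - 1) \<le> (1/2) powr (s - 1)"
      using z1 s by (intro powr_mono2') auto
    also have "\<dots> \<le> (1/2) powr (- 1)"
      using s by (intro powr_mono') auto
    finally show ?thesis by (simp add: powr_minus)
  qed
  have "z powr 1 \<le> z powr s" using z1 s by (intro powr_mono') auto
  then have a2: "1 - z powr s \<le> 1 - z" using z1 by simp
  have a3: "0 \<le> 1 - z powr s" using z1 s powr_le1[of s z] by simp
  have "(1 - z powr s) * (1 - z) powr (-1 - 2 * s) \<le> (1 - z) * (1 - z) powr (-1 - 2 * s)"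
    using a2 by (intro mult_right_mono) auto
  also have "\<dots> = (1 - z) powr (- 2 * s)"
    using z1 powr_mult_base[of "1 - z" "-1 - 2 * s"] by simp
  also have "\<dots> \<le> (t / 2) powr (- 2 * s)"
    using z2 t s by (intro powr_mono2') auto
  also have "\<dots> = 2 powr (2 * s) * t powr (- 2 * s)"
    using t by (simp add: powr_divide powr_minus_divide)
  finally have a4: "(1 - z powr s) * (1 - z) powr (-1 - 2 * s) \<le> 2 powr (2 * s) * t powr (- 2 * s)" .
  have "z powr (s - 1) * ((1 - z powr s) * (1 - z) powr (-1 - 2 * s)) \<le> 2 * (2 powr (2 * s) * t powr (- 2 * s))"
    using a3 by (intro mult_mono[OF a1 a4]) auto
  note m1 = this
  have m2: "1 / (1 + t) - (1 - t) \<le> t\<^sup>2" using t by (simp add: field_simps power2_eq_square)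
  have m3: "0 \<le> z powr (s - 1) * ((1 - z powr s) * (1 - z) powr (-1 - 2 * s))"
    using a3 by simp
  have "(1 / (1 + t) - (1 - t)) * (z powr (s - 1) * ((1 - z powr s) * (1 - z) powr (-1 - 2 * s)))
      \<le> t\<^sup>2 * (2 * (2 powr (2 * s) * t powr (- 2 * s)))"
    by (rule mult_mono[OF m2 m1 _ m3]) simp
  moreover have "t\<^sup>2 * (2 * (2 powr (2 * s) * t powr (- 2 * s))) = 2 * 2 powr (2 * s) * t powr (2 - 2 * s)"
    using t powr_realpow[of t 2] powr_add[of t 2 "- 2 * s"] by simp
  moreover have "0 \<le> (1 / (1 + t) - (1 - t)) * (z powr (s - 1) * ((1 - z powr s) * (1 - z) powr (-1 - 2 * s)))"
    using lt a3 by (intro mult_nonneg_nonneg) auto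
  ultimately show ?thesis unfolding eq by (simp only: mult.assoc abs_of_nonneg)
qed

text \<open>On this interval the kernel is nonpositive by concavity, so the fundamental theorem for
  integrands of constant sign yields integrability and value together. At t = 1 the square term of
  the primitive contributes \<open>1 / (2 * s)\<close>, and the argument 1 / (1 + t) contributes
  \<open>kern_prim s (1/2)\<close>.\<close>

lemma hl_kernel_integral_01:
  fixes s :: real
  assumes s: "0 < s" "s < 1"
  shows "set_integrable lborel {0<..<1} (hl_kernel s)"
    and "(LBINT t:{0<..<1}. hl_kernel s t) = 1 / (2 * s) - kern_prim s (1/2)"
proof -
  define F where "F = (\<lambda>t. - ((1 - (1 - t) powr s)^2 * t powr (- 2 * s) / (2 * s) + kern_prim s (1 - t)
      - kern_prim s (1 / (1 + t))))"
  have D: "(F has_real_derivative - hl_kernel s t) (at t)" if "0 < t" "t < 1" for t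
  proof -
    have "((\<lambda>t. - (((1 - (1 - t) powr s)^2 * t powr (- 2 * s) / (2 * s) + kern_prim s (1 - t))
      + (- kern_prim s (1 / (1 + t))))) has_real_derivative
      - (((1 - t) powr s - 1) / t powr (1 + 2 * s) + ((1 + t) powr s - 1) / t powr (1 + 2 * s))) (at t)"
      by (intro DERIV_minus DERIV_add kern_prim_refl_deriv kern_prim_inv_deriv that s)
    moreover have "((1 - t) powr s - 1) / t powr (1 + 2 * s) + ((1 + t) powr s - 1) / t powr (1 + 2 * s) = hl_kernel s t"
      unfolding hl_kernel_def add_divide_distrib[symmetric] using that by (simp add: algebra_simps)
    ultimately show ?thesis by (simp add: F_def)
  qed
  have C: "isCont (\<lambda>t. - hl_kernel s t) t" if "0 < t" for t
    using hl_kernel_cont[OF s(1)] that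
    by (intro continuous_intros) (auto simp: continuous_on_eq_continuous_at)
  have N: "0 \<le> - hl_kernel s t" if "0 < t" "t < 1" for t
  proof -
    have "(1 + t) powr s + (1 - t) powr s \<le> 2"
      using powr_le_tangent[OF s, of "1 + t"] powr_le_tangent[OF s, of "1 - t"] that by simp
    then show ?thesis using that unfolding hl_kernel_def
      by (simp add: divide_nonpos_nonneg)
  qed
  have b1: "\<bar>(1 - (1 - t) powr s)^2 * t powr (- 2 * s) / (2 * s)\<bar> \<le> t powr (2 - 2 * s) / (2 * s)"
    if "0 < t" "t < 1/2" for t
  proof -
    have "(1 - t) powr 1 \<le> (1 - t) powr s" using that s by (intro powr_mono') auto
    moreover have "(1 - t) powr s \<le> 1" using that s by (intro powr_le1) auto
    ultimately have "(1 - (1 - t) powr s)^2 \<le> t^2" using that by (intro power_mono) auto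
    then have "(1 - (1 - t) powr s)^2 * t powr (- 2 * s) \<le> t^2 * t powr (- 2 * s)"
      by (intro mult_right_mono) auto
    also have "\<dots> = t powr (2 - 2 * s)"
      using that powr_realpow[of t 2] powr_add[of t 2 "- 2 * s"] by simp
    finally show ?thesis using s by (simp add: divide_right_mono)
  qed
  have L0: "(F \<longlongrightarrow> 0) (at_right 0)"
  proof (rule Lim_null_comparison)
    show "eventually (\<lambda>t. norm (F t) \<le> t powr (2 - 2 * s) / (2 * s) + 2 * 2 powr (2 * s) * t powr (2 - 2 * s)) (at_right 0)"
    proof (rule eventually_at_rightI[of 0 "1/2"])
      fix t :: real assume "t \<in> {0<..<1/2}"
      then have t: "0 < t" "t < 1/2" by auto
      show "norm (F t) \<le> t powr (2 - 2 * s) / (2 * s) + 2 * 2 powr (2 * s) * t powr (2 - 2 * s)"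
        using b1[OF t] kern_prim_diff_bound[OF s t] unfolding F_def real_norm_def by linarith
    qed simp
    have "((\<lambda>t. t powr (2 - 2 * s)) \<longlongrightarrow> 0) (at_right 0)"
      using s
      by (intro tendsto_zero_powrI[OF tendsto_ident_at tendsto_const] eventually_at_rightI[of 0 1]) auto
    then have "((\<lambda>t. t powr (2 - 2 * s) / (2 * s) + 2 * 2 powr (2 * s) * t powr (2 - 2 * s)) \<longlongrightarrow> 0 / (2 * s) + 2 * 2 powr (2 * s) * 0) (at_right 0)"
      using s by (intro tendsto_intros) auto
    then show "((\<lambda>t. t powr (2 - 2 * s) / (2 * s) + 2 * 2 powr (2 * s) * t powr (2 - 2 * s)) \<longlongrightarrow> 0) (at_right 0)"
      by simp
  qed
  have one_minus: "filterlim (\<lambda>t. 1 - t) (at_right 0) (at_left (1::real))"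
    unfolding filterlim_at
    by (auto intro!: tendsto_eq_intros eventually_at_leftI[of 0 1])
  have K: "isCont (kern_prim s) (1/2)"
    using kern_prim_deriv[OF s(1), of "1/2"] by (auto intro: DERIV_isCont)
  have "((\<lambda>t. (1 - t) powr s) \<longlongrightarrow> 0) (at_left 1)"
  proof -
    have "((\<lambda>t. t powr s) \<longlongrightarrow> 0) (at_right (0::real))"
      using s by (auto intro!: tendsto_eq_intros eventually_at_rightI[of 0 1])
    from filterlim_compose[OF this one_minus] show ?thesis .
  qed
  moreover have "((\<lambda>t. kern_prim s (1 - t)) \<longlongrightarrow> 0) (at_left 1)"
    using filterlim_compose[OF kern_prim_tendsto_0[OF s(1)] one_minus] .
  moreover have "((\<lambda>t. kern_prim s (1 / (1 + t))) \<longlongrightarrow> kern_prim s (1/2)) (at_left 1)"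
    by (rule isCont_tendsto_compose[OF K]) (auto intro!: tendsto_eq_intros)
  ultimately have L1: "(F \<longlongrightarrow> - ((1 - 0)^2 * 1 powr (- 2 * s) / (2 * s) + 0 - kern_prim s (1/2))) (at_left 1)"
    unfolding F_def using s by (intro tendsto_intros) auto
  have I: "set_integrable lborel (einterval (ereal 0) (ereal 1)) (\<lambda>t. - hl_kernel s t)"
    "(LBINT t=ereal 0..ereal 1. - hl_kernel s t) = - ((1 - 0)^2 * 1 powr (- 2 * s) / (2 * s) + 0 - kern_prim s (1/2)) - 0"
    by (rule interval_integral_FTC_nonneg[of "ereal 0" "ereal 1" F];
        use D C N L0 L1 in \<open>simp add: ereal_tendsto_simps\<close>)+
  show "set_integrable lborel {0<..<1} (hl_kernel s)"
    using I(1) by (simp add: set_integrable_def)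
  show "(LBINT t:{0<..<1}. hl_kernel s t) = 1 / (2 * s) - kern_prim s (1/2)"
    using I(2) by (simp add: interval_lebesgue_integral_def set_lebesgue_integral_def)
qed

text \<open>Beyond 1 the numerator is (1 + t)^s - 2, which changes sign at \<open>c\<close>; the
  fundamental theorem for constant sign is therefore applied on each side of \<open>c\<close>. The
  total is the negative of the integral over (0, 1).\<close>

lemma hl_kernel_integral_gt1:
  fixes s :: real
  assumes s: "0 < s" "s < 1"
  defines "c \<equiv> 2 powr (1 / s) - 1"
  shows "1 < c"
    and "set_integrable lborel {1<..<c} (hl_kernel s)"
    and "set_integrable lborel {c<..} (hl_kernel s)"
    and "(LBINT t:{1<..<c}. hl_kernel s t) + (LBINT t:{c<..}. hl_kernel s t) = kern_prim s (1/2) - 1 / (2 * s)"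
proof -
  have "2 powr 1 < 2 powr (1 / s)" using s by (intro powr_less_mono) auto
  then show c: "1 < c" by (simp add: c_def)
  define F where "F = (\<lambda>t. - kern_prim s (1 / (1 + t)) + t powr (- 2 * s) / (2 * s))"
  have D: "(F has_real_derivative hl_kernel s t) (at t)" if "1 < t" for t
  proof -
    have "((\<lambda>t. t powr (- 2 * s) / (2 * s)) has_real_derivative - 1 / t powr (1 + 2 * s)) (at t)"
    proof -
      have e: "- 2 * s - 1 = - (1 + 2 * s)" by simp
      have "((\<lambda>t. t powr (- 2 * s) / (2 * s)) has_real_derivative (- 2 * s * t powr (- 2 * s - 1)) / (2 * s)) (at t)"
        using that by (intro DERIV_cdivide has_real_derivative_powr) auto
      moreover have "(- 2 * s * t powr (- 2 * s - 1)) / (2 * s) = - 1 / t powr (1 + 2 * s)"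
        unfolding e powr_minus_divide using s by simp
      ultimately show ?thesis by simp
    qed
    from DERIV_add[OF kern_prim_inv_deriv[OF s(1)] this] that
    show ?thesis by (simp add: F_def hl_kernel_def diff_divide_distrib[symmetric])
  qed
  have C: "isCont (\<lambda>t. hl_kernel s t) t" "isCont (\<lambda>t. - hl_kernel s t) t" if "1 < t" for t
    using hl_kernel_cont[OF s(1)] that
    by (auto intro!: continuous_intros simp: continuous_on_eq_continuous_at)
  have cs: "(1 + c) powr s = 2" using s by (simp add: c_def powr_powr)
  have N1: "0 \<le> - hl_kernel s t" if "1 < t" "t < c" for t
  proof -
    have "(1 + t) powr s \<le> (1 + c) powr s" using that s by (intro powr_mono2) auto
    then show ?thesis using that cs unfolding hl_kernel_def by (simp add: divide_nonpos_nonneg)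
  qed
  have N2: "0 \<le> hl_kernel s t" if "c < t" for t
  proof -
    have "(1 + c) powr s \<le> (1 + t) powr s" using that c s by (intro powr_mono2) auto
    then show ?thesis using that c cs unfolding hl_kernel_def by simp
  qed
  have K: "isCont (kern_prim s) (1/2)"
    using kern_prim_deriv[OF s(1), of "1/2"] by (auto intro: DERIV_isCont)
  have L1: "(F \<longlongrightarrow> - kern_prim s (1/2) + 1 powr (- 2 * s) / (2 * s)) (at_right 1)"
    unfolding F_def using s
    by (intro tendsto_intros isCont_tendsto_compose[OF K]) (auto intro!: tendsto_eq_intros)
  have "isCont F c" using D[OF c] by (rule DERIV_isCont)
  then have Lc: "(F \<longlongrightarrow> F c) (at_left c)" "(F \<longlongrightarrow> F c) (at_right c)"
    unfolding isCont_def by (auto intro: tendsto_mono at_le)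
  have inv: "filterlim (\<lambda>t. 1 / (1 + t)) (at_right (0::real)) at_top"
    unfolding filterlim_at
  proof
    have "((\<lambda>t::real. 1 / t) \<longlongrightarrow> 0) at_top"
      using tendsto_inverse_0_at_top[OF filterlim_ident] by (simp add: divide_inverse)
    then show "((\<lambda>t::real. 1 / (1 + t)) \<longlongrightarrow> 0) at_top"
      by (rule filterlim_compose) (rule filterlim_tendsto_add_at_top[OF tendsto_const filterlim_ident])
    show "\<forall>\<^sub>F x in at_top. 1 / (1 + x) \<in> {0::real<..} \<and> 1 / (1 + x) \<noteq> 0"
      by (rule eventually_at_top_linorderI[of 0]) auto
  qed
  have "((\<lambda>t. t powr (- 2 * s)) \<longlongrightarrow> 0) at_top"
    using s by (intro tendsto_neg_powr filterlim_ident) auto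
  with filterlim_compose[OF kern_prim_tendsto_0[OF s(1)] inv]
  have "(F \<longlongrightarrow> - 0 + 0 / (2 * s)) at_top"
    unfolding F_def using s by (intro tendsto_intros) auto
  then have Li: "(F \<longlongrightarrow> 0) at_top" by simp
  have D': "((\<lambda>t. - F t) has_real_derivative - hl_kernel s t) (at t)" if "1 < t" for t
    using D[OF that] by (rule DERIV_minus)
  have L1': "((\<lambda>t. - F t) \<longlongrightarrow> - (- kern_prim s (1/2) + 1 powr (- 2 * s) / (2 * s))) (at_right 1)"
    using L1 by (rule tendsto_minus)
  have Lc': "((\<lambda>t. - F t) \<longlongrightarrow> - F c) (at_left c)"
    using Lc(1) by (rule tendsto_minus)
  have I1: "set_integrable lborel (einterval (ereal 1) (ereal c)) (\<lambda>t. - hl_kernel s t)"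
    "(LBINT t=ereal 1..ereal c. - hl_kernel s t) = - F c - (- (- kern_prim s (1/2) + 1 powr (- 2 * s) / (2 * s)))"
    by (rule interval_integral_FTC_nonneg[of "ereal 1" "ereal c" "\<lambda>t. - F t"];
        use D' C N1 L1' Lc' c in \<open>simp add: ereal_tendsto_simps\<close>)+
  have I2: "set_integrable lborel (einterval (ereal c) \<infinity>) (hl_kernel s)"
    "(LBINT t=ereal c..\<infinity>. hl_kernel s t) = 0 - F c"
    by (rule interval_integral_FTC_nonneg[of "ereal c" "\<infinity>" F];
        use D C N2 Li Lc c in \<open>simp add: ereal_tendsto_simps\<close>)+
  show "set_integrable lborel {1<..<c} (hl_kernel s)"
    using I1(1) by (simp add: set_integrable_def)
  show "set_integrable lborel {c<..} (hl_kernel s)"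
    using I2(1) by (simp add: set_integrable_def)
  show "(LBINT t:{1<..<c}. hl_kernel s t) + (LBINT t:{c<..}. hl_kernel s t) = kern_prim s (1/2) - 1 / (2 * s)"
    using I1(2) I2(2) c by (simp add: interval_lebesgue_integral_def set_lebesgue_integral_def)
qed


section \<open>Set integrals over the half-line: null sets, dilation, two-power functions\<close>

lemma set_lborel_AE_eq:
  fixes f :: "real \<Rightarrow> real"
  assumes A: "set_integrable lborel A f" and f: "f \<in> borel_measurable lborel" and B: "B \<in> sets lborel"
    and AE: "AE x in lborel. x \<in> A \<longleftrightarrow> x \<in> B"
  shows "set_integrable lborel B f" and "(LBINT x:B. f x) = (LBINT x:A. f x)"
proof -
  have m: "(\<lambda>x. indicator B x *\<^sub>R f x) \<in> borel_measurable lborel"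
    using f B by (intro borel_measurable_scaleR borel_measurable_indicator) auto
  have i: "integrable lborel (\<lambda>x. indicator A x *\<^sub>R f x)"
    using A by (simp add: set_integrable_def)
  have e: "AE x in lborel. indicator B x *\<^sub>R f x = indicator A x *\<^sub>R f x"
    using AE by eventually_elim (auto simp: indicator_def)
  show "set_integrable lborel B f"
    unfolding set_integrable_def
  proof (rule integrable_cong_AE_imp[OF i m])
    show "AE x in lborel. indicator A x *\<^sub>R f x = indicator B x *\<^sub>R f x"
      using e by eventually_elim (rule sym)
  qed
  show "(LBINT x:B. f x) = (LBINT x:A. f x)"
    unfolding set_lebesgue_integral_def
    using m borel_measurable_integrable[OF i] e by (rule integral_cong_AE)
qed

lemma hl_kernel_integral:
  fixes s :: real
  assumes s: "0 < s" "s < 1"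
  shows "set_integrable lborel {0<..} (hl_kernel s)"
    and "(LBINT t:{0<..}. hl_kernel s t) = 0"
proof -
  define c where "c = 2 powr (1 / s) - 1"
  note c = hl_kernel_integral_gt1[OF s, folded c_def] and i = hl_kernel_integral_01[OF s]
  let ?A = "{0<..<1} \<union> ({1<..<c} \<union> {c<..})"
  have A: "set_integrable lborel ?A (hl_kernel s)"
    using c i by (intro set_integrable_Un) auto
  have "(LBINT t:?A. hl_kernel s t) =
     (LBINT t:{0<..<1}. hl_kernel s t) + (LBINT t:({1<..<c} \<union> {c<..}). hl_kernel s t)"
    using c i by (intro set_integral_Un set_integrable_Un) auto
  also have "(LBINT t:({1<..<c} \<union> {c<..}). hl_kernel s t) =
      (LBINT t:{1<..<c}. hl_kernel s t) + (LBINT t:{c<..}. hl_kernel s t)"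
    using c by (intro set_integral_Un) auto
  finally have I: "(LBINT t:?A. hl_kernel s t) = 0" using c(4) i by simp
  have "AE t in lborel. t \<noteq> 1 \<and> t \<noteq> c"
    using AE_lborel_singleton[of 1] AE_lborel_singleton[of c] by auto
  then have AE: "AE t in lborel. t \<in> ?A \<longleftrightarrow> t \<in> {0<..}"
    by eventually_elim (use c(1) in auto)
  have m: "hl_kernel s \<in> borel_measurable lborel"
    unfolding hl_kernel_def[abs_def] by simp
  have B: "{0::real<..} \<in> sets lborel" by simp
  show "set_integrable lborel {0<..} (hl_kernel s)"
    by (rule set_lborel_AE_eq(1)[OF A m B AE])
  show "(LBINT t:{0<..}. hl_kernel s t) = 0"
    using set_lborel_AE_eq(2)[OF A m B AE] I by (rule trans)
qed

lemma set_lborel_dilation: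
  fixes f :: "real \<Rightarrow> real"
  assumes a: "0 < a" and f: "set_integrable lborel {0<..} f"
  shows "set_integrable lborel {0<..} (\<lambda>t. f (t / a))"
    and "(LBINT t:{0<..}. f (t / a)) = a * (LBINT t:{0<..}. f t)"
proof -
  have e: "indicator {0<..} (0 + (1 / a) * t) *\<^sub>R f (0 + (1 / a) * t) = indicator {0<..} t *\<^sub>R f (t / a)" for t
    using a by (auto simp: indicator_def zero_less_mult_iff zero_less_divide_iff)
  have "integrable lborel (\<lambda>t. indicator {0<..} (0 + (1 / a) * t) *\<^sub>R f (0 + (1 / a) * t))"
    using f a by (intro lborel_integrable_real_affine) (auto simp: set_integrable_def)
  then show "set_integrable lborel {0<..} (\<lambda>t. f (t / a))"
    unfolding e set_integrable_def .
  have "(\<integral>t. indicator {0<..} t *\<^sub>R f t \<partial>lborel) =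
      \<bar>1 / a\<bar> *\<^sub>R (\<integral>t. indicator {0<..} (0 + (1 / a) * t) *\<^sub>R f (0 + (1 / a) * t) \<partial>lborel)"
    using a by (intro lborel_integral_real_affine) auto
  then show "(LBINT t:{0<..}. f (t / a)) = a * (LBINT t:{0<..}. f t)"
    unfolding e set_lebesgue_integral_def using a by simp
qed

text \<open>By homogeneity the integrand is a power of \<open>a\<close> times
  \<open>hl_kernel s (t / a)\<close>, which reduces every base point to 1: x_+^s is s-harmonic at
  each positive point.\<close>

lemma half_line_harmonic:
  fixes s a :: real
  assumes s: "0 < s" "s < 1" and a: "0 < a"
  defines "f \<equiv> \<lambda>t. ((a + t) powr s + (max 0 (a - t)) powr s - 2 * a powr s) / t powr (1 + 2 * s)"
  shows "set_integrable lborel {0<..} f"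
    and "(LBINT t:{0<..}. f t) = 0"
proof -
  have e: "f t = a powr (s - (1 + 2 * s)) * hl_kernel s (t / a)" if "t \<in> {0<..}" for t
  proof -
    have "(a + t) powr s = a powr s * (1 + t / a) powr s"
    proof -
      have "a + t = a * (1 + t / a)" using a by (simp add: field_simps)
      then show ?thesis using a that by (simp only:) (simp add: powr_mult)
    qed
    moreover have "(max 0 (a - t)) powr s = a powr s * (max 0 (1 - t / a)) powr s"
    proof -
      have "max 0 (a - t) = a * max 0 (1 - t / a)"
        using a by (simp add: max_def field_simps)
      then show ?thesis using a by (simp add: powr_mult)
    qed
    moreover have "(t / a) powr (1 + 2 * s) = t powr (1 + 2 * s) / a powr (1 + 2 * s)"
      using a that by (simp add: powr_divide)
    moreover have "a powr (s - (1 + 2 * s)) = a powr s / a powr (1 + 2 * s)" by (rule powr_diff)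
    moreover have "(A * X + A * Y - 2 * A) / T = A / B * ((X + Y - 2) / (T / B))"
      if "0 < B" "0 < T" for A B T X Y :: real
      using that by (simp add: field_simps)
    ultimately show ?thesis
      unfolding f_def hl_kernel_def using a that by simp
  qed
  note d = set_lborel_dilation[OF a hl_kernel_integral(1)[OF s]]
  show "set_integrable lborel {0<..} f"
    using d(1) by (subst set_integrable_cong[OF refl refl e]) auto
  show "(LBINT t:{0<..}. f t) = 0"
  proof -
    have "(LBINT t:{0<..}. f t) = (LBINT t:{0<..}. a powr (s - (1 + 2 * s)) * hl_kernel s (t / a))"
      using e by (intro set_lebesgue_integral_cong) auto
    then show ?thesis using d(2) hl_kernel_integral(2)[OF s] by simp
  qed
qed


text \<open>Serves to integrate the minorants of second differences: one power, integrable at 0,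
  reflects the regularity near the point; the other, integrable at infinity, the growth far away;
  \<open>t\<close> is the length at which they switch.\<close>

lemma powr_two_sided_integral:
  fixes t a b c d :: real
  assumes t: "0 < t" and a: "- 1 < a" and b: "b < - 1"
  defines "M \<equiv> \<lambda>x. if x < t then c * x powr a else d * x powr b"
  shows "set_integrable lborel {0<..} M"
    and "(LBINT x:{0<..}. M x) = c * t powr (a + 1) / (a + 1) - d * t powr (b + 1) / (b + 1)"
proof -
  define F where "F = (\<lambda>e x::real. x powr (e + 1) / (e + 1))"
  have D: "(F e has_real_derivative x powr e) (at x)"
    if "0 < x" "e \<noteq> - 1" for x e :: real
  proof -
    have "(F e has_real_derivative ((e + 1) * x powr (e + 1 - 1)) / (e + 1)) (at x)"
      unfolding F_def using that by (intro DERIV_cdivide has_real_derivative_powr) auto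
    then show ?thesis using that by (simp add: add_eq_0_iff)
  qed
  have C: "isCont (\<lambda>x. x powr e) x" if "0 < x" for x e :: real
    using that by (intro continuous_intros) auto
  have L0: "(F a \<longlongrightarrow> 0) (at_right 0)"
  proof -
    have "((\<lambda>x. x powr (a + 1)) \<longlongrightarrow> 0) (at_right 0)"
      using a by (intro tendsto_zero_powrI[OF tendsto_ident_at tendsto_const] eventually_at_rightI[of 0 1]) auto
    from tendsto_divide[OF this tendsto_const[of "a + 1"]] show ?thesis using a by (simp add: F_def)
  qed
  have Lt: "(F e \<longlongrightarrow> F e t) (at t within S)"
    if "e \<noteq> - 1" for e S
    using D[OF t that] DERIV_isCont isCont_def tendsto_within_subset by blast
  have Li: "(F b \<longlongrightarrow> 0) at_top"
  proof -
    have "((\<lambda>x. x powr (b + 1)) \<longlongrightarrow> 0) at_top"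
      using b by (intro tendsto_neg_powr filterlim_ident) auto
    from tendsto_divide[OF this tendsto_const[of "b + 1"]] show ?thesis using b by (simp add: F_def)
  qed
  have I1: "set_integrable lborel (einterval (ereal 0) (ereal t)) (\<lambda>x. x powr a)"
    "(LBINT x=ereal 0..ereal t. x powr a) = F a t - 0"
    using interval_integral_FTC_nonneg[of "ereal 0" "ereal t" "F a" "\<lambda>x. x powr a" 0 "F a t"]
      t a D C L0 Lt[of a] by (simp_all add: ereal_tendsto_simps)
  have I2: "set_integrable lborel (einterval (ereal t) \<infinity>) (\<lambda>x. x powr b)"
    "(LBINT x=ereal t..\<infinity>. x powr b) = 0 - F b t"
    using interval_integral_FTC_nonneg[of "ereal t" \<infinity> "F b" "\<lambda>x. x powr b" "F b t" 0]
      t b D C Li Lt[of b] by (simp_all add: ereal_tendsto_simps)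
  have i1: "set_integrable lborel {0<..<t} (\<lambda>x. c * x powr a)"
      "(LBINT x:{0<..<t}. c * x powr a) = c * F a t"
    using I1 t by (auto simp: interval_lebesgue_integral_def)
  have i2: "set_integrable lborel {t<..} (\<lambda>x. d * x powr b)"
      "(LBINT x:{t<..}. d * x powr b) = - (d * F b t)"
    using I2 t by (auto simp: interval_lebesgue_integral_def)
  have m1: "set_integrable lborel {0<..<t} M"
    using i1(1) by (subst set_integrable_cong[OF refl refl, where f' = "\<lambda>x. c * x powr a"]) (auto simp: M_def)
  have m2: "set_integrable lborel {t<..} M"
    using i2(1) by (subst set_integrable_cong[OF refl refl, where f' = "\<lambda>x. d * x powr b"]) (auto simp: M_def)
  have n1: "(LBINT x:{0<..<t}. M x) = (LBINT x:{0<..<t}. c * x powr a)"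
    by (intro set_lebesgue_integral_cong) (auto simp: M_def)
  have n2: "(LBINT x:{t<..}. M x) = (LBINT x:{t<..}. d * x powr b)"
    by (intro set_lebesgue_integral_cong) (auto simp: M_def)
  let ?A = "{0<..<t} \<union> {t<..}"
  have A: "set_integrable lborel ?A M" using m1 m2 by (intro set_integrable_Un) auto
  have I: "(LBINT x:?A. M x) = c * t powr (a + 1) / (a + 1) - d * t powr (b + 1) / (b + 1)"
    using m1 m2 n1 n2 i1 i2 by (subst set_integral_Un) (auto simp: F_def)
  have AE: "AE x in lborel. x \<in> ?A \<longleftrightarrow> x \<in> {0<..}"
    using AE_lborel_singleton[of t] by eventually_elim (use t in auto)
  have m: "M \<in> borel_measurable lborel" unfolding M_def by measurable
  have B: "{0::real<..} \<in> sets lborel" by simp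
  show "set_integrable lborel {0<..} M"
    by (rule set_lborel_AE_eq(1)[OF A m B AE])
  show "(LBINT x:{0<..}. M x) = c * t powr (a + 1) / (a + 1) - d * t powr (b + 1) / (b + 1)"
    using set_lborel_AE_eq(2)[OF A m B AE] I by (rule trans)
qed

section \<open>The one-dimensional product barrier on a chord\<close>

lemma powr_add_le:
  fixes s a b :: real
  assumes "0 < s" "s < 1" "0 \<le> a" "0 \<le> b"
  shows "(a + b) powr s \<le> a powr s + b powr s"
proof (cases "a + b = 0")
  case False
  then have ab: "0 < a + b" using assms by linarith
  \<comment> \<open>Division by \<open>a + b\<close> reduces the claim to this inequality for two
    fractions with sum 1.\<close>
  have "x \<le> x powr s" if "0 \<le> x" "x \<le> 1" for x :: real
    using powr_mono'[of s 1 x] that assms by simp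
  then have "a / (a + b) \<le> (a / (a + b)) powr s" "b / (a + b) \<le> (b / (a + b)) powr s"
    using assms ab by simp_all
  then have "a / (a + b) + b / (a + b) \<le> a powr s / (a + b) powr s + b powr s / (a + b) powr s"
    using assms ab by (simp add: powr_divide)
  moreover have "a / (a + b) + b / (a + b) = 1" using ab by (simp add: add_divide_distrib[symmetric])
  ultimately show ?thesis using ab by (simp add: field_simps)
qed (use assms in auto)

text \<open>The products are the remainder in the discrete product rule for g(t) = (p - t)_+^s and
  h(t) = (q + t)_+^s. For t < q, increments of g are at most t^s by subadditivity, and those of h at
  most q^(s-1) t, a Lipschitz bound at the scale of the longer side. For t >= q, in each product the
  factor that decreases changes by at most q^s and the other by at most t^s.\<close>

lemma barrier_increments:
  fixes s p q t :: real
  assumes s: "0 < s" "s < 1" and pq: "0 < p" "p \<le> q" and t: "0 < t"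
  shows "- (2 * (if t < q then q powr (s - 1) * t powr (1 + s) else q powr s * t powr s))
    \<le> ((max 0 (p - t)) powr s - p powr s) * ((q + t) powr s - q powr s)
      + ((p + t) powr s - p powr s) * ((max 0 (q - t)) powr s - q powr s)"
proof -
  have q: "0 < q" using pq by simp
  have g1: "\<bar>(max 0 (p - t)) powr s - p powr s\<bar> \<le> t powr s"
  proof -
    have "p powr s \<le> (max 0 (p - t) + t) powr s" using pq t s by (intro powr_mono2) auto
    also have "\<dots> \<le> (max 0 (p - t)) powr s + t powr s" using t s by (intro powr_add_le) auto
    moreover have "(max 0 (p - t)) powr s \<le> p powr s" using pq t s by (intro powr_mono2) auto
    ultimately show ?thesis by simp
  qed
  have g2: "\<bar>(p + t) powr s - p powr s\<bar> \<le> t powr s"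
    using powr_add_le[OF s, of p t] powr_mono2[of s p "p + t"] pq t s by simp
  have h2: "\<bar>(q + t) powr s - q powr s\<bar> \<le> t powr s"
    using powr_add_le[OF s, of q t] powr_mono2[of s q "q + t"] q t s by simp
  have g3: "\<bar>(max 0 (p - t)) powr s - p powr s\<bar> \<le> q powr s"
  proof -
    have "(max 0 (p - t)) powr s \<le> p powr s" "p powr s \<le> q powr s" using pq t s by (auto intro!: powr_mono2)
    moreover have "0 \<le> (max 0 (p - t)) powr s" by simp
    ultimately show ?thesis by linarith
  qed
  have h3: "\<bar>(max 0 (q - t)) powr s - q powr s\<bar> \<le> q powr s"
  proof -
    have "(max 0 (q - t)) powr s \<le> q powr s" using q t s by (intro powr_mono2) auto
    then show ?thesis by simp
  qed
  have prod: "- (A * B) \<le> x * y" if "\<bar>x\<bar> \<le> A" "\<bar>y\<bar> \<le> B" for x y A B :: real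
  proof -
    have "\<bar>x * y\<bar> \<le> A * B" unfolding abs_mult using that by (intro mult_mono) auto
    then show ?thesis by linarith
  qed
  show ?thesis
  proof (cases "t < q")
    case True
    have qs: "q powr s = q * q powr (s - 1)" using q powr_mult_base[of q "s - 1"] by simp
    have h4: "\<bar>(q + t) powr s - q powr s\<bar> \<le> q powr (s - 1) * t"
    proof -
      have "(q + t) powr s = q powr s * (1 + t / q) powr s"
        using q t powr_mult[of q "1 + t / q" s] by (simp add: distrib_left)
      also have "\<dots> \<le> q powr s * (1 + s * (t / q))"
        using powr_le_tangent[OF s, of "1 + t / q"] q t by (intro mult_left_mono) auto
      also have "\<dots> \<le> q powr s * (1 + 1 * (t / q))"
        using s q t by (intro mult_left_mono add_left_mono mult_right_mono) auto
      also have "\<dots> = q powr s + q powr (s - 1) * t" using q qs by (simp add: field_simps)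
      finally show ?thesis using powr_mono2[of s q "q + t"] q t s by simp
    qed
    \<comment> \<open>On the decreasing side, y <= y^s for y = (q - t) / q in [0, 1] takes the place
      of the tangent inequality.\<close>
    have h5: "\<bar>(max 0 (q - t)) powr s - q powr s\<bar> \<le> q powr (s - 1) * t"
    proof -
      have "q powr (s - 1) * (q - t) = q powr s * ((q - t) / q) powr 1"
        using True q qs by simp
      also have "\<dots> \<le> q powr s * ((q - t) / q) powr s"
        using True q t s by (intro mult_left_mono powr_mono') auto
      also have "\<dots> = (q - t) powr s" using True q powr_mult[of q "(q - t) / q" s] by simp
      finally have "q powr s - q powr (s - 1) * t \<le> (q - t) powr s" using qs by (simp add: algebra_simps)
      moreover have "(q - t) powr s \<le> q powr s" using True t s by (intro powr_mono2) auto
      ultimately show ?thesis using True by simp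
    qed
    have "t powr (1 + s) = t * t powr s" using t powr_mult_base[of t s] by simp
    then show ?thesis
      using prod[OF g1 h4] prod[OF g2 h5] True by (simp add: mult_ac)
  next
    case False
    then show ?thesis using prod[OF g3 h2] prod[OF g2 h3] by (simp add: mult_ac)
  qed
qed

text \<open>Discrete product rule: the second difference of g h at 0 is g(0) times that of h, plus
  h(0) times that of g, plus two products of increments. The first two terms integrate to 0 by
  \<open>half_line_harmonic\<close>; the products are bounded below by \<open>- M\<close> after
  division by the kernel, and the integral of \<open>M\<close> depends on neither \<open>p\<close>
  nor \<open>q\<close>.\<close>

lemma barrier_line_aux:
  fixes s p q :: real
  assumes s: "0 < s" "s < 1" and pq: "0 < p" "p \<le> q"
  defines "v \<equiv> \<lambda>t. (max 0 (p - t) * max 0 (q + t)) powr s"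
  shows "\<exists>G. set_integrable lborel {0<..} G \<and> - (2 / s + 2 / (1 - s)) \<le> (LBINT t:{0<..}. G t) \<and>
    (\<forall>t>0. G t \<le> (v t + v (- t) - 2 * v 0) / t powr (1 + 2 * s))"
proof -
  have q: "0 < q" using pq by simp
  define f where "f = (\<lambda>a t. ((a + t) powr s + (max 0 (a - t)) powr s - 2 * a powr s) / t powr (1 + 2 * s))"
  have fi: "set_integrable lborel {0<..} (f a)" "(LBINT t:{0<..}. f a t) = 0" if "0 < a" for a
    using half_line_harmonic[OF s that] by (simp_all add: f_def)
  \<comment> \<open>The bound of \<open>barrier_increments\<close> divided by t^(1+2s). The
    exponents -s and -1-s are integrable at 0 and at infinity, and all powers of \<open>q\<close>
    cancel in the integral.\<close>
  define M where "M = (\<lambda>t. if t < q then (2 * q powr (s - 1)) * t powr (- s) else (2 * q powr s) * t powr (- 1 - s))"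
  have M: "set_integrable lborel {0<..} M"
    "(LBINT t:{0<..}. M t) = (2 * q powr (s - 1)) * q powr (- s + 1) / (- s + 1) - (2 * q powr s) * q powr (- 1 - s + 1) / (- 1 - s + 1)"
    unfolding M_def using powr_two_sided_integral[of q "- s" "- 1 - s"] q s by auto
  have "q powr (s - 1) * q powr (- s + 1) = 1" "q powr s * q powr (- s) = 1"
    using q by (simp_all flip: powr_add)
  then have M2: "(LBINT t:{0<..}. M t) = 2 / s + 2 / (1 - s)"
    unfolding M(2) using s by (simp add: mult.assoc)
  define G where "G = (\<lambda>t. p powr s * f q t + q powr s * f p t - M t)"
  have "set_integrable lborel {0<..} G"
    unfolding G_def using fi(1)[OF q] fi(1)[OF pq(1)] M(1)
    by (intro set_integral_diff(1) set_integral_add(1) set_integrable_mult_right) auto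
  moreover have "(LBINT t:{0<..}. G t) = p powr s * (LBINT t:{0<..}. f q t) + q powr s * (LBINT t:{0<..}. f p t) - (LBINT t:{0<..}. M t)"
    unfolding G_def using fi(1)[OF q] fi(1)[OF pq(1)] M(1)
    by (simp add: set_integral_diff set_integral_add)
  moreover have "G t \<le> (v t + v (- t) - 2 * v 0) / t powr (1 + 2 * s)" if t: "0 < t" for t
  proof -
    have M': "M t = 2 * (if t < q then q powr (s - 1) * t powr (1 + s) else q powr s * t powr s) / t powr (1 + 2 * s)"
    proof -
      have "t powr (- s) = t powr (1 + s) / t powr (1 + 2 * s)" "t powr (- 1 - s) = t powr s / t powr (1 + 2 * s)"
      proof -
        have e: "- s = 1 + s - (1 + 2 * s)" "- 1 - s = s - (1 + 2 * s)" by auto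
        show "t powr (- s) = t powr (1 + s) / t powr (1 + 2 * s)" "t powr (- 1 - s) = t powr s / t powr (1 + 2 * s)"
          unfolding powr_diff[symmetric] by (rule arg_cong[OF e(1)], rule arg_cong[OF e(2)])
      qed
      then show ?thesis by (simp add: M_def)
    qed
    define hp hm gp gm where "hp = (q + t) powr s" and "hm = (max 0 (q - t)) powr s"
      and "gp = (max 0 (p - t)) powr s" and "gm = (p + t) powr s"
    have "G t = (p powr s * (hp + hm - 2 * q powr s) + q powr s * (gm + gp - 2 * p powr s)
       - 2 * (if t < q then q powr (s - 1) * t powr (1 + s) else q powr s * t powr s)) / t powr (1 + 2 * s)"
    proof -
      have "A * (X / T) + B * (Y / T) - Z / T = (A * X + B * Y - Z) / T" for A B X Y Z T :: real
        by (simp add: diff_divide_distrib add_divide_distrib)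
      then show ?thesis unfolding G_def f_def M' hp_def hm_def gp_def gm_def .
    qed
    also have "\<dots> \<le> (gp * hp + gm * hm - 2 * (p powr s * q powr s)) / t powr (1 + 2 * s)"
      using barrier_increments[OF s pq t] unfolding hp_def[symmetric] hm_def[symmetric] gp_def[symmetric] gm_def[symmetric]
      by (intro divide_right_mono) (auto simp: algebra_simps)
    also have "gp * hp + gm * hm - 2 * (p powr s * q powr s) = v t + v (- t) - 2 * v 0"
      using t pq by (simp add: v_def hp_def hm_def gp_def gm_def powr_mult max_def)
    finally show ?thesis .
  qed
  ultimately show ?thesis using fi(2)[OF q] fi(2)[OF pq(1)] M2 by (intro exI[of _ G]) auto
qed

lemma barrier_line:
  fixes s p q :: real
  assumes s: "0 < s" "s < 1" and pq: "0 < p" "0 < q"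
  defines "v \<equiv> \<lambda>t. (max 0 (p - t) * max 0 (q + t)) powr s"
  shows "\<exists>G. set_integrable lborel {0<..} G \<and> - (2 / s + 2 / (1 - s)) \<le> (LBINT t:{0<..}. G t) \<and>
    (\<forall>t>0. G t \<le> (v t + v (- t) - 2 * v 0) / t powr (1 + 2 * s))"
proof (cases "p \<le> q")
  case True
  then show ?thesis using barrier_line_aux[OF s pq(1), of q] unfolding v_def by blast
next
  case False
  then have "q \<le> p" by simp
  \<comment> \<open>Reflecting the line exchanges \<open>p\<close> and \<open>q\<close> and
    preserves the second difference.\<close>
  from barrier_line_aux[OF s pq(2) this] show ?thesis
    unfolding v_def by (simp add: mult.commute add.commute)
qed


section \<open>Interior and exterior balls\<close>

text \<open>A bound for the Hessian on \<open>K\<close> makes \<open>Df\<close> Lipschitz there; the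
  mean value inequality on a segment, applied to \<open>f\<close> minus its linear part at
  \<open>x\<close>, then gives the quadratic remainder.\<close>

lemma C2_on_taylor:
  fixes f :: "'a::euclidean_space \<Rightarrow> real"
  assumes "C2_on f UNIV"
  shows "\<exists>Df. \<forall>K. compact K \<longrightarrow> convex K \<longrightarrow> (\<exists>L\<ge>0. \<forall>x\<in>K. \<forall>y\<in>K. \<bar>f y - f x - Df x \<bullet> (y - x)\<bar> \<le> L * (norm (y - x))\<^sup>2)"
proof -
  obtain Df :: "'a \<Rightarrow> 'a" and D2f :: "'a \<Rightarrow> 'a \<Rightarrow>\<^sub>L 'a" where
    Df: "\<And>x. (f has_derivative (\<lambda>h. Df x \<bullet> h)) (at x)" and
    D2: "\<And>x. (Df has_derivative blinfun_apply (D2f x)) (at x)" and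
    c: "continuous_on UNIV D2f"
    using assms unfolding C2_on_def by auto
  show ?thesis
  proof (intro exI[of _ Df] allI impI)
    fix K :: "'a set" assume K: "compact K" "convex K"
    have "compact (D2f ` K)" using c K(1) by (meson compact_continuous_image continuous_on_subset top_greatest)
    then obtain L where L: "0 < L" "\<And>x. x \<in> K \<Longrightarrow> norm (D2f x) \<le> L"
      using compact_imp_bounded bounded_pos by (metis image_eqI)
    have lip: "norm (Df y - Df x) \<le> L * norm (y - x)" if "x \<in> K" "y \<in> K" for x y
    proof (rule differentiable_bound[OF K(2)])
      show "(Df has_derivative blinfun_apply (D2f z)) (at z within K)" for z
        using D2 by (rule has_derivative_at_withinI)
      show "onorm (blinfun_apply (D2f z)) \<le> L" if "z \<in> K" for z
        using L(2)[OF that] by (simp add: norm_blinfun.rep_eq)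
    qed (use that in auto)
    have "\<bar>f y - f x - Df x \<bullet> (y - x)\<bar> \<le> L * (norm (y - x))\<^sup>2" if xy: "x \<in> K" "y \<in> K" for x y
    proof -
      let ?S = "closed_segment x y"
      have S: "?S \<subseteq> K" using xy K(2) by (rule closed_segment_subset)
      define g where "g = (\<lambda>z. f z - Df x \<bullet> z)"
      have "norm (g y - g x) \<le> (L * norm (y - x)) * norm (y - x)"
      proof (rule differentiable_bound[of ?S g "\<lambda>z h. Df z \<bullet> h - Df x \<bullet> h"])
        show "(g has_derivative (\<lambda>h. Df z \<bullet> h - Df x \<bullet> h)) (at z within ?S)" for z
          unfolding g_def by (intro has_derivative_diff has_derivative_at_withinI[OF Df] 
            has_derivative_inner_right has_derivative_ident)
        fix z assume z: "z \<in> ?S"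
        have "norm (Df z \<bullet> h - Df x \<bullet> h) \<le> (L * norm (y - x)) * norm h" for h
        proof -
          have "norm (Df z \<bullet> h - Df x \<bullet> h) \<le> norm (Df z - Df x) * norm h"
            by (simp add: Cauchy_Schwarz_ineq2 flip: inner_diff_left)
          also have "\<dots> \<le> (L * norm (z - x)) * norm h"
            using lip[of x z] z S xy by (intro mult_right_mono) auto
          also have "\<dots> \<le> (L * norm (y - x)) * norm h"
            using L(1) segment_bound(1)[OF z] by (intro mult_right_mono mult_left_mono) auto
          finally show ?thesis .
        qed
        then show "onorm (\<lambda>h. Df z \<bullet> h - Df x \<bullet> h) \<le> L * norm (y - x)"
          by (rule onorm_le)
      qed auto
      then show ?thesis by (simp add: g_def inner_diff_right power2_eq_square algebra_simps)
    qed
    then show "\<exists>L\<ge>0. \<forall>x\<in>K. \<forall>y\<in>K. \<bar>f y - f x - Df x \<bullet> (y - x)\<bar> \<le> L * (norm (y - x))\<^sup>2"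
      using L(1) by (intro exI[of _ L]) auto
  qed
qed

text \<open>\<open>n\<close> acts as the inner unit normal. For R > 0 both balls touch at
  \<open>p\<close>, which forces \<open>p\<close> onto the boundary.\<close>

definition two_sided_ball :: "'a::euclidean_space set \<Rightarrow> real \<Rightarrow> 'a \<Rightarrow> 'a \<Rightarrow> bool" where
  "two_sided_ball \<Omega> R p n \<longleftrightarrow>
     norm n = 1 \<and> ball (p + R *\<^sub>R n) R \<subseteq> \<Omega> \<and> ball (p - R *\<^sub>R n) R \<inter> \<Omega> = {}"

lemma ball_along_unit_mono:
  fixes p n :: "'a::real_normed_vector"
  assumes "norm n = 1" "0 < r" "r \<le> R"
  shows "ball (p + r *\<^sub>R n) r \<subseteq> ball (p + R *\<^sub>R n) R"
proof -
  have "dist (p + r *\<^sub>R n) (p + R *\<^sub>R n) = R - r"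
    using assms by (simp add: dist_norm flip: scaleR_diff_left)
  then have "dist (p + R *\<^sub>R n) y < R" if "dist (p + r *\<^sub>R n) y < r" for y
    using that dist_triangle[of "p + R *\<^sub>R n" y "p + r *\<^sub>R n"] by (simp add: dist_commute)
  then show ?thesis by auto
qed

lemma two_sided_ball_mono:
  assumes "two_sided_ball \<Omega> R p n" "0 < r" "r \<le> R"
  shows "two_sided_ball \<Omega> r p n"
proof -
  have n: "norm n = 1" "norm (- n) = 1" using assms by (auto simp: two_sided_ball_def)
  show ?thesis
    using ball_along_unit_mono[OF n(1) assms(2,3), of p] ball_along_unit_mono[OF n(2) assms(2,3), of p] assms
    by (auto simp: two_sided_ball_def)
qed

text \<open>Expanding the square shows the ball as the set where a linear term dominates a quadratic
  one, the form that is compared with a Taylor remainder.\<close>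

lemma mem_ball_along_unit:
  fixes p n y :: "'a::real_inner"
  assumes "norm n = 1" "0 < R"
  shows "y \<in> ball (p + R *\<^sub>R n) R \<longleftrightarrow> (norm (y - p))\<^sup>2 < 2 * R * (n \<bullet> (y - p))"
proof -
  have "y \<in> ball (p + R *\<^sub>R n) R \<longleftrightarrow> norm ((y - p) - R *\<^sub>R n) < R"
    by (simp add: dist_norm norm_minus_commute algebra_simps)
  also have "\<dots> \<longleftrightarrow> (norm ((y - p) - R *\<^sub>R n))\<^sup>2 < R\<^sup>2"
    using assms(2) power2_less_imp_less[of "norm ((y - p) - R *\<^sub>R n)" R]
      power_strict_mono[of "norm ((y - p) - R *\<^sub>R n)" R 2] by auto
  also have "(norm ((y - p) - R *\<^sub>R n))\<^sup>2 = (norm (y - p))\<^sup>2 - 2 * R * (n \<bullet> (y - p)) + R\<^sup>2"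
  proof -
    have "n \<bullet> n = 1" using assms(1) by (simp add: dot_square_norm)
    then have "(a - R *\<^sub>R n) \<bullet> (a - R *\<^sub>R n) = a \<bullet> a - 2 * R * (n \<bullet> a) + R\<^sup>2" for a
      by (simp add: inner_diff_left inner_diff_right inner_commute power2_eq_square algebra_simps)
    then show ?thesis unfolding power2_norm_eq_inner .
  qed
  finally show ?thesis by simp
qed

text \<open>Near \<open>p0\<close> the set is where \<open>F\<close> is positive, and the gradient
  \<open>g\<close> of \<open>F\<close> has length at least 1. In a tangent ball of radius
  \<open>R\<close> with 2 R L < 1 the linear term of \<open>F\<close> beats the quadratic remainder,
  so \<open>F\<close> is positive in the inner and negative in the outer ball.\<close>

lemma C2_boundary_local_balls:
  fixes \<Omega> :: "'a::euclidean_space set"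
  assumes \<Omega>: "open \<Omega>" and C2: "C2_boundary \<Omega>" and p0: "p0 \<in> frontier \<Omega>"
  shows "\<exists>\<rho>>0. \<exists>R>0. \<forall>p\<in>frontier \<Omega> \<inter> ball p0 \<rho>. \<exists>n. two_sided_ball \<Omega> R p n"
proof -
  obtain r \<nu> \<gamma> where r: "0 < r" and \<nu>: "norm \<nu> = 1" and \<gamma>: "C2_on \<gamma> UNIV"
    and eq: "\<Omega> \<inter> ball p0 r = {x \<in> ball p0 r. x \<bullet> \<nu> > \<gamma> (x - (x \<bullet> \<nu>) *\<^sub>R \<nu>)}"
    using bspec[OF C2[unfolded C2_boundary_def] p0] by (elim exE conjE) (rule that)
  define P where "P = (\<lambda>x. x - (x \<bullet> \<nu>) *\<^sub>R \<nu>)"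
  define F where "F = (\<lambda>x. x \<bullet> \<nu> - \<gamma> (P x))"
  have \<nu>\<nu>: "\<nu> \<bullet> \<nu> = 1" using \<nu> by (simp add: dot_square_norm)
  have mem: "x \<in> \<Omega> \<longleftrightarrow> 0 < F x" if "x \<in> ball p0 r" for x
  proof -
    have "x \<in> \<Omega> \<inter> ball p0 r \<longleftrightarrow> x \<in> {x \<in> ball p0 r. x \<bullet> \<nu> > \<gamma> (x - (x \<bullet> \<nu>) *\<^sub>R \<nu>)}"
      by (simp only: eq)
    then show ?thesis using that unfolding F_def P_def Int_iff mem_Collect_eq by linarith
  qed
  have Pdiff: "P y - P x = P (y - x)" for x y
    by (simp add: P_def inner_diff_left scaleR_diff_left algebra_simps)
  have Pnorm: "norm (P x) \<le> norm x" for x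
  proof -
    have "(norm (P x))\<^sup>2 = (norm x)\<^sup>2 - (x \<bullet> \<nu>)\<^sup>2"
    proof -
      have "P x \<bullet> P x = x \<bullet> x - 2 * (x \<bullet> \<nu>) * (x \<bullet> \<nu>) + (x \<bullet> \<nu>) * (x \<bullet> \<nu>) * (\<nu> \<bullet> \<nu>)"
        unfolding P_def by (simp only: inner_diff_left inner_diff_right inner_scaleR_left inner_scaleR_right
            inner_commute[of \<nu> x]) (simp add: algebra_simps)
      then show ?thesis unfolding power2_norm_eq_inner \<nu>\<nu> by (simp add: power2_eq_square)
    qed
    then have "(norm (P x))\<^sup>2 \<le> (norm x)\<^sup>2" by simp
    then show ?thesis by (rule power2_le_imp_le) simp
  qed
  obtain D\<gamma> where D\<gamma>: "\<forall>K. compact K \<longrightarrow> convex K \<longrightarrow>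
      (\<exists>L\<ge>0. \<forall>x\<in>K. \<forall>y\<in>K. \<bar>\<gamma> y - \<gamma> x - D\<gamma> x \<bullet> (y - x)\<bar> \<le> L * (norm (y - x))\<^sup>2)"
    using C2_on_taylor[OF \<gamma>] ..
  from D\<gamma>[rule_format, of "cball (P p0) r"] obtain L where L: "0 \<le> L"
    and T: "\<And>x y. x \<in> cball (P p0) r \<Longrightarrow> y \<in> cball (P p0) r \<Longrightarrow>
       \<bar>\<gamma> y - \<gamma> x - D\<gamma> x \<bullet> (y - x)\<bar> \<le> L * (norm (y - x))\<^sup>2"
    by auto
  have Pb: "P x \<in> cball (P p0) r" if "x \<in> ball p0 r" for x
    using that Pdiff[of p0 x] Pnorm[of "p0 - x"] Pdiff[of x p0] by (auto simp: dist_norm)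
  \<comment> \<open>The gradient of \<open>F\<close>. Its component along \<nu> is 1, because the
    graph function sees only the projection; hence the lower bound for its norm.\<close>
  define g where "g = (\<lambda>x. \<nu> - P (D\<gamma> (P x)))"
  have g1: "g x \<bullet> \<nu> = 1" for x
    using \<nu>\<nu> by (simp add: g_def P_def inner_diff_left)
  have g_norm: "1 \<le> norm (g x)" for x
    using Cauchy_Schwarz_ineq2[of "g x" \<nu>] g1[of x] \<nu> by simp
  have FT: "\<bar>F y - F x - g x \<bullet> (y - x)\<bar> \<le> L * (norm (y - x))\<^sup>2" if "x \<in> ball p0 r" "y \<in> ball p0 r" for x y
  proof -
    have "D\<gamma> (P x) \<bullet> P (y - x) = P (D\<gamma> (P x)) \<bullet> (y - x)"
      by (simp add: P_def inner_diff_left inner_diff_right inner_commute)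
    then have "F y - F x - g x \<bullet> (y - x) = - (\<gamma> (P y) - \<gamma> (P x) - D\<gamma> (P x) \<bullet> (P y - P x))"
      unfolding Pdiff by (simp add: F_def g_def inner_diff_left inner_diff_right inner_commute)
    then have "\<bar>F y - F x - g x \<bullet> (y - x)\<bar> \<le> L * (norm (P y - P x))\<^sup>2"
      using T[OF Pb[OF that(1)] Pb[OF that(2)]] by simp
    also have "\<dots> \<le> L * (norm (y - x))\<^sup>2"
      using Pnorm[of "y - x"] L unfolding Pdiff by (intro mult_left_mono power_mono) auto
    finally show ?thesis .
  qed
  have F0: "F p = 0" if p: "p \<in> frontier \<Omega>" "p \<in> ball p0 r" for p
  proof -
    have "p \<notin> \<Omega>" using p(1) \<Omega> by (simp add: frontier_def interior_open)
    then have "F p \<le> 0" using mem[OF p(2)] by simp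
    moreover have "\<not> F p < 0"
    proof
      assume neg: "F p < 0"
      \<comment> \<open>Bounds the growth of \<open>F\<close> away from \<open>p\<close> inside the
        chart. It keeps \<open>F\<close> negative near \<open>p\<close>, although \<open>p\<close>
        lies in the closure of \<Omega>.\<close>
      define C where "C = norm (g p) + L * r * 2 + 1"
      have C: "0 < C" using L r by (simp add: C_def add_nonneg_pos)
      have "0 < min (r - dist p0 p) (- F p / C)"
        using divide_pos_pos[of "- F p" C] neg C p(2) by simp
      then obtain y where y: "y \<in> \<Omega>" "dist y p < min (r - dist p0 p) (- F p / C)"
      proof -
        have "p \<in> closure \<Omega>" using p(1) by (simp add: frontier_def)
        then show ?thesis
          using that \<open>0 < min (r - dist p0 p) (- F p / C)\<close> unfolding closure_approachable by blast
      qed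
      have yb: "y \<in> ball p0 r" using y(2) dist_triangle[of p0 y p] by (simp add: dist_commute)
      have n2: "norm (y - p) \<le> r * 2"
        using yb p(2) dist_triangle[of y p p0] by (simp add: dist_norm norm_minus_commute)
      have "F y - F p \<le> g p \<bullet> (y - p) + L * (norm (y - p))\<^sup>2"
        using FT[OF p(2) yb] by linarith
      also have "\<dots> \<le> norm (g p) * norm (y - p) + L * (r * 2) * norm (y - p)"
      proof (intro add_mono norm_cauchy_schwarz)
        have "norm (y - p) * norm (y - p) \<le> (r * 2) * norm (y - p)"
          using n2 by (rule mult_right_mono) simp
        from mult_left_mono[OF this L] show "L * (norm (y - p))\<^sup>2 \<le> L * (r * 2) * norm (y - p)"
          by (simp add: power2_eq_square mult.assoc)
      qed
      also have "\<dots> \<le> C * norm (y - p)" by (simp add: C_def algebra_simps)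
      also have "\<dots> < - F p"
        using y(2) C by (simp add: dist_norm field_simps)
      finally show False using mem[OF yb] y(1) by simp
    qed
    ultimately show ?thesis by simp
  qed
  \<comment> \<open>The first bound keeps tangent balls at points of \<open>ball p0 (r / 4)\<close>
    inside the chart \<open>ball p0 r\<close>; the second gives 2 R L < 1.\<close>
  define R where "R = min (r / 8) (1 / (2 * (L + 1)))"
  have R: "0 < R" "R \<le> r / 8" "R \<le> 1 / (2 * (L + 1))" using r L by (auto simp: R_def)
  have RL: "2 * R * L < 1"
  proof -
    have "2 * R * (L + 1) \<le> 1" using R(3) L by (simp add: field_simps)
    then show ?thesis using R(1) by (simp add: algebra_simps)
  qed
  have "\<exists>n. two_sided_ball \<Omega> R p n" if p: "p \<in> frontier \<Omega>" "p \<in> ball p0 (r / 4)" for p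
  proof -
    define n where "n = (1 / norm (g p)) *\<^sub>R g p"
    have gp: "0 < norm (g p)" using g_norm[of p] by linarith
    have n: "norm n = 1" "norm (- n) = 1" using gp by (auto simp: n_def)
    have gn: "g p = norm (g p) *\<^sub>R n" using gp by (simp add: n_def)
    have pb: "p \<in> ball p0 r" using p(2) r by simp
    have key: "y \<in> ball p0 r \<and> L * (norm (y - p))\<^sup>2 < norm (g p) * (m \<bullet> (y - p))"
      if y: "y \<in> ball (p + R *\<^sub>R m) R" and m: "norm m = 1" for y m
    proof -
      have "norm (y - p) < 2 * R"
        using y norm_triangle_ineq[of "y - p - R *\<^sub>R m" "R *\<^sub>R m"] m R(1)
        by (simp add: dist_norm norm_minus_commute algebra_simps)
      then have yb: "y \<in> ball p0 r"
        using p(2) R dist_triangle[of p0 y p] by (simp add: dist_norm norm_minus_commute)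
      have q: "(norm (y - p))\<^sup>2 < 2 * R * (m \<bullet> (y - p))"
        using y mem_ball_along_unit[OF m R(1)] by blast
      then have pos: "0 < m \<bullet> (y - p)"
        using R(1) by (smt (verit) zero_le_power2 zero_less_mult_pos)
      have "L * (norm (y - p))\<^sup>2 \<le> L * (2 * R * (m \<bullet> (y - p)))"
        using q L by (intro mult_left_mono) auto
      also have "\<dots> = (2 * R * L) * (m \<bullet> (y - p))" by simp
      also have "\<dots> < 1 * (m \<bullet> (y - p))" using RL pos by (intro mult_strict_right_mono) auto
      also have "\<dots> \<le> norm (g p) * (m \<bullet> (y - p))" using g_norm pos by (intro mult_right_mono) auto
      finally show ?thesis using yb by blast
    qed
    have "ball (p + R *\<^sub>R n) R \<subseteq> \<Omega>"
    proof
      fix y assume "y \<in> ball (p + R *\<^sub>R n) R"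
      from key[OF this n(1)] have yb: "y \<in> ball p0 r" and k: "L * (norm (y - p))\<^sup>2 < g p \<bullet> (y - p)"
        using gn by (auto simp: inner_scaleR_left[symmetric] simp del: inner_scaleR_left)
      then show "y \<in> \<Omega>" using FT[OF pb yb] F0[OF p(1) pb] mem[OF yb] by simp
    qed
    moreover have "y \<notin> \<Omega>" if "y \<in> ball (p - R *\<^sub>R n) R" for y
    proof -
      have yb: "y \<in> ball p0 r" and k: "L * (norm (y - p))\<^sup>2 < - (g p \<bullet> (y - p))"
        using key[of y "- n"] that n(2) gn
        by (auto simp: inner_scaleR_left[symmetric] simp del: inner_scaleR_left)
      then show "y \<notin> \<Omega>" using FT[OF pb yb] F0[OF p(1) pb] mem[OF yb] by simp
    qed
    ultimately show ?thesis using n(1) by (auto simp: two_sided_ball_def intro!: exI[of _ n])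
  qed
  then show ?thesis using r R(1) by (intro exI[of _ "r / 4"] conjI exI[of _ R]) auto
qed

text \<open>Finitely many local neighbourhoods cover the compact frontier, and the smallest of their
  radii works everywhere, since tangent balls shrink within each other.\<close>

lemma bounded_C2_domain_uniform_balls:
  fixes \<Omega> :: "'a::euclidean_space set"
  assumes "bounded_C2_domain \<Omega>"
  shows "\<exists>R>0. \<forall>p\<in>frontier \<Omega>. \<exists>n. two_sided_ball \<Omega> R p n"
proof -
  have \<Omega>: "open \<Omega>" "bounded \<Omega>" "C2_boundary \<Omega>" using assms by (auto simp: bounded_C2_domain_def)
  have "\<forall>q\<in>frontier \<Omega>. \<exists>\<rho>. 0 < \<rho> \<and> (\<exists>R>0. \<forall>p\<in>frontier \<Omega> \<inter> ball q \<rho>. \<exists>n. two_sided_ball \<Omega> R p n)"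
    using C2_boundary_local_balls[OF \<Omega>(1,3)] by blast
  from bchoice[OF this] obtain \<rho> where \<rho>: "\<forall>q\<in>frontier \<Omega>. 0 < \<rho> q \<and>
      (\<exists>R>0. \<forall>p\<in>frontier \<Omega> \<inter> ball q (\<rho> q). \<exists>n. two_sided_ball \<Omega> R p n)" ..
  then have "\<forall>q\<in>frontier \<Omega>. \<exists>R. 0 < R \<and> (\<forall>p\<in>frontier \<Omega> \<inter> ball q (\<rho> q). \<exists>n. two_sided_ball \<Omega> R p n)"
    by blast
  from bchoice[OF this] obtain S where S: "\<forall>q\<in>frontier \<Omega>. 0 < S q \<and>
      (\<forall>p\<in>frontier \<Omega> \<inter> ball q (\<rho> q). \<exists>n. two_sided_ball \<Omega> (S q) p n)" ..
  have "compact (frontier \<Omega>)" using \<Omega>(2) by (simp add: compact_frontier_bounded)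
  then obtain Q where Q: "Q \<subseteq> frontier \<Omega>" "finite Q" "frontier \<Omega> \<subseteq> (\<Union>q\<in>Q. ball q (\<rho> q))"
  proof (rule compactE_image[where f = "\<lambda>q. ball q (\<rho> q)" and C = "frontier \<Omega>"])
    show "frontier \<Omega> \<subseteq> (\<Union>q\<in>frontier \<Omega>. ball q (\<rho> q))"
      using \<rho> centre_in_ball by blast
  qed auto
  define R where "R = Min (insert 1 (S ` Q))"
  have R: "0 < R" using Q(1,2) S by (auto simp: R_def)
  have "\<exists>n. two_sided_ball \<Omega> R p n" if p: "p \<in> frontier \<Omega>" for p
  proof -
    obtain q where q: "q \<in> Q" "p \<in> ball q (\<rho> q)" using Q(3) p by blast
    have "R \<le> S q" unfolding R_def using q(1) Q(2) by (intro Min_le) auto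
    moreover obtain n where "two_sided_ball \<Omega> (S q) p n" using S q Q(1) p by blast
    ultimately show ?thesis using R two_sided_ball_mono by blast
  qed
  then show ?thesis using R by blast
qed

text \<open>A ball meeting both \<Omega> and its complement is connected and so meets the frontier,
  at a distance from \<open>x\<close> smaller than the radius.\<close>

lemma ball_subset_of_infdist_frontier:
  fixes \<Omega> :: "'a::euclidean_space set"
  assumes "x \<in> \<Omega>"
  shows "ball x (infdist x (frontier \<Omega>)) \<subseteq> \<Omega>"
proof
  fix y assume y: "y \<in> ball x (infdist x (frontier \<Omega>))"
  let ?B = "ball x (infdist x (frontier \<Omega>))"
  show "y \<in> \<Omega>"
  proof (rule ccontr)
    assume ny: "y \<notin> \<Omega>"
    have "x \<in> ?B" using y zero_le_dist[of x y] unfolding mem_ball dist_self by linarith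
    then have "?B \<inter> \<Omega> \<noteq> {}" using assms by blast
    moreover have "?B - \<Omega> \<noteq> {}" using y ny by blast
    ultimately have "?B \<inter> frontier \<Omega> \<noteq> {}"
      by (intro connected_Int_frontier connected_ball)
    then obtain z where "z \<in> ?B" "z \<in> frontier \<Omega>" by blast
    then show False using infdist_le[of z "frontier \<Omega>" x] by simp
  qed
qed

text \<open>The ball about \<open>x\<close> of radius d lies in \<Omega>, hence is disjoint from the
  exterior ball at a nearest point \<open>p\<close>, and the centres are at distance at least d + R.
  The path through \<open>p\<close> has exactly that length, so equality in the triangle inequality
  puts \<open>x\<close> on the normal at \<open>p\<close>.\<close>

lemma nearest_frontier_point:
  fixes \<Omega> :: "'a::euclidean_space set"
  assumes "open \<Omega>" "frontier \<Omega> \<noteq> {}" "x \<in> \<Omega>"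
    and R: "0 < R" "\<forall>p\<in>frontier \<Omega>. \<exists>n. two_sided_ball \<Omega> R p n"
  shows "0 < infdist x (frontier \<Omega>) \<and>
    (\<exists>p n. two_sided_ball \<Omega> R p n \<and> x = p + infdist x (frontier \<Omega>) *\<^sub>R n)"
proof -
  define d where "d = infdist x (frontier \<Omega>)"
  obtain p where p: "p \<in> frontier \<Omega>" "d = dist x p"
    unfolding d_def using infdist_attains_inf[of "frontier \<Omega>" x] assms(2) by auto
  have "x \<notin> frontier \<Omega>" using assms by (simp add: frontier_def interior_open)
  then have d: "0 < d" using p by auto
  obtain n where n: "two_sided_ball \<Omega> R p n" using R p(1) by blast
  have n1: "norm n = 1" using n by (simp add: two_sided_ball_def)
  define e where "e = p - R *\<^sub>R n"
  have disj: "ball x d \<inter> ball e R = {}"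
    using ball_subset_of_infdist_frontier[OF assms(3)] n unfolding d_def e_def two_sided_ball_def by blast
  have "d + R \<le> dist x e"
  proof (rule ccontr)
    assume "\<not> ?thesis"
    then have lt: "dist x e < d + R" by simp
    \<comment> \<open>The point dividing the segment of centres in the ratio d : R; if the centres
      are too close, it lies in both balls.\<close>
    define z where "z = x + (d / (d + R)) *\<^sub>R (e - x)"
    have "dist x z = d / (d + R) * dist x e"
      using d R(1) by (simp add: z_def dist_norm norm_minus_commute)
    also have "\<dots> < d / (d + R) * (d + R)" using lt d R(1) by (intro mult_strict_left_mono) auto
    also have "\<dots> = d" using d R(1) by simp
    finally have zx: "z \<in> ball x d" by simp
    have "e - z = (R / (d + R)) *\<^sub>R (e - x)"
    proof -
      have "1 - d / (d + R) = R / (d + R)" using d R(1) by (simp add: field_simps)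
      moreover have "e - z = (1 - d / (d + R)) *\<^sub>R (e - x)"
        by (simp add: z_def scaleR_diff_left)
      ultimately show ?thesis by simp
    qed
    then have "dist e z = R / (d + R) * dist x e"
      using d R(1) by (simp add: dist_norm norm_minus_commute)
    also have "\<dots> < R / (d + R) * (d + R)" using lt d R(1) by (intro mult_strict_left_mono) auto
    also have "\<dots> = R" using d R(1) by simp
    finally have "dist e z < R" .
    with zx show False using disj by auto
  qed
  moreover have "x - e = (x - p) + R *\<^sub>R n" by (simp add: e_def)
  ultimately have "norm (x - p) + norm (R *\<^sub>R n) \<le> norm ((x - p) + R *\<^sub>R n)"
    using p(2) n1 R(1) by (simp add: dist_norm)
  then have "norm ((x - p) + R *\<^sub>R n) = norm (x - p) + norm (R *\<^sub>R n)"
    using norm_triangle_ineq[of "x - p" "R *\<^sub>R n"] by linarith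
  then have "norm (x - p) *\<^sub>R (R *\<^sub>R n) = norm (R *\<^sub>R n) *\<^sub>R (x - p)"
    by (rule norm_triangle_eq[THEN iffD1])
  then have "R *\<^sub>R (d *\<^sub>R n) = R *\<^sub>R (x - p)"
    using R(1) n1 p(2) by (simp add: dist_norm mult.commute)
  then have "x - p = d *\<^sub>R n"
    using R(1) by (simp del: scaleR_scaleR)
  then have "x = p + d *\<^sub>R n" by (simp add: algebra_simps)
  with n d show ?thesis unfolding d_def by blast
qed


section \<open>Lower bounds for the tested operator\<close>

text \<open>Monotonicity of the nonnegative integral is enough, so nonmeasurable \<open>f\<close>,
  whose parts are lower integrals, are covered too. The minorant also keeps the negative part
  finite.\<close>

lemma ext_integral_ge:
  fixes f g :: "real \<Rightarrow> real"
  assumes g: "set_integrable lborel A g" and le: "\<And>t. t \<in> A \<Longrightarrow> g t \<le> f t"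
  shows "ereal (LBINT t:A. g t) \<le> ext_integral A f"
proof -
  define h where "h = (\<lambda>t. indicator A t *\<^sub>R g t)"
  have h: "integrable lborel h" using g by (simp add: set_integrable_def h_def)
  have fin: "(\<integral>\<^sup>+t. ennreal (h t) \<partial>lborel) < \<infinity>" "(\<integral>\<^sup>+t. ennreal (- h t) \<partial>lborel) < \<infinity>"
    using h unfolding real_integrable_def by (auto simp: less_top)
  have "(\<integral>\<^sup>+t. ennreal (h t) \<partial>lborel) \<le> (\<integral>\<^sup>+t\<in>A. ennreal (f t) \<partial>lborel)"
    using le by (intro nn_integral_mono) (auto simp: h_def indicator_def ennreal_leI)
  moreover have "(\<integral>\<^sup>+t\<in>A. ennreal (- f t) \<partial>lborel) \<le> (\<integral>\<^sup>+t. ennreal (- h t) \<partial>lborel)"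
    using le by (intro nn_integral_mono) (auto simp: h_def indicator_def ennreal_leI)
  ultimately have "enn2ereal (\<integral>\<^sup>+t. ennreal (h t) \<partial>lborel) - enn2ereal (\<integral>\<^sup>+t. ennreal (- h t) \<partial>lborel)
      \<le> ext_integral A f"
    unfolding ext_integral_def nn_integral_completion
    by (intro ereal_minus_mono) (auto simp: less_eq_ennreal.rep_eq)
  moreover have "(LBINT t:A. g t) = enn2real (\<integral>\<^sup>+t. ennreal (h t) \<partial>lborel) - enn2real (\<integral>\<^sup>+t. ennreal (- h t) \<partial>lborel)"
    unfolding set_lebesgue_integral_def h_def[symmetric] using h by (rule real_lebesgue_integral_def)
  moreover have "enn2ereal x = ereal (enn2real x)" if "x < \<infinity>" for x
    using that by (cases x) (auto simp: less_top[symmetric])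
  ultimately show ?thesis using fin by simp
qed

lemma set_integrable_powr_Icc:
  fixes a b c e :: real
  assumes "0 < a"
  shows "set_integrable lborel {a..b} (\<lambda>t. c / t powr e)"
  using assms by (intro borel_integrable_atLeastAtMost') (auto intro!: continuous_intros)

lemma powr_integral_ge:
  fixes a e l :: real
  assumes a: "0 < a" and l: "0 < l" and e: "0 < e"
  shows "l * (1 + l) powr (- e) * a powr (1 - e) \<le> (LBINT t:{a..a * (1 + l)}. 1 / t powr e)"
proof -
  let ?b = "a * (1 + l)"
  have ab: "a < ?b" using a l by simp
  have "(LBINT t:{a..?b}. 1 / ?b powr e) \<le> (LBINT t:{a..?b}. 1 / t powr e)"
    using a ab e by (intro set_integral_mono set_integrable_powr_Icc borel_integrable_atLeastAtMost' divide_left_mono powr_mono2 mult_pos_pos)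
      (auto intro!: continuous_intros)
  also have "(LBINT t:{a..?b}. 1 / ?b powr e) = (?b - a) * (1 / ?b powr e)"
    unfolding set_lebesgue_integral_def using ab by simp
  also have "\<dots> = l * (1 + l) powr (- e) * a powr (1 - e)"
  proof -
    have "?b powr e = a powr e * (1 + l) powr e" using a l by (simp only: powr_mult)
    moreover have "?b - a = l * a" by (simp add: algebra_simps)
    moreover have "(1 + l) powr (- e) = 1 / (1 + l) powr e" by (rule powr_minus_divide)
    moreover have "a powr (1 - e) = a / a powr e" using a by (simp add: powr_diff)
    ultimately show ?thesis by simp
  qed
  finally show ?thesis .
qed

text \<open>Parseval's identity writes the squared norm as a sum of \<open>CARD('n)\<close> squares,
  one of which is at least the average.\<close>

lemma orthonormal_large_component:
  fixes w :: "real ^ 'n"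
  assumes "\<xi> \<in> orthonormal_bases"
  shows "\<exists>i. (norm w)\<^sup>2 \<le> real CARD('n) * (\<xi> i \<bullet> w)\<^sup>2"
proof (rule ccontr)
  assume neg: "\<not> ?thesis"
  have on: "\<xi> i \<bullet> \<xi> j = (if i = j then 1 else 0)" for i j
    using assms by (auto simp: orthonormal_bases_def)
  have sp: "span (range \<xi>) = UNIV" using assms by (auto simp: orthonormal_bases_def)
  define v where "v = w - (\<Sum>i\<in>UNIV. (\<xi> i \<bullet> w) *\<^sub>R \<xi> i)"
  have "v \<bullet> \<xi> j = 0" for j
  proof -
    have "(\<Sum>i\<in>UNIV. (\<xi> i \<bullet> w) * (\<xi> i \<bullet> \<xi> j)) = (\<Sum>i\<in>UNIV. if i = j then \<xi> i \<bullet> w else 0)"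
      by (intro sum.cong) (auto simp: on)
    then show ?thesis by (simp add: v_def inner_diff_left inner_sum_left inner_commute[of w])
  qed
  then have "orthogonal v v"
    using sp by (intro orthogonal_to_span[of v "range \<xi>"]) (auto simp: orthogonal_def)
  then have "w = (\<Sum>i\<in>UNIV. (\<xi> i \<bullet> w) *\<^sub>R \<xi> i)" by (simp add: v_def orthogonal_self)
  then have "w \<bullet> w = (\<Sum>i\<in>UNIV. (\<xi> i \<bullet> w) *\<^sub>R \<xi> i) \<bullet> w" by (rule arg_cong)
  then have "(norm w)\<^sup>2 = (\<Sum>i\<in>UNIV. (\<xi> i \<bullet> w)\<^sup>2)"
    unfolding power2_norm_eq_inner by (simp add: inner_sum_left power2_eq_square)
  also have "\<dots> < (\<Sum>i\<in>(UNIV :: 'n set). (norm w)\<^sup>2 / real CARD('n))"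
    using neg by (intro sum_strict_mono) (auto simp: not_le field_simps)
  also have "\<dots> = (norm w)\<^sup>2" by simp
  finally show False by simp
qed

text \<open>Relative length of the parameter interval on which a ray stays in the target ball; small
  enough to keep (t - \<kappa>)^2 below r^2 / (2 N) in \<open>ray_hits_ball\<close>.\<close>

definition ray_width :: "real \<Rightarrow> real" where "ray_width N = 1 / (2 * N)"

text \<open>\<kappa> is the parameter of the point of the line closest to \<open>e\<close>, and
  \<sigma> the sense leading there. With r = \<open>dist x e\<close>, the squared distance to
  \<open>e\<close> at parameter t is r^2 - \<kappa>^2 + (t - \<kappa>)^2, where \<kappa>^2 is at
  least r^2 / N and the last square is less than r^2 / (2 N).\<close>

lemma ray_hits_ball:
  fixes x e \<xi> :: "'a::real_inner"
  assumes \<xi>: "norm \<xi> = 1" and N: "1 \<le> N" and x: "x \<noteq> e"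
    and comp: "(dist x e)\<^sup>2 \<le> N * (\<xi> \<bullet> (x - e))\<^sup>2"
    and \<rho>: "0 < \<rho>" "(dist x e)\<^sup>2 * (1 - 1 / (2 * N)) \<le> \<rho>\<^sup>2"
  obtains \<kappa> \<sigma> where "\<sigma> = 1 \<or> \<sigma> = - 1" "0 < \<kappa>" "\<kappa> \<le> dist x e" "dist x e \<le> N * \<kappa>"
    "\<And>t. t \<in> {\<kappa>..\<kappa> * (1 + ray_width N)} \<Longrightarrow> x + (\<sigma> * t) *\<^sub>R \<xi> \<in> ball e \<rho>"
proof -
  define r where "r = dist x e"
  define \<kappa> where "\<kappa> = \<bar>\<xi> \<bullet> (x - e)\<bar>"
  define \<sigma> :: real where "\<sigma> = (if \<xi> \<bullet> (x - e) \<le> 0 then 1 else - 1)"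
  have r: "0 < r" using x by (simp add: r_def)
  have \<sigma>: "\<sigma> = 1 \<or> \<sigma> = - 1" "\<sigma> * (\<xi> \<bullet> (x - e)) = - \<kappa>" by (auto simp: \<sigma>_def \<kappa>_def)
  have \<kappa>r: "\<kappa> \<le> r" unfolding \<kappa>_def r_def dist_norm
    using Cauchy_Schwarz_ineq2[of \<xi> "x - e"] \<xi> by simp
  have c: "r\<^sup>2 \<le> N * \<kappa>\<^sup>2" using comp by (simp add: r_def \<kappa>_def)
  have \<kappa>0: "0 < \<kappa>"
  proof (rule ccontr)
    assume "\<not> ?thesis"
    then have "\<kappa> = 0" by (simp add: \<kappa>_def)
    then show False using c r by simp
  qed
  have "r * r \<le> N * \<kappa> * \<kappa>" using c by (simp add: power2_eq_square mult.assoc)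
  also have "\<dots> \<le> N * \<kappa> * r" using \<kappa>r N \<kappa>0 by (intro mult_left_mono) auto
  finally have "r * r \<le> N * \<kappa> * r" .
  then have rN: "r \<le> N * \<kappa>" using r by simp
  have hit: "x + (\<sigma> * t) *\<^sub>R \<xi> \<in> ball e \<rho>" if t: "t \<in> {\<kappa>..\<kappa> * (1 + ray_width N)}" for t
  proof -
    have "0 \<le> t - \<kappa>" "t - \<kappa> \<le> \<kappa> / (2 * N)" using t by (auto simp: ray_width_def algebra_simps)
    then have "(t - \<kappa>)\<^sup>2 \<le> (\<kappa> / (2 * N))\<^sup>2" by (intro power_mono) auto
    also have "\<dots> \<le> (r / (2 * N))\<^sup>2" using \<kappa>r \<kappa>0 N by (intro power_mono divide_right_mono) auto
    also have "\<dots> = r\<^sup>2 / (2 * N) / (2 * N)" by (simp add: power2_eq_square)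
    also have "\<dots> < r\<^sup>2 / (2 * N)" using r N by (simp add: divide_less_eq)
    finally have t1: "(t - \<kappa>)\<^sup>2 < r\<^sup>2 / (2 * N)" .
    have \<xi>\<xi>: "\<xi> \<bullet> \<xi> = 1" using \<xi> by (simp add: dot_square_norm)
    have \<sigma>2: "\<sigma> * \<sigma> = 1" using \<sigma>(1) by auto
    have "(norm ((x - e) + (\<sigma> * t) *\<^sub>R \<xi>))\<^sup>2 = (x - e) \<bullet> (x - e) + 2 * t * (\<sigma> * (\<xi> \<bullet> (x - e))) + (\<sigma> * \<sigma>) * (t * t) * (\<xi> \<bullet> \<xi>)"
      unfolding power2_norm_eq_inner
      by (simp only: inner_add_left inner_add_right inner_scaleR_left inner_scaleR_right inner_commute[of "x - e" \<xi>])
        (simp add: algebra_simps)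
    also have "\<dots> = r\<^sup>2 - 2 * t * \<kappa> + t * t"
      unfolding \<sigma>(2) \<xi>\<xi> \<sigma>2 by (simp add: r_def dist_norm power2_norm_eq_inner)
    also have "\<dots> = (t - \<kappa>)\<^sup>2 + r\<^sup>2 - \<kappa>\<^sup>2" by (simp add: power2_eq_square algebra_simps)
    also have "\<dots> < r\<^sup>2 / (2 * N) + r\<^sup>2 - r\<^sup>2 / N"
    proof -
      have "r\<^sup>2 / N \<le> \<kappa>\<^sup>2" using c N by (simp add: field_simps)
      then show ?thesis using t1 by linarith
    qed
    also have "\<dots> = r\<^sup>2 * (1 - 1 / (2 * N))" using N by (simp add: field_simps)
    also have "\<dots> \<le> \<rho>\<^sup>2" using \<rho>(2) by (simp add: r_def)
    finally have "norm ((x - e) + (\<sigma> * t) *\<^sub>R \<xi>) < \<rho>"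
      by (rule power2_less_imp_less) (use \<rho> in simp)
    moreover have "dist e (x + (\<sigma> * t) *\<^sub>R \<xi>) = norm ((x - e) + (\<sigma> * t) *\<^sub>R \<xi>)"
      by (simp add: dist_norm norm_minus_commute[of e] algebra_simps)
    ultimately show ?thesis by simp
  qed
  show ?thesis
    using that[of \<sigma> \<kappa>] \<sigma>(1) \<kappa>0 \<kappa>r rN hit unfolding r_def by blast
qed

lemma orthonormal_basis_ray_hits_ball:
  fixes x e :: "real ^ 'n"
  assumes \<xi>: "\<xi> \<in> orthonormal_bases" and x: "x \<noteq> e"
    and \<rho>: "0 < \<rho>" "(dist x e)\<^sup>2 * (1 - 1 / (2 * real CARD('n))) \<le> \<rho>\<^sup>2"
  obtains i \<kappa> \<sigma> where "\<sigma> = 1 \<or> \<sigma> = - 1" "0 < \<kappa>" "\<kappa> \<le> dist x e" "dist x e \<le> real CARD('n) * \<kappa>"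
    "\<And>t. t \<in> {\<kappa>..\<kappa> * (1 + ray_width (real CARD('n)))} \<Longrightarrow> x + (\<sigma> * t) *\<^sub>R \<xi> i \<in> ball e \<rho>"
proof -
  obtain i where i: "(dist x e)\<^sup>2 \<le> real CARD('n) * (\<xi> i \<bullet> (x - e))\<^sup>2"
    using orthonormal_large_component[OF \<xi>, of "x - e"] by (auto simp: dist_norm)
  have "\<xi> i \<bullet> \<xi> i = 1" using \<xi> by (auto simp: orthonormal_bases_def)
  then have n: "norm (\<xi> i) = 1" by (simp add: norm_eq_1)
  have N: "1 \<le> real CARD('n)" by (simp add: Suc_leI)
  show ?thesis
    by (rule ray_hits_ball[OF n N x i \<rho>]) (rule that)
qed

text \<open>The lower bound of \<open>powr_integral_ge\<close> for the integral of t^(-1-2s) over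
  [a, a (1 + l)], without its factor a^(-2s).\<close>

definition gain_const :: "real \<Rightarrow> real \<Rightarrow> real" where
  "gain_const s l = l * (1 + l) powr (- (1 + 2 * s))"

lemma ray_width_pos: "0 < ray_width (real CARD('n::finite))"
  by (simp add: ray_width_def)

lemma gain_const_pos: "0 < l \<Longrightarrow> 0 < gain_const s l"
  by (simp add: gain_const_def)

section \<open>Cost against gain in the viscosity inequality\<close>

lemma C_frac_pos:
  assumes "0 < s" "s < 1"
  shows "0 < C_frac s"
  using assms unfolding C_frac_def by (intro divide_pos_pos mult_pos_pos) auto

lemma ext_integral_split_ge:
  fixes G f1 f2 :: "real \<Rightarrow> real"
  assumes \<rho>: "0 < \<rho>" and G: "set_integrable lborel {0<..} G"
    and 1: "\<And>t. 0 < t \<Longrightarrow> t < \<rho> \<Longrightarrow> G t \<le> f1 t" and 2: "\<And>t. \<rho> \<le> t \<Longrightarrow> G t \<le> f2 t"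
  shows "ereal (LBINT t:{0<..}. G t) \<le> ext_integral {0<..<\<rho>} f1 + ext_integral {\<rho>..} f2"
proof -
  have U: "{0<..} = {0<..<\<rho>} \<union> {\<rho>..}" using \<rho> by auto
  have i: "set_integrable lborel {0<..<\<rho>} G" "set_integrable lborel {\<rho>..} G"
    using \<rho> by (auto intro!: set_integrable_subset[OF G])
  have "(LBINT t:{0<..}. G t) = (LBINT t:{0<..<\<rho>}. G t) + (LBINT t:{\<rho>..}. G t)"
    unfolding U by (rule set_integral_Un) (use i in auto)
  then have "ereal (LBINT t:{0<..}. G t) = ereal (LBINT t:{0<..<\<rho>}. G t) + ereal (LBINT t:{\<rho>..}. G t)"
    by simp
  also have "\<dots> \<le> ext_integral {0<..<\<rho>} f1 + ext_integral {\<rho>..} f2"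
    using 1 2 i by (intro add_mono ext_integral_ge) auto
  finally show ?thesis .
qed

text \<open>
  The bounds \<open>G\<close> cost at most \<open>K\<close> in each direction, while every orthonormal basis has one
  direction that gains \<open>\<mu>\<close> on an interval of relative length \<open>l\<close>.
\<close>
lemma supersolution_gain_le:
  fixes u :: "real ^ 'n \<Rightarrow> real"
  assumes s: "0 < s" "s < 1" and u: "visc_supersolution s \<Omega> u" and x: "x \<in> \<Omega>" and \<rho>: "0 < \<rho>"
    and \<phi>: "C2_on \<phi> (ball x \<rho>)" "\<And>y. y \<in> ball x \<rho> \<Longrightarrow> u x - \<phi> x \<le> u y - \<phi> y"
    and G: "\<And>\<xi>. norm \<xi> = 1 \<Longrightarrow> set_integrable lborel {0<..} (G \<xi>) \<and> - K \<le> (LBINT t:{0<..}. G \<xi> t)"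
    and low1: "\<And>\<xi> t. norm \<xi> = 1 \<Longrightarrow> 0 < t \<Longrightarrow> t < \<rho> \<Longrightarrow> G \<xi> t \<le> delta \<phi> x (t *\<^sub>R \<xi>) / t powr (1 + 2 * s)"
    and low2: "\<And>\<xi> t. norm \<xi> = 1 \<Longrightarrow> \<rho> \<le> t \<Longrightarrow> G \<xi> t \<le> delta u x (t *\<^sub>R \<xi>) / t powr (1 + 2 * s)"
    and l: "0 < l" and \<mu>: "0 < \<mu>"
    and gain: "\<And>\<xi>. \<xi> \<in> orthonormal_bases \<Longrightarrow> \<exists>i a. \<rho> \<le> a \<and> a \<le> A \<and>
       (\<forall>t\<in>{a..a * (1 + l)}. G (\<xi> i) t + \<mu> / t powr (1 + 2 * s) \<le> delta u x (t *\<^sub>R \<xi> i) / t powr (1 + 2 * s))"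
  shows "\<mu> * (gain_const s l * A powr (- 2 * s)) \<le> real CARD('n) * K"
proof -
  define e where "e = 1 + 2 * s"
  define g where "g = \<mu> * (gain_const s l * A powr (- 2 * s))"
  define b where "b = g - real CARD('n) * K"
  let ?D = "\<lambda>\<xi> i. ext_integral {0<..<\<rho>} (\<lambda>\<tau>. delta \<phi> x (\<tau> *\<^sub>R \<xi> i) / \<tau> powr (1 + 2 * s))
        + ext_integral {\<rho>..} (\<lambda>\<tau>. delta u x (\<tau> *\<^sub>R \<xi> i) / \<tau> powr (1 + 2 * s))"
  have "ereal b \<le> (\<Sum>i\<in>UNIV. ?D \<xi> i)" if \<xi>: "\<xi> \<in> orthonormal_bases" for \<xi> :: "'n \<Rightarrow> real ^ 'n"
  proof -
    have n: "norm (\<xi> i) = 1" for i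
    proof -
      have "\<xi> i \<bullet> \<xi> i = 1" using \<xi> by (auto simp: orthonormal_bases_def)
      then show ?thesis by (simp add: norm_eq_1)
    qed
    have plain: "ereal (- K) \<le> ?D \<xi> i" for i
    proof -
      have "ereal (- K) \<le> ereal (LBINT t:{0<..}. G (\<xi> i) t)" using G[OF n] by simp
      also have "\<dots> \<le> ?D \<xi> i"
        using G[OF n] low1[OF n] low2[OF n] \<rho> by (intro ext_integral_split_ge) auto
      finally show ?thesis .
    qed
    obtain i0 a where a: "\<rho> \<le> a" "a \<le> A" and
      ga: "\<And>t. t \<in> {a..a * (1 + l)} \<Longrightarrow> G (\<xi> i0) t + \<mu> / t powr (1 + 2 * s) \<le> delta u x (t *\<^sub>R \<xi> i0) / t powr (1 + 2 * s)"
      using gain[OF \<xi>] by blast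
    have a0: "0 < a" using a \<rho> by simp
    let ?J = "{a..a * (1 + l)}"
    \<comment> \<open>The gain as a function on the whole half-line. It vanishes before
      \<open>a\<close>, hence before \<rho>, so only the part of the operator that sees
      \<open>u\<close> has to provide it.\<close>
    define h where "h = (\<lambda>t. \<mu> * (indicator ?J t * (1 / t powr e)))"
    have hJ: "set_integrable lborel ?J (\<lambda>t. 1 / t powr e)"
      using a0 by (rule set_integrable_powr_Icc)
    have J0: "indicator {0<..} t *\<^sub>R h t = \<mu> * (indicator ?J t *\<^sub>R (1 / t powr e))" for t
      using a0 by (auto simp: h_def indicator_def)
    have h: "set_integrable lborel {0<..} h"
      using hJ unfolding set_integrable_def J0 by (intro integrable_mult_right)
    have hI: "(LBINT t:{0<..}. h t) = \<mu> * (LBINT t:?J. 1 / t powr e)"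
      unfolding set_lebesgue_integral_def J0 by (rule integral_mult_right_zero)
    have special: "ereal (- K + g) \<le> ?D \<xi> i0"
    proof -
      have "A powr (- 2 * s) \<le> a powr (- 2 * s)" using a a0 s by (intro powr_mono2') auto
      then have "gain_const s l * A powr (- 2 * s) \<le> l * (1 + l) powr (- e) * a powr (1 - e)"
        using l unfolding gain_const_def e_def by (simp add: mult_left_mono)
      also have "\<dots> \<le> (LBINT t:?J. 1 / t powr e)"
        using a0 l s by (intro powr_integral_ge) (auto simp: e_def)
      finally have "g \<le> (LBINT t:{0<..}. h t)"
        unfolding g_def hI using \<mu> by (intro mult_left_mono) auto
      then have "- K + g \<le> (LBINT t:{0<..}. G (\<xi> i0) t + h t)"
        using G[OF n, of i0] h by (simp add: set_integral_add)
      then have "ereal (- K + g) \<le> ereal (LBINT t:{0<..}. G (\<xi> i0) t + h t)" by simp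
      also have "\<dots> \<le> ?D \<xi> i0"
      proof (rule ext_integral_split_ge[OF \<rho>])
        show "set_integrable lborel {0<..} (\<lambda>t. G (\<xi> i0) t + h t)"
          using G[OF n] h by (intro set_integral_add) auto
        show "G (\<xi> i0) t + h t \<le> delta \<phi> x (t *\<^sub>R \<xi> i0) / t powr (1 + 2 * s)" if "0 < t" "t < \<rho>" for t
          using low1[OF n that] that a by (simp add: h_def indicator_def)
        show "G (\<xi> i0) t + h t \<le> delta u x (t *\<^sub>R \<xi> i0) / t powr (1 + 2 * s)" if "\<rho> \<le> t" for t
          using low2[OF n that] ga[of t] by (cases "t \<in> ?J") (auto simp: h_def e_def)
      qed
      finally show ?thesis .
    qed
    have "ereal b = ereal (\<Sum>i\<in>UNIV. - K + (if i = i0 then g else 0))"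
    proof -
      have "(\<Sum>i\<in>UNIV. - K + (if i = i0 then g else 0)) = (\<Sum>i\<in>(UNIV :: 'n set). - K) + (\<Sum>i\<in>UNIV. if i = i0 then g else 0)"
        by (rule sum.distrib)
      then show ?thesis by (simp add: b_def)
    qed
    also have "\<dots> = (\<Sum>i\<in>UNIV. ereal (- K + (if i = i0 then g else 0)))"
      by (simp only: sum_ereal)
    also have "\<dots> \<le> (\<Sum>i\<in>UNIV. ?D \<xi> i)"
      using plain special by (intro sum_mono) auto
    finally show ?thesis .
  qed
  \<comment> \<open>The bound is the same for every basis and so passes to the infimum, attained or
    not.\<close>
  then have "ereal b \<le> (INF \<xi>\<in>orthonormal_bases. \<Sum>i\<in>UNIV. ?D \<xi> i)"
    by (intro INF_greatest)
  then have "ereal (C_frac s) * ereal b \<le> I_minus_test s \<rho> \<phi> u x"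
    unfolding I_minus_test_def using C_frac_pos[OF s] by (intro ereal_mult_left_mono) auto
  also have "\<dots> \<le> 0"
    using u x \<rho> \<phi> unfolding visc_supersolution_def by blast
  finally have "C_frac s * b \<le> 0" by simp
  then have "b \<le> 0" using C_frac_pos[OF s] by (simp add: mult_le_0_iff)
  then show ?thesis by (simp add: b_def g_def)
qed


section \<open>Minimum principles\<close>

text \<open>Without a minimum, every \<open>x\<close> has a competitor \<open>w x\<close> whose
  value lies below all values near \<open>x\<close>. In a finite subcover, the competitor of least
  value lies in one of the balls, and the competitor of that ball is lower still.\<close>

lemma lsc_on_add_attains_min:
  fixes u g :: "'a::metric_space \<Rightarrow> real"
  assumes K: "compact K" "K \<noteq> {}" "K \<subseteq> S" and u: "lsc_on u S" and g: "continuous_on K g"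
  shows "\<exists>x\<in>K. \<forall>y\<in>K. u x + g x \<le> u y + g y"
proof (rule ccontr)
  let ?f = "\<lambda>x. u x + g x"
  assume "\<not> ?thesis"
  then have "\<forall>x\<in>K. \<exists>y. y \<in> K \<and> ?f y < ?f x" by (auto simp: not_le)
  from bchoice[OF this] obtain w where w: "\<forall>x\<in>K. w x \<in> K \<and> ?f (w x) < ?f x" ..
  have "\<exists>d>0. \<forall>y\<in>K. dist y x < d \<longrightarrow> ?f (w x) < ?f y" if x: "x \<in> K" for x
  proof -
    \<comment> \<open>Half of the gap to the competitor: \<open>u\<close> and \<open>g\<close> may
      each lose this much near \<open>x\<close>.\<close>
    define e where "e = (?f x - ?f (w x)) / 2"
    have e: "0 < e" using w x by (auto simp: e_def)
    have "\<forall>\<^sub>F y in at x within S. u x - e < u y"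
      using u x K(3) e unfolding lsc_on_def by auto
    then obtain d1 where d1: "0 < d1" "\<And>y. y \<in> S \<Longrightarrow> y \<noteq> x \<Longrightarrow> dist y x < d1 \<Longrightarrow> u x - e < u y"
      unfolding eventually_at by blast
    obtain d2 where d2: "0 < d2" "\<And>y. y \<in> K \<Longrightarrow> dist y x < d2 \<Longrightarrow> dist (g y) (g x) < e"
      using g x e unfolding continuous_on_iff by blast
    have "?f (w x) < ?f y" if y: "y \<in> K" "dist y x < min d1 d2" for y
    proof -
      have "u x - e < u y" using d1(2)[of y] y K(3) e by (cases "y = x") auto
      moreover have "g x - e < g y" using d2(2)[of y] y by (auto simp: dist_real_def)
      moreover have "?f (w x) = ?f x - 2 * e" by (simp add: e_def field_simps)
      ultimately show ?thesis by linarith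
    qed
    then show ?thesis using d1(1) d2(1) by (intro exI[of _ "min d1 d2"]) auto
  qed
  then have "\<forall>x\<in>K. \<exists>d. 0 < d \<and> (\<forall>y\<in>K. dist y x < d \<longrightarrow> ?f (w x) < ?f y)" by blast
  from bchoice[OF this] obtain d where d: "\<forall>x\<in>K. 0 < d x \<and> (\<forall>y\<in>K. dist y x < d x \<longrightarrow> ?f (w x) < ?f y)" ..
  obtain Q where Q: "Q \<subseteq> K" "finite Q" "K \<subseteq> (\<Union>x\<in>Q. ball x (d x))"
  proof (rule compactE_image[OF K(1), of K "\<lambda>x. ball x (d x)"])
    show "K \<subseteq> (\<Union>x\<in>K. ball x (d x))" using d by force
  qed auto
  have Qne: "Q \<noteq> {}" using Q(3) K(2) by auto
  define m where "m = Min ((\<lambda>x. ?f (w x)) ` Q)"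
  have "m \<in> (\<lambda>x. ?f (w x)) ` Q" unfolding m_def using Q(2) Qne by (intro Min_in) auto
  then obtain q where q: "q \<in> Q" "m = ?f (w q)" by blast
  then have "w q \<in> K" using Q(1) w by blast
  then obtain p where p: "p \<in> Q" "dist (w q) p < d p" using Q(3) by (auto simp: dist_commute)
  have "?f (w p) < ?f (w q)" using d p Q(1) \<open>w q \<in> K\<close> by blast
  moreover have "m \<le> ?f (w p)" unfolding m_def using Q(2) p(1) by (intro Min_le) auto
  ultimately show False using q(2) by simp
qed

lemma lsc_on_pos_lower_bound:
  fixes u :: "'a::metric_space \<Rightarrow> real"
  assumes "compact K" "K \<subseteq> S" "lsc_on u S" "\<And>x. x \<in> K \<Longrightarrow> 0 < u x"
  shows "\<exists>\<mu>>0. \<forall>x\<in>K. \<mu> \<le> u x"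
proof (cases "K = {}")
  case False
  from lsc_on_add_attains_min[OF assms(1) this assms(2,3) continuous_on_const[of K 0]]
  obtain x where "x \<in> K" "\<forall>y\<in>K. u x \<le> u y" by auto
  then show ?thesis using assms(4) by blast
qed (auto intro: exI[of _ 1])

section \<open>Test functions and rays leaving the domain\<close>

lemma C2_on_subset: "C2_on f S \<Longrightarrow> T \<subseteq> S \<Longrightarrow> C2_on f T"
  unfolding C2_on_def by (meson continuous_on_subset subsetD)

lemma C2_on_const: "C2_on (\<lambda>x. c) S"
  unfolding C2_on_def
  by (intro exI[of _ "\<lambda>x. 0"]) (auto intro!: derivative_eq_intros exI[of _ "\<lambda>x. 0"])

lemma C2_on_neg_square:
  fixes a :: "'a::euclidean_space"
  shows "C2_on (\<lambda>x. - (k * (norm (x - a))\<^sup>2)) S"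
  unfolding C2_on_def
proof (intro exI[of _ "\<lambda>x. (- 2 * k) *\<^sub>R (x - a)"] exI[of _ "\<lambda>x. (- 2 * k) *\<^sub>R id_blinfun"] conjI ballI)
  fix x
  have e: "blinfun_apply ((- 2 * k) *\<^sub>R id_blinfun) = (\<lambda>h :: 'a. (- 2 * k) *\<^sub>R h)"
    by (simp add: fun_eq_iff blinfun.scaleR_left blinfun.minus_left)
  show "((\<lambda>x. - (k * (norm (x - a))\<^sup>2)) has_derivative (\<lambda>h. ((- 2 * k) *\<^sub>R (x - a)) \<bullet> h)) (at x)"
    unfolding power2_norm_eq_inner
    by (auto intro!: derivative_eq_intros simp: algebra_simps inner_commute)
  show "((\<lambda>x. (- 2 * k) *\<^sub>R (x - a)) has_derivative blinfun_apply ((- 2 * k) *\<^sub>R id_blinfun)) (at x)"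
    unfolding e by (intro has_derivative_scaleR_right) (auto intro!: derivative_eq_intros)
qed (rule continuous_on_const)

lemma infdist_frontier_ge:
  fixes \<Omega> :: "'a::euclidean_space set"
  assumes "open \<Omega>" "frontier \<Omega> \<noteq> {}" "ball x r \<subseteq> \<Omega>"
  shows "r \<le> infdist x (frontier \<Omega>)"
proof -
  obtain p where p: "p \<in> frontier \<Omega>" "infdist x (frontier \<Omega>) = dist x p"
    using infdist_attains_inf[of "frontier \<Omega>" x] assms(2) by auto
  have "p \<notin> \<Omega>" using p(1) assms(1) by (simp add: frontier_def interior_open)
  then have "p \<notin> ball x r" using assms(3) by blast
  then show ?thesis using p(2) by simp
qed

lemma bounded_C2_domain_frontier:
  fixes \<Omega> :: "'a::euclidean_space set"
  assumes "bounded_C2_domain \<Omega>"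
  shows "frontier \<Omega> \<noteq> {}"
proof -
  have "\<Omega> \<noteq> {}" "bounded \<Omega>" using assms by (auto simp: bounded_C2_domain_def)
  then show ?thesis using frontier_not_empty[of \<Omega>] not_bounded_UNIV by fastforce
qed

text \<open>Near the boundary the target is an exterior ball of radius proportional to the distance;
  far from it, a ray longer than the diameter bound \<open>D\<close> has left the domain. The exit
  parameter must be at most a multiple of the distance, so that the gain scales like the
  cost.\<close>

lemma exterior_ray:
  fixes \<Omega> :: "(real ^ 'n) set"
  assumes \<Omega>: "bounded_C2_domain \<Omega>"
  obtains C where "0 < C"
    "\<And>x \<xi>. x \<in> \<Omega> \<Longrightarrow> \<xi> \<in> orthonormal_bases \<Longrightarrow> \<exists>i \<kappa> \<sigma>. (\<sigma> = 1 \<or> \<sigma> = - 1) \<and> 0 < \<kappa> \<and>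
        \<kappa> \<le> C * infdist x (frontier \<Omega>) \<and>
        (\<forall>t\<in>{\<kappa>..\<kappa> * (1 + ray_width (real CARD('n)))}. x + (\<sigma> * t) *\<^sub>R \<xi> i \<notin> \<Omega>)"
proof -
  let ?N = "real CARD('n)"
  have N: "1 \<le> ?N" by (simp add: Suc_leI)
  have op: "open \<Omega>" and bd: "bounded \<Omega>" using \<Omega> by (auto simp: bounded_C2_domain_def)
  note fr = bounded_C2_domain_frontier[OF \<Omega>]
  obtain R where R: "0 < R" "\<forall>p\<in>frontier \<Omega>. \<exists>n. two_sided_ball \<Omega> R p n"
    using bounded_C2_domain_uniform_balls[OF \<Omega>] by blast
  obtain b where b: "0 < b" "\<And>x. x \<in> \<Omega> \<Longrightarrow> norm x \<le> b"
    using bd unfolding bounded_pos by blast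
  define D where "D = 2 * b + 1"
  have D: "0 < D" "\<And>x y. x \<in> \<Omega> \<Longrightarrow> y \<in> \<Omega> \<Longrightarrow> dist x y < D"
  proof -
    show "0 < D" using b(1) by (simp add: D_def)
    show "dist x y < D" if "x \<in> \<Omega>" "y \<in> \<Omega>" for x y
      using b(2)[OF that(1)] b(2)[OF that(2)] norm_triangle_ineq4[of x y] by (simp add: D_def dist_norm)
  qed
  define C where "C = 4 * ?N + 4 * ?N * D / R"
  have C: "0 < C" "4 * ?N \<le> C" "4 * ?N * D / R \<le> C"
    using N D(1) R(1) by (auto simp: C_def intro!: add_pos_nonneg)
  have "\<exists>i \<kappa> \<sigma>. (\<sigma> = 1 \<or> \<sigma> = - 1) \<and> 0 < \<kappa> \<and> \<kappa> \<le> C * infdist x (frontier \<Omega>) \<and>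
        (\<forall>t\<in>{\<kappa>..\<kappa> * (1 + ray_width ?N)}. x + (\<sigma> * t) *\<^sub>R \<xi> i \<notin> \<Omega>)"
    if x: "x \<in> \<Omega>" and \<xi>: "\<xi> \<in> orthonormal_bases" for x and \<xi> :: "'n \<Rightarrow> real ^ 'n"
  proof -
    define d where "d = infdist x (frontier \<Omega>)"
    obtain p n where d0: "0 < d" and n: "two_sided_ball \<Omega> R p n" and xp: "x = p + d *\<^sub>R n"
      using nearest_frontier_point[OF op fr x R] unfolding d_def by blast
    have n1: "norm n = 1" using n by (simp add: two_sided_ball_def)
    show ?thesis
    proof (cases "4 * ?N * d \<le> R")
      case True
      \<comment> \<open>The centre is then at distance 4 N d from \<open>x\<close>, and (4 N - 1)^2
        >= (4 N)^2 (1 - 1 / (2 N)), as \<open>ray_hits_ball\<close> requires.\<close>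
      define \<rho> where "\<rho> = (4 * ?N - 1) * d"
      have "1 < real CARD('n) * 4" using N by linarith
      then have \<rho>: "0 < \<rho>" "\<rho> \<le> R" using d0 True by (auto simp: \<rho>_def algebra_simps)
      define e where "e = p - \<rho> *\<^sub>R n"
      have disj: "ball e \<rho> \<inter> \<Omega> = {}"
        using two_sided_ball_mono[OF n \<rho>] by (simp add: two_sided_ball_def e_def)
      have "x - e = (4 * ?N * d) *\<^sub>R n"
        by (simp add: xp e_def \<rho>_def algebra_simps)
      then have dxe: "dist x e = 4 * ?N * d" using n1 d0 by (simp add: dist_norm)
      have "(4 * ?N * d)\<^sup>2 * (1 - 1 / (2 * ?N)) \<le> \<rho>\<^sup>2"
      proof -
        have "(4 * ?N * d)\<^sup>2 * (1 - 1 / (2 * ?N)) = d\<^sup>2 * (16 * ?N\<^sup>2 - 8 * ?N)"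
          using N by (simp add: field_simps power2_eq_square)
        also have "\<dots> \<le> d\<^sup>2 * (4 * ?N - 1)\<^sup>2"
          by (intro mult_left_mono) (simp_all add: power2_eq_square algebra_simps)
        finally show ?thesis by (simp add: \<rho>_def power_mult_distrib mult.commute)
      qed
      moreover have "x \<noteq> e" using dxe d0 N by auto
      ultimately obtain i \<kappa> \<sigma> where r: "\<sigma> = 1 \<or> \<sigma> = - 1" "0 < \<kappa>" "\<kappa> \<le> dist x e"
          "\<And>t. t \<in> {\<kappa>..\<kappa> * (1 + ray_width ?N)} \<Longrightarrow> x + (\<sigma> * t) *\<^sub>R \<xi> i \<in> ball e \<rho>"
        using orthonormal_basis_ray_hits_ball[OF \<xi>, of x e \<rho>] \<rho>(1) dxe by metis
      have "\<kappa> \<le> C * d" using r(3) dxe mult_right_mono[OF C(2), of d] d0 by linarith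
      then show ?thesis using r(1,2,4) disj unfolding d_def by blast
    next
      case False
      \<comment> \<open>Now d > R / (4 N), so the fixed length \<open>D\<close> is itself at most a
        multiple of d.\<close>
      then have "D \<le> 4 * ?N * D / R * d" using D(1) R(1) N by (simp add: field_simps)
      also have "\<dots> \<le> C * d" using C(3) d0 by (intro mult_right_mono) auto
      finally have DC: "D \<le> C * d" .
      fix i0 :: 'n
      have "\<xi> i0 \<bullet> \<xi> i0 = 1" using \<xi> by (auto simp: orthonormal_bases_def)
      then have ni: "norm (\<xi> i0) = 1" by (simp add: norm_eq_1)
      have "x + (1 * t) *\<^sub>R \<xi> i0 \<notin> \<Omega>" if "t \<in> {D..D * (1 + ray_width ?N)}" for t
      proof
        assume "x + (1 * t) *\<^sub>R \<xi> i0 \<in> \<Omega>"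
        from D(2)[OF x this] show False using that ni D(1) by (simp add: dist_norm)
      qed
      then show ?thesis using DC D(1) unfolding d_def by (intro exI[of _ i0] exI[of _ D] exI[of _ 1]) auto
    qed
  qed
  then show ?thesis using that C(1) by blast
qed

text \<open>Let the infimum \<open>m\<close> be negative. At a point with value below m +
  \<epsilon>, at distance of order t from the boundary, touching from below costs at most a multiple
  of \<epsilon> t^(-2s). Rays leaving \<Omega> at parameters of order t meet nonnegative values,
  which is a gain of order -m t^(-2s). The factor t^(-2s) cancels and a small \<epsilon> is
  contradictory.\<close>

lemma weak_minimum_principle:
  fixes u :: "real ^ 'n \<Rightarrow> real"
  assumes s: "0 < s" "s < 1" and \<Omega>: "bounded_C2_domain \<Omega>" and u: "visc_supersolution s \<Omega> u"
    and out: "\<And>x. x \<notin> \<Omega> \<Longrightarrow> 0 \<le> u x"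
  shows "0 \<le> u x"
proof (rule ccontr)
  assume neg: "\<not> 0 \<le> u x"
  let ?N = "real CARD('n)"
  have N: "1 \<le> ?N" by (simp add: Suc_leI)
  have op: "open \<Omega>" using \<Omega> by (auto simp: bounded_C2_domain_def)
  note fr = bounded_C2_domain_frontier[OF \<Omega>]
  have lsc: "lsc_on u \<Omega>" and "bounded (range u)" using u by (auto simp: visc_supersolution_def)
  then have bdd: "bdd_below (range u)" by (simp add: bounded_imp_bdd_below)
  define m where "m = Inf (range u)"
  have mle: "m \<le> u y" for y unfolding m_def using bdd by (intro cInf_lower) auto
  have m: "m < 0" using mle[of x] neg by simp
  obtain C where C: "0 < C" and ray:
    "\<And>x \<xi>. x \<in> \<Omega> \<Longrightarrow> \<xi> \<in> orthonormal_bases \<Longrightarrow> \<exists>i \<kappa> \<sigma>. (\<sigma> = 1 \<or> \<sigma> = - 1) \<and> 0 < \<kappa> \<and>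
        \<kappa> \<le> C * infdist x (frontier \<Omega>) \<and>
        (\<forall>t\<in>{\<kappa>..\<kappa> * (1 + ray_width ?N)}. x + (\<sigma> * t) *\<^sub>R \<xi> i \<notin> \<Omega>)"
    using exterior_ray[OF \<Omega>] by metis
  have l: "0 < ray_width ?N" using N by (simp add: ray_width_def)
  have gc: "0 < gain_const s (ray_width ?N)" using l by (simp add: gain_const_def)
  define c0 where "c0 = 2 / (1 - s) + 1 / s"
  have c0: "0 < c0" using s by (simp add: c0_def add_pos_pos)
  have main: "- m * (gain_const s (ray_width ?N) * (3 * C) powr (- 2 * s)) \<le> ?N * c0 * \<epsilon>"
    if \<epsilon>: "0 < \<epsilon>" "\<epsilon> < - m" for \<epsilon>
  proof -
    have "\<exists>y. u y < m + \<epsilon>"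
      using cInf_lessD[of "range u" "m + \<epsilon>"] \<epsilon> unfolding m_def by auto
    then obtain y0 where y0: "u y0 < m + \<epsilon>" by blast
    have y0\<Omega>: "y0 \<in> \<Omega>" using out[of y0] y0 \<epsilon> by fastforce
    define t where "t = infdist y0 (frontier \<Omega>) / 2"
    have "y0 \<notin> frontier \<Omega>" using y0\<Omega> op by (simp add: frontier_def interior_open)
    then have "0 < infdist y0 (frontier \<Omega>)" using in_closed_iff_infdist_zero[OF frontier_closed fr] infdist_nonneg[of y0] 
      by (metis less_eq_real_def)
    then have t: "0 < t" by (simp add: t_def)
    have cb: "cball y0 t \<subseteq> \<Omega>"
    proof -
      have "cball y0 t \<subseteq> ball y0 (infdist y0 (frontier \<Omega>))" using t by (auto simp: t_def)
      then show ?thesis using ball_subset_of_infdist_frontier[OF y0\<Omega>] by blast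
    qed
    \<comment> \<open>At distance at least t from \<open>y0\<close> the paraboloid is at least 2
      \<epsilon>, more than the excess of \<open>u y0\<close> over the infimum, so the minimum on
      \<open>cball y0 t\<close> is global.\<close>
    define k where "k = 2 * \<epsilon> / t\<^sup>2"
    have k: "0 < k" using \<epsilon> t by (simp add: k_def)
    define \<phi> where "\<phi> = (\<lambda>y. - (k * (norm (y - y0))\<^sup>2))"
    have "\<exists>x\<in>cball y0 t. \<forall>y\<in>cball y0 t. u x + k * (norm (x - y0))\<^sup>2 \<le> u y + k * (norm (y - y0))\<^sup>2"
      using t cb lsc by (intro lsc_on_add_attains_min[of _ \<Omega>]) (auto intro!: continuous_intros)
    then obtain x0 where x0: "x0 \<in> cball y0 t"
      and x0min: "\<And>y. y \<in> cball y0 t \<Longrightarrow> u x0 + k * (norm (x0 - y0))\<^sup>2 \<le> u y + k * (norm (y - y0))\<^sup>2"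
      by blast
    have x0le: "u x0 + k * (norm (x0 - y0))\<^sup>2 < m + \<epsilon>"
      using x0min[of y0] t y0 by simp
    have glob: "u x0 - \<phi> x0 \<le> u y - \<phi> y" for y
    proof (cases "y \<in> cball y0 t")
      case False
      then have "t\<^sup>2 \<le> (norm (y - y0))\<^sup>2"
        using t by (intro power_mono) (auto simp: dist_norm norm_minus_commute)
      then have "k * t\<^sup>2 \<le> k * (norm (y - y0))\<^sup>2" using k by simp
      moreover have "k * t\<^sup>2 = 2 * \<epsilon>" using t by (simp add: k_def)
      ultimately show ?thesis using x0le mle[of y] \<epsilon> by (simp add: \<phi>_def)
    qed (use x0min in \<open>simp add: \<phi>_def\<close>)
    have x0\<Omega>: "x0 \<in> \<Omega>" using x0 cb by blast
    have ux0: "u x0 < m + \<epsilon>" using x0le k by (smt (verit) mult_nonneg_nonneg zero_le_power2)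
    have dx0: "t \<le> infdist x0 (frontier \<Omega>)" "infdist x0 (frontier \<Omega>) \<le> 3 * t"
      using x0 infdist_triangle[of y0 "frontier \<Omega>" x0] infdist_triangle[of x0 "frontier \<Omega>" y0]
      by (auto simp: t_def dist_commute)
    \<comment> \<open>Below t the second difference of the paraboloid is -4 \<epsilon> \<tau>^2 /
      t^2; above t that of \<open>u\<close> is at least -2 \<epsilon>, because \<open>u x0\<close>
      exceeds the infimum by less than \<epsilon>.\<close>
    define G where "G = (\<lambda>(\<xi> :: real ^ 'n) \<tau>. if \<tau> < t then (- (4 * \<epsilon> / t\<^sup>2)) * \<tau> powr (1 - 2 * s) else (- (2 * \<epsilon>)) * \<tau> powr (- 1 - 2 * s))"
    have e: "1 - 2 * s + 1 = 2 - 2 * s" "- 1 - 2 * s + 1 = - 2 * s" by auto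
    note pw = powr_two_sided_integral[of t "1 - 2 * s" "- 1 - 2 * s" "- (4 * \<epsilon> / t\<^sup>2)" "- (2 * \<epsilon>)", unfolded e]
    have GI: "set_integrable lborel {0<..} (G \<xi>)" "(LBINT \<tau>:{0<..}. G \<xi> \<tau>) = - (\<epsilon> * t powr (- 2 * s) * c0)" for \<xi>
    proof -
      show "set_integrable lborel {0<..} (G \<xi>)"
        unfolding G_def using pw(1) t s by simp
      have "(LBINT \<tau>:{0<..}. G \<xi> \<tau>) = - (4 * \<epsilon> / t\<^sup>2) * t powr (2 - 2 * s) / (2 - 2 * s) - (- (2 * \<epsilon>)) * t powr (- 2 * s) / (- 2 * s)"
        unfolding G_def using pw(2) t s by simp
      also have "t powr (2 - 2 * s) = t\<^sup>2 * t powr (- 2 * s)"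
        using t powr_add[of t 2 "- 2 * s"] by simp
      also have "- (4 * \<epsilon> / t\<^sup>2) * (t\<^sup>2 * t powr (- 2 * s)) / (2 - 2 * s) - (- (2 * \<epsilon>)) * t powr (- 2 * s) / (- 2 * s)
          = - (\<epsilon> * t powr (- 2 * s) * c0)"
      proof -
        have "- (4 * \<epsilon> / t\<^sup>2) * (t\<^sup>2 * P) / (2 * r) - (- (2 * \<epsilon>)) * P / (- 2 * s) = - (\<epsilon> * P * (2 / r + 1 / s))"
          if "0 < r" for P r :: real
          using that s t by (simp add: field_simps)
        from this[of "1 - s" "t powr (- 2 * s)"] show ?thesis using s by (simp add: c0_def)
      qed
      finally show "(LBINT \<tau>:{0<..}. G \<xi> \<tau>) = - (\<epsilon> * t powr (- 2 * s) * c0)" .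
    qed
    have dlow: "- (2 * \<epsilon>) \<le> delta u x0 y" for y
      using mle[of "x0 + y"] mle[of "x0 - y"] ux0 by (simp add: delta_def)
    have pe: "\<tau> powr (- 1 - 2 * s) = 1 / \<tau> powr (1 + 2 * s)" for \<tau>
    proof -
      have "- 1 - 2 * s = - (1 + 2 * s)" by simp
      then show ?thesis by (simp only: powr_minus_divide)
    qed
    have "(- m) * (gain_const s (ray_width ?N) * (3 * C * t) powr (- 2 * s)) \<le> ?N * (\<epsilon> * t powr (- 2 * s) * c0)"
    proof (rule supersolution_gain_le[OF s u x0\<Omega> t, of \<phi> G])
      show "C2_on \<phi> (ball x0 t)" unfolding \<phi>_def by (rule C2_on_neg_square)
      show "u x0 - \<phi> x0 \<le> u y - \<phi> y" for y by (rule glob)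
      show "set_integrable lborel {0<..} (G \<xi>) \<and> - (\<epsilon> * t powr (- 2 * s) * c0) \<le> (LBINT t:{0<..}. G \<xi> t)" for \<xi>
        using GI by simp
      show "0 < ray_width ?N" by (rule l)
      show "0 < - m" using m by simp
    next
      fix \<xi> :: "real ^ 'n" and \<tau> assume \<xi>: "norm \<xi> = 1" and \<tau>: "0 < \<tau>" "\<tau> < t"
      have "delta \<phi> x0 (\<tau> *\<^sub>R \<xi>) = - (2 * k) * \<tau>\<^sup>2"
      proof -
        have "(norm (a + b))\<^sup>2 + (norm (a - b))\<^sup>2 = 2 * (norm a)\<^sup>2 + 2 * (norm b)\<^sup>2" for a b :: "real ^ 'n"
          unfolding power2_norm_eq_inner
          by (simp only: inner_add_left inner_add_right inner_diff_left inner_diff_right)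
        from this[of "x0 - y0" "\<tau> *\<^sub>R \<xi>"]
        have "(norm (x0 + \<tau> *\<^sub>R \<xi> - y0))\<^sup>2 + (norm (x0 - \<tau> *\<^sub>R \<xi> - y0))\<^sup>2 = 2 * (norm (x0 - y0))\<^sup>2 + 2 * \<tau>\<^sup>2"
          using \<xi> by (simp add: algebra_simps)
        then have "k * (norm (x0 + \<tau> *\<^sub>R \<xi> - y0))\<^sup>2 + k * (norm (x0 - \<tau> *\<^sub>R \<xi> - y0))\<^sup>2 = k * (2 * (norm (x0 - y0))\<^sup>2 + 2 * \<tau>\<^sup>2)"
          by (simp only: distrib_left[symmetric])
        then show ?thesis by (simp add: delta_def \<phi>_def algebra_simps)
      qed
      moreover have "\<tau> powr (1 - 2 * s) = \<tau>\<^sup>2 / \<tau> powr (1 + 2 * s)"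
        using \<tau> powr_diff[of \<tau> 2 "1 + 2 * s"] by simp
      ultimately show "G \<xi> \<tau> \<le> delta \<phi> x0 (\<tau> *\<^sub>R \<xi>) / \<tau> powr (1 + 2 * s)"
        using \<tau> by (simp add: G_def k_def)
    next
      fix \<xi> :: "real ^ 'n" and \<tau> assume "norm \<xi> = 1" and \<tau>: "t \<le> \<tau>"
      then show "G \<xi> \<tau> \<le> delta u x0 (\<tau> *\<^sub>R \<xi>) / \<tau> powr (1 + 2 * s)"
        using divide_right_mono[OF dlow[of "\<tau> *\<^sub>R \<xi>"], of "\<tau> powr (1 + 2 * s)"]
        unfolding G_def pe by simp
    next
      fix \<xi> :: "'n \<Rightarrow> real ^ 'n" assume \<xi>: "\<xi> \<in> orthonormal_bases"
      obtain i \<kappa> \<sigma> where r: "\<sigma> = 1 \<or> \<sigma> = - 1" "0 < \<kappa>" "\<kappa> \<le> C * infdist x0 (frontier \<Omega>)"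
        "\<And>\<tau>. \<tau> \<in> {\<kappa>..\<kappa> * (1 + ray_width ?N)} \<Longrightarrow> x0 + (\<sigma> * \<tau>) *\<^sub>R \<xi> i \<notin> \<Omega>"
        using ray[OF x0\<Omega> \<xi>] by blast
      have "\<xi> i \<bullet> \<xi> i = 1" using \<xi> by (auto simp: orthonormal_bases_def)
      then have ni: "norm (\<xi> i) = 1" by (simp add: norm_eq_1)
      have "x0 + (\<sigma> * \<kappa>) *\<^sub>R \<xi> i \<notin> \<Omega>" using r(2,4) l by simp
      then have "\<not> dist x0 (x0 + (\<sigma> * \<kappa>) *\<^sub>R \<xi> i) < infdist x0 (frontier \<Omega>)"
        using ball_subset_of_infdist_frontier[OF x0\<Omega>] by auto
      then have t\<kappa>: "t \<le> \<kappa>" using dx0 ni r(1,2) by (auto simp: dist_norm)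
      have \<kappa>A: "\<kappa> \<le> 3 * C * t"
      proof -
        have "C * infdist x0 (frontier \<Omega>) \<le> C * (3 * t)" using dx0(2) C by (intro mult_left_mono) auto
        then show ?thesis using r(3) by (simp only: mult.assoc mult.left_commute[of C 3])
      qed
      have "G (\<xi> i) \<tau> + - m / \<tau> powr (1 + 2 * s) \<le> delta u x0 (\<tau> *\<^sub>R \<xi> i) / \<tau> powr (1 + 2 * s)"
        if \<tau>: "\<tau> \<in> {\<kappa>..\<kappa> * (1 + ray_width ?N)}" for \<tau>
      proof -
        have "0 \<le> u (x0 + (\<sigma> * \<tau>) *\<^sub>R \<xi> i)" using r(4)[OF \<tau>] out by blast
        then have "- m - 2 * \<epsilon> \<le> delta u x0 (\<tau> *\<^sub>R \<xi> i)"
          using r(1) mle[of "x0 + \<tau> *\<^sub>R \<xi> i"] mle[of "x0 - \<tau> *\<^sub>R \<xi> i"] ux0 by (auto simp: delta_def)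
        from divide_right_mono[OF this, of "\<tau> powr (1 + 2 * s)"] \<tau> t\<kappa>
        show ?thesis unfolding G_def pe by (simp add: diff_divide_distrib)
      qed
      then show "\<exists>i a. t \<le> a \<and> a \<le> 3 * C * t \<and>
         (\<forall>\<tau>\<in>{a..a * (1 + ray_width ?N)}. G (\<xi> i) \<tau> + - m / \<tau> powr (1 + 2 * s) \<le> delta u x0 (\<tau> *\<^sub>R \<xi> i) / \<tau> powr (1 + 2 * s))"
        using t\<kappa> \<kappa>A by blast
    qed
    moreover have "(3 * C * t) powr (- 2 * s) = (3 * C) powr (- 2 * s) * t powr (- 2 * s)" by (rule powr_mult)
    ultimately have "(- m * (gain_const s (ray_width ?N) * (3 * C) powr (- 2 * s))) * t powr (- 2 * s) \<le> (?N * c0 * \<epsilon>) * t powr (- 2 * s)"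
      by (simp only: mult_ac)
    then show ?thesis by (rule mult_right_le_imp_le) (use t in simp)
  qed
  define B where "B = - m * (gain_const s (ray_width ?N) * (3 * C) powr (- 2 * s))"
  have B: "0 < B" unfolding B_def using m gc C by (intro mult_pos_pos) auto
  \<comment> \<open>Small enough that the cost is at most half of the gain \<open>B\<close>.\<close>
  define \<epsilon> where "\<epsilon> = min (- m / 2) (B / (2 * ?N * c0))"
  have \<epsilon>: "0 < \<epsilon>" "\<epsilon> < - m" "\<epsilon> \<le> B / (2 * ?N * c0)" using m B N c0 by (auto simp: \<epsilon>_def)
  have "B \<le> ?N * c0 * \<epsilon>" using main[OF \<epsilon>(1,2)] by (simp add: B_def)
  also have "\<dots> \<le> ?N * c0 * (B / (2 * ?N * c0))" using \<epsilon>(3) N c0 by (intro mult_left_mono) auto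
  also have "\<dots> = B / 2" using N c0 by simp
  finally show False using B by simp
qed

text \<open>At a zero \<open>x0\<close> the constant 0 touches from below at no cost. If
  \<open>x0\<close> lies on the sphere of a ball where \<open>u\<close> is positive, every basis has
  a ray into a smaller concentric ball, on which semicontinuity bounds \<open>u\<close> away from 0,
  so the gain is strictly positive.\<close>

lemma strong_minimum_principle:
  fixes u :: "real ^ 'n \<Rightarrow> real"
  assumes s: "0 < s" "s < 1" and \<Omega>: "open \<Omega>" "connected \<Omega>" and u: "visc_supersolution s \<Omega> u"
    and nonneg: "\<And>x. 0 \<le> u x" and ne: "\<exists>x\<in>\<Omega>. u x \<noteq> 0" and x: "x \<in> \<Omega>"
  shows "0 < u x"
proof (rule ccontr)
  assume ux: "\<not> 0 < u x"
  let ?N = "real CARD('n)"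
  have N: "1 \<le> ?N" by (simp add: Suc_leI)
  have lsc: "lsc_on u \<Omega>" using u by (auto simp: visc_supersolution_def)
  define P where "P = {y \<in> \<Omega>. 0 < u y}"
  have Pne: "P \<noteq> {}" using ne nonneg by (force simp: P_def less_le)
  have Popen: "open P"
    unfolding open_dist
  proof
    fix y assume y: "y \<in> P"
    obtain d1 where d1: "0 < d1" "ball y d1 \<subseteq> \<Omega>" using \<Omega>(1) y by (auto simp: P_def open_contains_ball)
    have "\<forall>\<^sub>F z in at y within \<Omega>. 0 < u z" using lsc y unfolding lsc_on_def P_def by blast
    then obtain d2 where d2: "0 < d2" "\<And>z. z \<in> \<Omega> \<Longrightarrow> z \<noteq> y \<Longrightarrow> dist z y < d2 \<Longrightarrow> 0 < u z"
      unfolding eventually_at by blast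
    have "z \<in> P" if z: "dist z y < min d1 d2" for z
    proof -
      have "z \<in> \<Omega>" using d1(2) z by (auto simp: dist_commute)
      then show ?thesis using d2(2)[of z] z y by (cases "z = y") (auto simp: P_def)
    qed
    then show "\<exists>e>0. \<forall>z. dist z y < e \<longrightarrow> z \<in> P" using d1(1) d2(1) by (intro exI[of _ "min d1 d2"]) auto
  qed
  \<comment> \<open>Otherwise \<open>P\<close> and its complement in \<Omega> would both be open,
    against connectedness.\<close>
  have "\<exists>z\<in>\<Omega> - P. z \<in> closure P"
  proof (rule ccontr)
    assume neg: "\<not> ?thesis"
    have "open (\<Omega> - closure P)" using \<Omega>(1) by (intro open_Diff) auto
    moreover have "\<Omega> - closure P = \<Omega> - P" using neg closure_subset by blast
    ultimately have "open (\<Omega> - P)" by simp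
    then have "P \<inter> \<Omega> = {} \<or> (\<Omega> - P) \<inter> \<Omega> = {}"
      using connectedD[OF \<Omega>(2) Popen, of "\<Omega> - P"] by blast
    then show False using Pne x ux by (auto simp: P_def)
  qed
  then obtain z0 where z0: "z0 \<in> \<Omega>" "z0 \<notin> P" "z0 \<in> closure P" by blast
  obtain r0 where r0: "0 < r0" "ball z0 r0 \<subseteq> \<Omega>" using \<Omega>(1) z0(1) by (auto simp: open_contains_ball)
  \<comment> \<open>Close enough to \<open>z0\<close> for the closed ball about \<open>y\<close>
    through \<open>z0\<close> to stay in \<Omega>, so that the nearest zero found in it is a point
    of \<Omega>.\<close>
  obtain y where y: "y \<in> P" "dist y z0 < r0 / 2"
    using z0(3) r0(1) unfolding closure_approachable by (meson half_gt_zero)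
  have near: "w \<in> \<Omega>" if "dist y w \<le> dist y z0" for w
  proof -
    have "dist z0 w < r0" using that y(2) dist_triangle[of z0 w y] by (simp add: dist_commute)
    then show ?thesis using r0(2) by auto
  qed
  define K where "K = cball y (dist y z0) - P"
  have K: "closed K" "z0 \<in> K" using Popen z0(2) by (auto simp: K_def closed_Diff)
  obtain x0 where x0: "x0 \<in> K" "\<And>w. w \<in> K \<Longrightarrow> dist y x0 \<le> dist y w"
    using distance_attains_inf[of K y] K by blast
  define r where "r = dist x0 y"
  have rz: "r \<le> dist y z0" using x0(2)[OF K(2)] by (simp add: r_def dist_commute)
  have x0P: "x0 \<in> \<Omega>" "u x0 = 0"
  proof -
    show "x0 \<in> \<Omega>" using near[of x0] rz by (simp add: r_def dist_commute)
    then show "u x0 = 0" using x0(1) nonneg[of x0] by (auto simp: K_def P_def less_le)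
  qed
  have r: "0 < r" using x0(1) y(1) by (auto simp: r_def K_def)
  have ballP: "w \<in> P" if "dist y w < r" for w
    using x0(2)[of w] that rz by (force simp: K_def r_def dist_commute)
  \<comment> \<open>(1 - 1 / (4 N))^2 >= 1 - 1 / (2 N), which is the condition of
    \<open>ray_hits_ball\<close> for a point at distance r from the centre.\<close>
  define \<rho> where "\<rho> = r * (1 - 1 / (4 * ?N))"
  have \<rho>: "0 < \<rho>" "\<rho> < r" "(dist x0 y)\<^sup>2 * (1 - 1 / (2 * ?N)) \<le> \<rho>\<^sup>2"
  proof -
    have "1 < real CARD('n) * 4" using N by linarith
    then have "1 / (4 * ?N) < 1" "0 < 1 / (4 * ?N)" by (auto simp: field_simps)
    then show "0 < \<rho>" "\<rho> < r" using r by (auto simp: \<rho>_def)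
    have "1 - 1 / (2 * ?N) \<le> (1 - 1 / (4 * ?N))\<^sup>2"
      using N by (simp add: power2_eq_square field_simps)
    then show "(dist x0 y)\<^sup>2 * (1 - 1 / (2 * ?N)) \<le> \<rho>\<^sup>2"
      by (simp add: \<rho>_def r_def power_mult_distrib mult_left_mono)
  qed
  have cP: "cball y \<rho> \<subseteq> P" using ballP \<rho>(2) by auto
  obtain \<mu> where \<mu>: "0 < \<mu>" "\<And>w. w \<in> cball y \<rho> \<Longrightarrow> \<mu> \<le> u w"
  proof -
    have "\<exists>\<mu>>0. \<forall>w\<in>cball y \<rho>. \<mu> \<le> u w"
      using cP by (intro lsc_on_pos_lower_bound[OF compact_cball _ lsc]) (auto simp: P_def)
    then show ?thesis using that by blast
  qed
  have l: "0 < ray_width ?N" using N by (simp add: ray_width_def)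
  have "\<mu> * (gain_const s (ray_width ?N) * r powr (- 2 * s)) \<le> ?N * 0"
  proof (rule supersolution_gain_le[OF s u x0P(1), where \<rho> = "r / ?N" and \<phi> = "\<lambda>x. 0" and G = "\<lambda>\<xi> t. 0"])
    show "0 < r / ?N" using r N by simp
    show "C2_on (\<lambda>x. 0) (ball x0 (r / ?N))" by (rule C2_on_const)
    show "u x0 - 0 \<le> u w - 0" for w using nonneg x0P by simp
    show "set_integrable lborel {0<..} (\<lambda>t. 0) \<and> - 0 \<le> (LBINT t:{0<..}. (0 :: real))"
      by (simp add: set_integrable_def set_lebesgue_integral_def)
    show "0 \<le> delta (\<lambda>x. 0) x0 (t *\<^sub>R \<xi>) / t powr (1 + 2 * s)" for t and \<xi> :: "real ^ 'n"
      by (simp add: delta_def)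
    show "0 \<le> delta u x0 (t *\<^sub>R \<xi>) / t powr (1 + 2 * s)" for t and \<xi> :: "real ^ 'n"
      using nonneg x0P by (simp add: delta_def)
    show "0 < ray_width ?N" "0 < \<mu>" by (fact l, fact \<mu>)
  next
    fix \<xi> :: "'n \<Rightarrow> real ^ 'n" assume \<xi>: "\<xi> \<in> orthonormal_bases"
    have "x0 \<noteq> y" using r by (auto simp: r_def)
    from orthonormal_basis_ray_hits_ball[OF \<xi> this \<rho>(1,3)]
    obtain i \<kappa> \<sigma> where q: "\<sigma> = 1 \<or> \<sigma> = - 1" "\<kappa> \<le> r" "r \<le> ?N * \<kappa>"
      "\<And>t. t \<in> {\<kappa>..\<kappa> * (1 + ray_width ?N)} \<Longrightarrow> x0 + (\<sigma> * t) *\<^sub>R \<xi> i \<in> ball y \<rho>"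
      unfolding r_def by metis
    have "r / ?N \<le> \<kappa>" using q(3) N by (simp add: field_simps)
    moreover have "0 + \<mu> / t powr (1 + 2 * s) \<le> delta u x0 (t *\<^sub>R \<xi> i) / t powr (1 + 2 * s)"
      if t: "t \<in> {\<kappa>..\<kappa> * (1 + ray_width ?N)}" for t
    proof -
      have "\<mu> \<le> u (x0 + (\<sigma> * t) *\<^sub>R \<xi> i)" using q(4)[OF t] \<mu>(2) by auto
      then have "\<mu> \<le> delta u x0 (t *\<^sub>R \<xi> i)"
        using q(1) nonneg[of "x0 + t *\<^sub>R \<xi> i"] nonneg[of "x0 - t *\<^sub>R \<xi> i"] x0P by (auto simp: delta_def)
      then show ?thesis by (simp add: divide_right_mono)
    qed
    ultimately show "\<exists>i a. r / ?N \<le> a \<and> a \<le> r \<and> (\<forall>t\<in>{a..a * (1 + ray_width ?N)}.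
        0 + \<mu> / t powr (1 + 2 * s) \<le> delta u x0 (t *\<^sub>R \<xi> i) / t powr (1 + 2 * s))"
      using q(2) by blast
  qed
  moreover have "0 < \<mu> * (gain_const s (ray_width ?N) * r powr (- 2 * s))"
    using \<mu>(1) l r by (intro mult_pos_pos) (auto simp: gain_const_def)
  ultimately show False by simp
qed


section \<open>The barrier in a ball\<close>

lemma C2_on_ball_barrier:
  fixes z :: "'a::euclidean_space"
  assumes r: "0 < r"
  shows "C2_on (\<lambda>x. \<eta> * (r\<^sup>2 - (norm (x - z))\<^sup>2) powr s) (ball z r)"
proof -
  define w where "w = (\<lambda>x. r\<^sup>2 - (norm (x - z))\<^sup>2)"
  have w: "0 < w x" if "x \<in> ball z r" for x
  proof -
    have "(norm (x - z))\<^sup>2 < r\<^sup>2"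
      using that r by (intro power_strict_mono) (auto simp: dist_norm norm_minus_commute)
    then show ?thesis by (simp add: w_def)
  qed
  have dw: "(w has_derivative (\<lambda>h. - 2 * ((x - z) \<bullet> h))) (at x)" for x
    unfolding w_def power2_norm_eq_inner
    by (auto intro!: derivative_eq_intros simp: algebra_simps inner_commute)
  have dpow: "((\<lambda>x. w x powr e) has_derivative (\<lambda>h. (e * w x powr (e - 1)) * (- 2 * ((x - z) \<bullet> h)))) (at x)"
    if "x \<in> ball z r" for x e
  proof -
    have "((\<lambda>t. t powr e) has_derivative (\<lambda>h. e * w x powr (e - 1) * h)) (at (w x))"
      using has_real_derivative_powr[OF w[OF that], of e] by (simp add: has_field_derivative_def)
    from has_derivative_compose[OF dw this] show ?thesis by simp
  qed
  have cw: "continuous_on (ball z r) w"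
    unfolding w_def by (intro continuous_intros)
  have cpow: "continuous_on (ball z r) (\<lambda>x. w x powr e)" for e
    using w cw by (intro continuous_intros) (auto dest: w)
  define Dv where "Dv = (\<lambda>x. (- 2 * \<eta> * s * w x powr (s - 1)) *\<^sub>R (x - z))"
  \<comment> \<open>A multiple of the identity plus a rank-one term along x - z; the negative powers
    of \<open>w\<close> confine it to the open ball.\<close>
  define D2v where "D2v = (\<lambda>x. (- 2 * \<eta> * s * w x powr (s - 1)) *\<^sub>R (id_blinfun :: 'a \<Rightarrow>\<^sub>L 'a)
      + (4 * \<eta> * s * (s - 1) * w x powr (s - 2)) *\<^sub>R (blinfun_scaleR_left (x - z) o\<^sub>L blinfun_inner_right (x - z)))"
  have "((\<lambda>x. \<eta> * w x powr s) has_derivative (\<lambda>h. Dv x \<bullet> h)) (at x)" if "x \<in> ball z r" for x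
  proof -
    have "((\<lambda>x. \<eta> * w x powr s) has_derivative (\<lambda>h. \<eta> * ((s * w x powr (s - 1)) * (- 2 * ((x - z) \<bullet> h))))) (at x)"
      by (intro has_derivative_mult_right dpow that)
    moreover have "(\<lambda>h. \<eta> * ((s * w x powr (s - 1)) * (- 2 * ((x - z) \<bullet> h)))) = (\<lambda>h. Dv x \<bullet> h)"
      by (simp add: Dv_def mult_ac fun_eq_iff)
    ultimately show ?thesis by simp
  qed
  moreover have "(Dv has_derivative blinfun_apply (D2v x)) (at x)" if "x \<in> ball z r" for x
  proof -
    have "((\<lambda>x. (- 2 * \<eta> * s) * w x powr (s - 1)) has_derivative
        (\<lambda>h. (- 2 * \<eta> * s) * (((s - 1) * w x powr (s - 1 - 1)) * (- 2 * ((x - z) \<bullet> h))))) (at x)"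
      by (intro has_derivative_mult_right dpow that)
    moreover have "((\<lambda>x. x - z) has_derivative (\<lambda>h. h)) (at x)"
      by (auto intro!: derivative_eq_intros)
    ultimately have "(Dv has_derivative (\<lambda>h. ((- 2 * \<eta> * s) * w x powr (s - 1)) *\<^sub>R h
        + ((- 2 * \<eta> * s) * (((s - 1) * w x powr (s - 1 - 1)) * (- 2 * ((x - z) \<bullet> h)))) *\<^sub>R (x - z))) (at x)"
      unfolding Dv_def by (rule has_derivative_scaleR)
    moreover have "(\<lambda>h. ((- 2 * \<eta> * s) * w x powr (s - 1)) *\<^sub>R h
        + ((- 2 * \<eta> * s) * (((s - 1) * w x powr (s - 1 - 1)) * (- 2 * ((x - z) \<bullet> h)))) *\<^sub>R (x - z)) = blinfun_apply (D2v x)"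
    proof
      fix h
      have e: "s - 1 - 1 = s - 2" by simp
      show "((- 2 * \<eta> * s) * w x powr (s - 1)) *\<^sub>R h
        + ((- 2 * \<eta> * s) * (((s - 1) * w x powr (s - 1 - 1)) * (- 2 * ((x - z) \<bullet> h)))) *\<^sub>R (x - z) = blinfun_apply (D2v x) h"
        unfolding D2v_def e
        by (simp only: blinfun.add_left blinfun.scaleR_left blinfun_apply_blinfun_compose id_blinfun.rep_eq
            blinfun_scaleR_left.rep_eq blinfun_inner_right.rep_eq scaleR_scaleR) (simp add: mult_ac)
    qed
    ultimately show ?thesis by simp
  qed
  moreover have "continuous_on (ball z r) D2v"
    unfolding D2v_def
    by (intro continuous_intros cpow bounded_linear.continuous_on[OF bounded_linear_blinfun_scaleR_left]
        bounded_linear.continuous_on[OF bounded_linear_blinfun_inner_right]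
        bounded_bilinear.continuous_on[OF bounded_bilinear_blinfun_compose])
  ultimately have "C2_on (\<lambda>x. \<eta> * w x powr s) (ball z r)"
    unfolding C2_on_def by blast
  then show ?thesis by (simp add: w_def)
qed

text \<open>
  On a line through \<open>x\<close> the ball barrier factors as \<open>((p - \<tau>)\<^sub>+ (q + \<tau>)\<^sub>+)\<^sup>s\<close>, where \<open>p\<close> and \<open>- q\<close>
  are the parameters at which the line leaves the ball, so the bound of \<open>barrier_line\<close> is uniform.
\<close>
lemma ball_barrier_line:
  fixes x z \<xi> :: "'a::real_inner"
  assumes s: "0 < s" "s < 1" and x: "x \<in> ball z r" and \<xi>: "norm \<xi> = 1"
  defines "v \<equiv> \<lambda>y. (max 0 (r\<^sup>2 - (norm (y - z))\<^sup>2)) powr s"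
  shows "\<exists>G. set_integrable lborel {0<..} G \<and> - (2 / s + 2 / (1 - s)) \<le> (LBINT t:{0<..}. G t) \<and>
    (\<forall>t>0. G t \<le> delta v x (t *\<^sub>R \<xi>) / t powr (1 + 2 * s))"
proof -
  define b where "b = (x - z) \<bullet> \<xi>"
  define c where "c = r\<^sup>2 - (norm (x - z))\<^sup>2"
  have "norm (x - z) < r" using x by (simp add: dist_norm norm_minus_commute)
  then have c: "0 < c" using power_strict_mono[of "norm (x - z)" r 2] by (simp add: c_def)
  \<comment> \<open>- b - q and - b + q are the roots of c - 2 t b - t^2, the base of the power
    along the line; the line therefore leaves the ball at the parameters q - b and - (q +
    b).\<close>
  define q where "q = sqrt (b\<^sup>2 + c)"
  have q2: "q\<^sup>2 = b\<^sup>2 + c" using c by (simp add: q_def)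
  have "\<bar>b\<bar> < q" unfolding q_def using c by (intro real_less_rsqrt) simp
  then have pq: "0 < q - b" "0 < q + b" by auto
  have line: "v (x + t *\<^sub>R \<xi>) = (max 0 (q - b - t) * max 0 (q + b + t)) powr s" for t
  proof -
    have \<xi>\<xi>: "\<xi> \<bullet> \<xi> = 1" using \<xi> by (simp add: dot_square_norm)
    have "x + t *\<^sub>R \<xi> - z = (x - z) + t *\<^sub>R \<xi>" by simp
    then have "(norm (x + t *\<^sub>R \<xi> - z))\<^sup>2 = (x - z) \<bullet> (x - z) + 2 * t * b + t * t * (\<xi> \<bullet> \<xi>)"
      unfolding power2_norm_eq_inner b_def
      by (simp only: inner_add_left inner_add_right inner_scaleR_left inner_scaleR_right inner_commute[of \<xi> "x - z"])
        (simp add: algebra_simps)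
    then have "r\<^sup>2 - (norm (x + t *\<^sub>R \<xi> - z))\<^sup>2 = c - 2 * t * b - t * t"
      unfolding \<xi>\<xi> by (simp add: c_def power2_norm_eq_inner)
    also have "\<dots> = (q - b - t) * (q + b + t)"
      using q2 by (simp add: power2_eq_square algebra_simps)
    finally have e: "r\<^sup>2 - (norm (x + t *\<^sub>R \<xi> - z))\<^sup>2 = (q - b - t) * (q + b + t)" .
    \<comment> \<open>Two factors with positive sum are not both negative, so truncation commutes
      with the product. Here the sum is 2 q.\<close>
    have "max 0 (A * B) = max 0 A * max 0 B" if "0 < A + B" for A B :: real
    proof (cases "0 \<le> A"; cases "0 \<le> B")
      assume "0 \<le> A" "0 \<le> B" then show ?thesis by simp
    next
      assume "0 \<le> A" "\<not> 0 \<le> B" then show ?thesis using mult_nonneg_nonpos[of A B] by (simp add: max_absorb1)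
    next
      assume "\<not> 0 \<le> A" "0 \<le> B" then show ?thesis using mult_nonneg_nonpos[of B A] by (simp add: max_absorb1 mult.commute)
    qed (use that in auto)
    from this[of "q - b - t" "q + b + t"] show ?thesis
      using pq unfolding v_def e by simp
  qed
  obtain G where G: "set_integrable lborel {0<..} G" "- (2 / s + 2 / (1 - s)) \<le> (LBINT t:{0<..}. G t)"
    "\<And>t. 0 < t \<Longrightarrow> G t \<le> ((max 0 (q - b - t) * max 0 (q + b + t)) powr s
        + (max 0 (q - b - (- t)) * max 0 (q + b + (- t))) powr s
        - 2 * (max 0 (q - b - 0) * max 0 (q + b + 0)) powr s) / t powr (1 + 2 * s)"
    using barrier_line[OF s pq] by blast
  have "delta v x (t *\<^sub>R \<xi>) = (max 0 (q - b - t) * max 0 (q + b + t)) powr s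
        + (max 0 (q - b - (- t)) * max 0 (q + b + (- t))) powr s
        - 2 * (max 0 (q - b - 0) * max 0 (q + b + 0)) powr s" for t
    using line[of t] line[of "- t"] line[of 0] by (simp add: delta_def)
  then show ?thesis using G by (intro exI[of _ G]) auto
qed

text \<open>If \<open>v\<close> exceeded \<open>u\<close> somewhere, the negative minimum of
  \<open>u - v\<close> on the closed ball would be global, since outside \<open>v\<close> is 0 and
  \<open>u\<close> is nonnegative. It would lie outside the inner ball, where u >= \<mu> and v <=
  \<mu> / 2. Touching by \<open>v\<close> costs a multiple of \<eta> and gains \<mu> / 2 on the
  inner ball, against \<open>\<eta>_small\<close>.\<close>

lemma barrier_comparison:
  fixes u :: "real ^ 'n \<Rightarrow> real"
  assumes s: "0 < s" "s < 1" and u: "visc_supersolution s \<Omega> u" and nonneg: "\<And>x. 0 \<le> u x"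
    and r: "0 < r" "cball z r \<subseteq> \<Omega>" and \<mu>: "0 < \<mu>"
    and inner: "\<And>y. y \<in> cball z (r * (1 - 1 / (4 * real CARD('n)))) \<Longrightarrow> \<mu> \<le> u y"
    and \<eta>: "0 < \<eta>" "\<eta> * (r\<^sup>2) powr s \<le> \<mu> / 2"
    and \<eta>_small: "real CARD('n) * (\<eta> * (2 / s + 2 / (1 - s)))
        < \<mu> / 2 * (gain_const s (ray_width (real CARD('n))) * r powr (- 2 * s))"
    and x: "x \<in> ball z r"
  shows "\<eta> * (r\<^sup>2 - (norm (x - z))\<^sup>2) powr s \<le> u x"
proof -
  let ?N = "real CARD('n)"
  have N: "1 \<le> ?N" by (simp add: Suc_leI)
  have lsc: "lsc_on u \<Omega>" using u by (auto simp: visc_supersolution_def)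
  define w where "w = (\<lambda>y. (max 0 (r\<^sup>2 - (norm (y - z))\<^sup>2)) powr s)"
  define v where "v = (\<lambda>y. \<eta> * w y)"
  define \<theta> where "\<theta> = r * (1 - 1 / (4 * ?N))"
  have sq: "0 < r\<^sup>2 - (norm (y - z))\<^sup>2 \<longleftrightarrow> y \<in> ball z r" for y
  proof -
    have "(norm (y - z))\<^sup>2 < r\<^sup>2 \<longleftrightarrow> norm (y - z) < r"
      using r(1) power_strict_mono[of "norm (y - z)" r 2] power2_less_imp_less[of "norm (y - z)" r] by auto
    then show ?thesis by (simp add: dist_norm norm_minus_commute)
  qed
  have v_out: "v y = 0" if "y \<notin> ball z r" for y
  proof -
    have "max 0 (r\<^sup>2 - (norm (y - z))\<^sup>2) = 0" using sq[of y] that by (simp add: max_def)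
    then show ?thesis by (simp add: v_def w_def)
  qed
  have v_in: "v y = \<eta> * (r\<^sup>2 - (norm (y - z))\<^sup>2) powr s" if "y \<in> ball z r" for y
    using sq[of y] that by (simp add: v_def w_def)
  have v_le: "v y \<le> \<mu> / 2" for y
  proof -
    have "w y \<le> (r\<^sup>2) powr s" unfolding w_def using s by (intro powr_mono2) auto
    then have "v y \<le> \<eta> * (r\<^sup>2) powr s" unfolding v_def using \<eta>(1) by simp
    then show ?thesis using \<eta>(2) by simp
  qed
  have "v y \<le> u y" for y
  proof (rule ccontr)
    assume neg: "\<not> v y \<le> u y"
    have yb: "y \<in> cball z r" using neg v_out[of y] nonneg[of y] by force
    have "continuous_on (cball z r) (\<lambda>y. - v y)"
      unfolding v_def w_def using s by (intro continuous_intros continuous_on_powr') auto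
    from lsc_on_add_attains_min[OF compact_cball _ r(2) lsc this] r(1)
    obtain x0 where x0: "x0 \<in> cball z r" "\<And>y. y \<in> cball z r \<Longrightarrow> u x0 + - v x0 \<le> u y + - v y"
      by fastforce
    have lt: "u x0 - v x0 < 0" using x0(2)[OF yb] neg by simp
    have glob: "u x0 - v x0 \<le> u y - v y" for y
    proof (cases "y \<in> cball z r")
      case False
      then have "y \<notin> ball z r" by auto
      then show ?thesis using v_out nonneg[of y] lt by simp
    qed (use x0(2) in force)
    have x0b: "x0 \<in> ball z r" using lt v_out[of x0] nonneg[of x0] by force
    have x0o: "x0 \<notin> cball z \<theta>"
      using lt v_le[of x0] inner[of x0] \<mu> by (force simp: \<theta>_def)
    have x0\<Omega>: "x0 \<in> \<Omega>" using x0(1) r(2) by blast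
    \<comment> \<open>The first bound keeps the test ball where the barrier is C^2; the second keeps
      it off the inner ball, so that the gain occurs at parameters of at least \<rho>.\<close>
    define \<rho> where "\<rho> = min (r - dist z x0) (dist z x0 - \<theta>)"
    have \<rho>: "0 < \<rho>" using x0b x0o by (simp add: \<rho>_def)
    have sub: "ball x0 \<rho> \<subseteq> ball z r"
    proof
      fix y assume "y \<in> ball x0 \<rho>"
      then show "y \<in> ball z r" using dist_triangle[of z y x0] by (simp add: \<rho>_def)
    qed
    have C2: "C2_on v (ball x0 \<rho>)"
    proof -
      obtain Df and D2f :: "real ^ 'n \<Rightarrow> (real ^ 'n) \<Rightarrow>\<^sub>L (real ^ 'n)" where
        1: "\<forall>y\<in>ball x0 \<rho>. ((\<lambda>y. \<eta> * (r\<^sup>2 - (norm (y - z))\<^sup>2) powr s) has_derivative (\<lambda>h. Df y \<bullet> h)) (at y)" and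
        2: "\<forall>y\<in>ball x0 \<rho>. (Df has_derivative blinfun_apply (D2f y)) (at y)" "continuous_on (ball x0 \<rho>) D2f"
        using C2_on_subset[OF C2_on_ball_barrier[OF r(1)] sub] unfolding C2_on_def by blast
      have "(v has_derivative (\<lambda>h. Df y \<bullet> h)) (at y)" if y: "y \<in> ball x0 \<rho>" for y
      proof (rule has_derivative_transform_within_open[OF bspec[OF 1 y] open_ball y])
        show "\<eta> * (r\<^sup>2 - (norm (a - z))\<^sup>2) powr s = v a" if "a \<in> ball x0 \<rho>" for a
          using v_in[of a] sub that by auto
      qed
      then show ?thesis using 2 unfolding C2_on_def by blast
    qed
    have "\<exists>G. set_integrable lborel {0<..} G \<and> - (2 / s + 2 / (1 - s)) \<le> (LBINT t:{0<..}. G t) \<and>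
      (\<forall>t>0. G t \<le> delta w x0 (t *\<^sub>R \<xi>) / t powr (1 + 2 * s))" if "norm \<xi> = 1" for \<xi>
      using ball_barrier_line[OF s x0b that] unfolding w_def .
    then obtain H where H: "\<And>\<xi>. norm \<xi> = 1 \<Longrightarrow> set_integrable lborel {0<..} (H \<xi>) \<and>
        - (2 / s + 2 / (1 - s)) \<le> (LBINT t:{0<..}. H \<xi> t) \<and>
        (\<forall>t>0. H \<xi> t \<le> delta w x0 (t *\<^sub>R \<xi>) / t powr (1 + 2 * s))"
      by metis
    define G where "G = (\<lambda>\<xi> t. \<eta> * H \<xi> t)"
    have Gv: "G \<xi> t \<le> delta v x0 (t *\<^sub>R \<xi>) / t powr (1 + 2 * s)" if "norm \<xi> = 1" "0 < t" for \<xi> t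
    proof -
      have "G \<xi> t \<le> \<eta> * (delta w x0 (t *\<^sub>R \<xi>) / t powr (1 + 2 * s))"
        unfolding G_def using H[OF that(1)] that(2) \<eta>(1) by (intro mult_left_mono) auto
      also have "\<dots> = delta v x0 (t *\<^sub>R \<xi>) / t powr (1 + 2 * s)"
        by (simp add: delta_def v_def algebra_simps)
      finally show ?thesis .
    qed
    have dvu: "delta v x0 y \<le> delta u x0 y" for y
      using glob[of "x0 + y"] glob[of "x0 - y"] by (simp add: delta_def)
    have "\<mu> / 2 * (gain_const s (ray_width ?N) * r powr (- 2 * s)) \<le> ?N * (\<eta> * (2 / s + 2 / (1 - s)))"
    proof (rule supersolution_gain_le[OF s u x0\<Omega> \<rho> C2, of G])
      show "u x0 - v x0 \<le> u y - v y" for y by (rule glob)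
      show "set_integrable lborel {0<..} (G \<xi>) \<and> - (\<eta> * (2 / s + 2 / (1 - s))) \<le> (LBINT t:{0<..}. G \<xi> t)"
        if "norm \<xi> = 1" for \<xi>
      proof -
        have "\<eta> * - (2 / s + 2 / (1 - s)) \<le> \<eta> * (LBINT t:{0<..}. H \<xi> t)"
          using H[OF that] \<eta>(1) by (intro mult_left_mono) auto
        then show ?thesis using H[OF that] unfolding G_def
          by (simp only: set_integral_mult_right mult_minus_right set_integrable_mult_right simp_thms)
      qed
      show "0 < ray_width ?N" using N by (simp add: ray_width_def)
      show "0 < \<mu> / 2" using \<mu> by simp
      show "G \<xi> t \<le> delta v x0 (t *\<^sub>R \<xi>) / t powr (1 + 2 * s)" if "norm \<xi> = 1" "0 < t" for \<xi> t
        by (rule Gv[OF that])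
      show "G \<xi> t \<le> delta u x0 (t *\<^sub>R \<xi>) / t powr (1 + 2 * s)" if "norm \<xi> = 1" "\<rho> \<le> t" for \<xi> t
        using Gv[OF that(1), of t] divide_right_mono[OF dvu[of "t *\<^sub>R \<xi>"], of "t powr (1 + 2 * s)"] that(2) \<rho> by simp
    next
      fix \<xi> :: "'n \<Rightarrow> real ^ 'n" assume \<xi>: "\<xi> \<in> orthonormal_bases"
      have \<theta>: "0 < \<theta>" "(dist x0 z)\<^sup>2 * (1 - 1 / (2 * ?N)) \<le> \<theta>\<^sup>2"
      proof -
        have "1 < real CARD('n) * 4" using N by linarith
        then show "0 < \<theta>" using r(1) by (auto simp: \<theta>_def field_simps)
        have "(dist x0 z)\<^sup>2 \<le> r\<^sup>2" using x0b by (intro power_mono) (auto simp: dist_commute)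
        moreover have "1 - 1 / (2 * ?N) \<le> (1 - 1 / (4 * ?N))\<^sup>2"
          using N by (simp add: power2_eq_square field_simps)
        ultimately have "(dist x0 z)\<^sup>2 * (1 - 1 / (2 * ?N)) \<le> r\<^sup>2 * (1 - 1 / (4 * ?N))\<^sup>2"
        proof (rule mult_mono)
          have "1 \<le> 2 * ?N" using N by linarith
          then show "0 \<le> 1 - 1 / (2 * ?N)" by simp
        qed auto
        then show "(dist x0 z)\<^sup>2 * (1 - 1 / (2 * ?N)) \<le> \<theta>\<^sup>2"
          by (simp add: \<theta>_def power_mult_distrib)
      qed
      have "x0 \<noteq> z" using x0o \<theta>(1) by auto
      from orthonormal_basis_ray_hits_ball[OF \<xi> this \<theta>]
      obtain i \<kappa> \<sigma> where q: "\<sigma> = 1 \<or> \<sigma> = - 1" "0 < \<kappa>" "\<kappa> \<le> dist x0 z"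
        "\<And>t. t \<in> {\<kappa>..\<kappa> * (1 + ray_width ?N)} \<Longrightarrow> x0 + (\<sigma> * t) *\<^sub>R \<xi> i \<in> ball z \<theta>"
        by metis
      have "\<xi> i \<bullet> \<xi> i = 1" using \<xi> by (auto simp: orthonormal_bases_def)
      then have ni: "norm (\<xi> i) = 1" by (simp add: norm_eq_1)
      have l: "0 < ray_width ?N" using N by (simp add: ray_width_def)
      have "\<rho> \<le> \<kappa>"
      proof -
        have "x0 + (\<sigma> * \<kappa>) *\<^sub>R \<xi> i \<in> ball z \<theta>" using q(2,4) l by simp
        moreover have "dist x0 (x0 + (\<sigma> * \<kappa>) *\<^sub>R \<xi> i) = \<kappa>" using q(1,2) ni by (auto simp: dist_norm)
        ultimately have "dist z x0 - \<theta> \<le> \<kappa>"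
          using dist_triangle[of z x0 "x0 + (\<sigma> * \<kappa>) *\<^sub>R \<xi> i"] by (simp add: dist_commute)
        then show ?thesis by (simp add: \<rho>_def)
      qed
      moreover have "\<kappa> \<le> r" using q(3) x0b by (simp add: dist_commute)
      moreover have "G (\<xi> i) t + \<mu> / 2 / t powr (1 + 2 * s) \<le> delta u x0 (t *\<^sub>R \<xi> i) / t powr (1 + 2 * s)"
        if t: "t \<in> {\<kappa>..\<kappa> * (1 + ray_width ?N)}" for t
      proof -
        have "x0 + (\<sigma> * t) *\<^sub>R \<xi> i \<in> cball z \<theta>" using q(4)[OF t] by auto
        then have "\<mu> / 2 \<le> u (x0 + (\<sigma> * t) *\<^sub>R \<xi> i) - v (x0 + (\<sigma> * t) *\<^sub>R \<xi> i)"
          using inner v_le[of "x0 + (\<sigma> * t) *\<^sub>R \<xi> i"] unfolding \<theta>_def by fastforce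
        then have "delta v x0 (t *\<^sub>R \<xi> i) + \<mu> / 2 \<le> delta u x0 (t *\<^sub>R \<xi> i)"
          using q(1) glob[of "x0 + t *\<^sub>R \<xi> i"] glob[of "x0 - t *\<^sub>R \<xi> i"] lt by (auto simp: delta_def)
        from divide_right_mono[OF this, of "t powr (1 + 2 * s)"]
        show ?thesis using Gv[OF ni, of t] t q(2) by (simp add: add_divide_distrib)
      qed
      ultimately show "\<exists>i a. \<rho> \<le> a \<and> a \<le> r \<and> (\<forall>t\<in>{a..a * (1 + ray_width ?N)}.
          G (\<xi> i) t + \<mu> / 2 / t powr (1 + 2 * s) \<le> delta u x0 (t *\<^sub>R \<xi> i) / t powr (1 + 2 * s))"
        by blast
    qed
    then show False using \<eta>_small by simp
  qed
  then show ?thesis using v_in[OF x] by metis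
qed

section \<open>Comparison with interior balls up to the boundary\<close>

theorem proposition4p9:
  fixes s :: real and \<Omega> :: "(real ^ 'n::finite) set" and u :: "real ^ 'n \<Rightarrow> real"
  assumes "0 < s" and "s < 1"
    and "bounded_C2_domain \<Omega>"
    and "visc_supersolution s \<Omega> u"
    and "\<forall>x. x \<notin> \<Omega> \<longrightarrow> u x \<ge> 0"
    and "\<exists>x\<in>\<Omega>. u x \<noteq> 0"
  shows "\<exists>c>0. \<forall>x\<in>closure \<Omega>. u x \<ge> c * infdist x (frontier \<Omega>) powr s"
proof -
  let ?N = "real CARD('n)"
  let ?d = "\<lambda>x. infdist x (frontier \<Omega>)"
  have N: "1 \<le> ?N" by (simp add: Suc_leI)
  note s = assms(1,2)
  have \<Omega>: "open \<Omega>" "connected \<Omega>" "bounded \<Omega>" using assms(3) by (auto simp: bounded_C2_domain_def)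
  note fr = bounded_C2_domain_frontier[OF assms(3)]
  have lsc: "lsc_on u \<Omega>" using assms(4) by (auto simp: visc_supersolution_def)
  have nonneg: "0 \<le> u x" for x
    using weak_minimum_principle[OF s assms(3,4)] assms(5) by blast
  have pos: "0 < u x" if "x \<in> \<Omega>" for x
    using strong_minimum_principle[OF s \<Omega>(1,2) assms(4) nonneg assms(6) that] .
  obtain R where R: "0 < R" "\<forall>p\<in>frontier \<Omega>. \<exists>n. two_sided_ball \<Omega> R p n"
    using bounded_C2_domain_uniform_balls[OF assms(3)] by blast
  \<comment> \<open>All inner balls used below keep distance R / (4 N) from the frontier and so lie
    in this compact set, which gives one \<mu> for all of them and for the points far from the
    boundary.\<close>
  define K where "K = closure \<Omega> \<inter> {x. R / (4 * ?N) \<le> ?d x}"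
  have K: "compact K" "K \<subseteq> \<Omega>"
  proof -
    have "closed {x. R / (4 * ?N) \<le> ?d x}" by (intro closed_Collect_le continuous_intros)
    then show "compact K" unfolding K_def using \<Omega>(3) by (intro compact_Int_closed) (simp add: compact_closure)
    show "K \<subseteq> \<Omega>"
    proof
      fix x assume x: "x \<in> K"
      have "0 < R / (4 * ?N)" using R(1) N by simp
      then have "x \<notin> frontier \<Omega>" using x by (force simp: K_def)
      then show "x \<in> \<Omega>" using x interior_subset by (auto simp: K_def frontier_def)
    qed
  qed
  obtain \<mu> where \<mu>: "0 < \<mu>" "\<And>x. x \<in> K \<Longrightarrow> \<mu> \<le> u x"
    using lsc_on_pos_lower_bound[OF K lsc] pos K(2) by blast
  define c1 where "c1 = 2 / s + 2 / (1 - s)"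
  have c1: "0 < c1" using s by (simp add: c1_def add_pos_pos)
  define g where "g = gain_const s (ray_width ?N) * R powr (- 2 * s)"
  have g: "0 < g" unfolding g_def using R(1) by (intro mult_pos_pos gain_const_pos ray_width_pos) auto
  \<comment> \<open>Both smallness conditions of \<open>barrier_comparison\<close> at radius
    \<open>R\<close>. They carry over to all r < R because r^2 is smaller and r^(-2s) larger; the 4
    in place of 2 makes the second one strict.\<close>
  define \<eta> where "\<eta> = min (\<mu> / (2 * (R\<^sup>2) powr s)) (\<mu> * g / (4 * ?N * c1))"
  have \<eta>: "0 < \<eta>" "\<eta> \<le> \<mu> / (2 * (R\<^sup>2) powr s)" "\<eta> \<le> \<mu> * g / (4 * ?N * c1)"
    using \<mu>(1) R(1) g N c1 by (auto simp: \<eta>_def)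
  have near: "\<eta> * (R / 4) powr s * ?d x powr s \<le> u x" if x: "x \<in> \<Omega>" and dR: "?d x < R" for x
  proof -
    define d where "d = ?d x"
    obtain p n where d: "0 < d" and n: "two_sided_ball \<Omega> R p n" and xp: "x = p + d *\<^sub>R n"
      using nearest_frontier_point[OF \<Omega>(1) fr x R] unfolding d_def by blast
    have n1: "norm n = 1" and BR: "ball (p + R *\<^sub>R n) R \<subseteq> \<Omega>" using n by (auto simp: two_sided_ball_def)
    define z where "z = p + R *\<^sub>R n"
    have zR: "ball z R \<subseteq> \<Omega>" using BR by (simp add: z_def)
    have "x - z = (d - R) *\<^sub>R n" by (simp add: xp z_def algebra_simps)
    then have xz: "norm (x - z) = R - d" using n1 dR by (simp add: d_def)
    \<comment> \<open>Below \<open>R\<close>, so that the closed ball lies in \<Omega>, where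
      semicontinuity is available, yet with \<open>x\<close> still at depth d / 2 inside.\<close>
    define r where "r = R - d / 2"
    have r: "0 < r" "r < R" "R - d < r" using d dR by (auto simp: r_def d_def)
    have "\<eta> * (r\<^sup>2 - (norm (x - z))\<^sup>2) powr s \<le> u x"
    proof (rule barrier_comparison[OF s assms(4) nonneg r(1) _ \<mu>(1) _ \<eta>(1)])
      show "cball z r \<subseteq> \<Omega>" using zR r(2) by (auto simp: subset_iff)
      show "\<mu> \<le> u y" if y: "y \<in> cball z (r * (1 - 1 / (4 * ?N)))" for y
      proof (rule \<mu>(2))
        have "1 \<le> 4 * ?N" using N by linarith
        then have "1 / (4 * ?N) \<le> 1" by simp
        then have "r * (1 - 1 / (4 * ?N)) \<le> R * (1 - 1 / (4 * ?N))" using r by (intro mult_right_mono) auto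
        then have dzy: "dist z y \<le> R - R / (4 * ?N)" using y by (simp add: algebra_simps)
        have "ball y (R / (4 * ?N)) \<subseteq> ball z R"
        proof
          fix a assume "a \<in> ball y (R / (4 * ?N))"
          then show "a \<in> ball z R" using dzy dist_triangle[of z a y] by simp
        qed
        then have b: "ball y (R / (4 * ?N)) \<subseteq> \<Omega>" using zR by blast
        have "0 < R / (4 * ?N)" using R(1) N by simp
        then have "y \<in> \<Omega>" using b by (meson centre_in_ball subsetD)
        then show "y \<in> K" using infdist_frontier_ge[OF \<Omega>(1) fr b] closure_subset by (auto simp: K_def)
      qed
      have "(r\<^sup>2) powr s \<le> (R\<^sup>2) powr s" using r s by (intro powr_mono2 power_mono) auto
      then have "\<eta> * (r\<^sup>2) powr s \<le> \<mu> / (2 * (R\<^sup>2) powr s) * (R\<^sup>2) powr s"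
        using \<eta>(2) \<mu>(1) by (intro mult_mono) auto
      then show "\<eta> * (r\<^sup>2) powr s \<le> \<mu> / 2" using R(1) by simp
      have "R powr (- 2 * s) \<le> r powr (- 2 * s)" using r s by (intro powr_mono2') auto
      then have gr: "g \<le> gain_const s (ray_width ?N) * r powr (- 2 * s)"
        unfolding g_def by (intro mult_left_mono less_imp_le[OF gain_const_pos] ray_width_pos)
      have "?N * (\<eta> * c1) \<le> ?N * (\<mu> * g / (4 * ?N * c1) * c1)"
        using \<eta>(3) c1 by (intro mult_left_mono mult_right_mono) auto
      also have "\<dots> = \<mu> * g / 4" using N c1 by simp
      also have "\<dots> < \<mu> / 2 * g" using \<mu>(1) g by simp
      also have "\<dots> \<le> \<mu> / 2 * (gain_const s (ray_width ?N) * r powr (- 2 * s))"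
        using gr \<mu>(1) by (intro mult_left_mono) auto
      finally show "?N * (\<eta> * (2 / s + 2 / (1 - s))) < \<mu> / 2 * (gain_const s (ray_width ?N) * r powr (- 2 * s))"
        unfolding c1_def .
      show "x \<in> ball z r" using xz r(3) by (simp add: dist_norm norm_minus_commute)
    qed
    \<comment> \<open>The base at \<open>x\<close> factors into r - (R - d) = d / 2 and r + (R - d)
      = 2 R - 3 d / 2, the latter at least R / 2 as d < R. The power \<open>s\<close> of the
      distance comes from the first factor.\<close>
    moreover have "(R / 4 * d) powr s \<le> (r\<^sup>2 - (norm (x - z))\<^sup>2) powr s"
    proof (rule powr_mono2)
      have "r\<^sup>2 - (norm (x - z))\<^sup>2 = d / 2 * (2 * R - 3 / 2 * d)"
        unfolding xz by (simp add: r_def power2_eq_square algebra_simps)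
      moreover have "d / 2 * (R / 2) \<le> d / 2 * (2 * R - 3 / 2 * d)"
        using d dR by (intro mult_left_mono) (auto simp: d_def)
      ultimately show "R / 4 * d \<le> r\<^sup>2 - (norm (x - z))\<^sup>2" by simp
    qed (use s R(1) d in auto)
    ultimately have "\<eta> * (R / 4 * d) powr s \<le> u x"
      using \<eta>(1) by (meson mult_left_mono less_imp_le order_trans)
    then show ?thesis unfolding powr_mult d_def mult.assoc .
  qed
  obtain b where b: "0 < b" "\<And>x. x \<in> \<Omega> \<Longrightarrow> ?d x \<le> b"
  proof -
    obtain p where p: "p \<in> frontier \<Omega>" using fr by blast
    have "bounded (closure \<Omega>)" using \<Omega>(3) by (rule bounded_closure)
    then obtain B where B: "\<And>x. x \<in> closure \<Omega> \<Longrightarrow> dist p x \<le> B"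
      using bounded_any_center[of "closure \<Omega>" p] by blast
    have "?d x \<le> max 1 B" if "x \<in> \<Omega>" for x
      using infdist_le[OF p, of x] B[of x] that closure_subset[of \<Omega>] by (force simp: dist_commute)
    then show ?thesis using that[of "max 1 B"] by simp
  qed
  \<comment> \<open>The barrier decides for d < R; otherwise u >= \<mu> while d <= b.\<close>
  define c where "c = min (\<eta> * (R / 4) powr s) (\<mu> / b powr s)"
  have c: "0 < c" "c \<le> \<eta> * (R / 4) powr s" "c \<le> \<mu> / b powr s"
    using \<eta>(1) R(1) \<mu>(1) b(1) by (auto simp: c_def)
  have "c * ?d x powr s \<le> u x" if x: "x \<in> closure \<Omega>" for x
  proof (cases "x \<in> \<Omega>")
    case False
    then have "x \<in> frontier \<Omega>" using x \<Omega>(1) by (simp add: frontier_def interior_open)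
    \<comment> \<open>On the frontier the distance is 0 and \<open>0 powr s = 0\<close>, so only
      nonnegativity is claimed.\<close>
    then show ?thesis using nonneg[of x] by simp
  next
    case True
    show ?thesis
    proof (cases "?d x < R")
      case True
      have "c * ?d x powr s \<le> \<eta> * (R / 4) powr s * ?d x powr s"
        using c(2) by (intro mult_right_mono) auto
      then show ?thesis using near[OF \<open>x \<in> \<Omega>\<close> True] by simp
    next
      case False
      have "1 \<le> 4 * ?N" using N by linarith
      then have "R / (4 * ?N) \<le> R / 1" using R(1) by (intro divide_left_mono) auto
      then have "x \<in> K" using False x by (simp add: K_def)
      have "c * ?d x powr s \<le> \<mu> / b powr s * b powr s"
        using c(1,3) b(2)[OF \<open>x \<in> \<Omega>\<close>] s infdist_nonneg[of x "frontier \<Omega>"] \<mu>(1)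
        by (intro mult_mono powr_mono2) auto
      also have "\<dots> = \<mu>" using b(1) by simp
      also have "\<dots> \<le> u x" using \<mu>(2)[OF \<open>x \<in> K\<close>] .
      finally show ?thesis .
    qed
  qed
  then show ?thesis using c(1) by blast
qed

end
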